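(* Let $\Omega\subset\mathbb{R}^n$ be a bounded domain and suppose that a nonparametric minimal submanifold $\Sigma$ is the graph of a distance-decreasing map $f:\Omega\subset\mathbb{R}^n\to\mathbb{R}^m$. Then $\Sigma$ is stable. It is strictly stable if $f$ is strictly distance-decreasing.
   Context: A $C^2$ vector-valued function $f=(f^1,\dots,f^m):\Omega\to\mathbb{R}^m$ on a bounded domain $\Omega\subset\mathbb{R}^n$ is a solution to the minimal surface system if $$\sum_{i,j=1}^n\frac{\partial}{\partial x^i}\left(\sqrt{g}\,g^{ij}\frac{\partial f^\alpha}{\partial x^j}\right)=0\quad\text{for each }\alpha=1,\dots,m,$$ where $g_{ij}=\delta_{ij}+\sum_\alpha\frac{\partial f^\alpha}{\partial x^i}\frac{\partial f^\alpha}{\partial x^j}$, $g=\det(g_{ij})$ and $(g^{ij})$ is the inverse matrix of $(g_{ij})$. The graph $\{(x,f(x)):x\in\Omega\}\subset\mathbb{R}^n\times\mathbb{R}^m$ of such an $f$ is called a nonparametric minimal submanifold; the system is the Euler-Lagrange equation of the volume functional $\int_\Omega\sqrt{g}\,dx^1\wedge\cdots\wedge dx^n$. A map $f:\Omega\to\mathbb{R}^m$ is called distance-decreasing if $|df(v)|\le|v|$ at each point of $\Omega$ for every nonzero $v\in\mathbb{R}^n$, and strictly distance-decreasing if $|df(v)|<|v|$ at each point of $\Omega$ for every nonzero $v\in\mathbb{R}^n$. A minimal submanifold is called stable if the second derivative (at time $0$) of the volume functional with respect to any compactly supported normal variation is non-negative. It is called strictly stable if this second derivative is positive for every compactly supported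 normal variation whose variation field is not identically zero. *)

theory Defs
  imports "HOL-Analysis.Analysis"
begin

definition pderiv_at :: "'n \<Rightarrow> (real^'n \<Rightarrow> 'a::real_normed_vector) \<Rightarrow> real^'n \<Rightarrow> 'a" where
  "pderiv_at i u x = frechet_derivative u (at x) (axis i 1)"

text \<open>In finite dimension, continuity of the derivative is equivalent to continuity of all
  directional derivatives. The two predicates below are meant for open sets.\<close>

definition C1_on :: "'a::euclidean_space set \<Rightarrow> ('a \<Rightarrow> 'b::real_normed_vector) \<Rightarrow> bool" where
  "C1_on S u \<longleftrightarrow> (\<forall>x\<in>S. u differentiable (at x)) \<and>
     (\<forall>v. continuous_on S (\<lambda>x. frechet_derivative u (at x) v))"

definition C2_on :: "'a::euclidean_space set \<Rightarrow> ('a \<Rightarrow> 'b::real_normed_vector) \<Rightarrow> bool" where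
  "C2_on S u \<longleftrightarrow> C1_on S u \<and> (\<forall>v. C1_on S (\<lambda>x. frechet_derivative u (at x) v))"

definition graph_metric :: "(real^'n \<Rightarrow> real^'m) \<Rightarrow> real^'n \<Rightarrow> real^'n^'n" where
  "graph_metric f x = (\<chi> i j. (if i = j then 1 else 0) +
     (\<Sum>\<alpha>\<in>UNIV. pderiv_at i (\<lambda>y. f y $ \<alpha>) x * pderiv_at j (\<lambda>y. f y $ \<alpha>) x))"

definition minimal_surface_solution ::
  "(real^'n) set \<Rightarrow> (real^'n \<Rightarrow> real^'m) \<Rightarrow> bool" where
  "minimal_surface_solution \<Omega> f \<longleftrightarrow> C2_on \<Omega> f \<and>
     (\<forall>x\<in>\<Omega>. \<forall>\<alpha>. (\<Sum>i\<in>UNIV. \<Sum>j\<in>UNIV.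
        pderiv_at i (\<lambda>y. sqrt (det (graph_metric f y)) * matrix_inv (graph_metric f y) $ i $ j
                        * pderiv_at j (\<lambda>z. f z $ \<alpha>) y) x) = 0)"

definition distance_decreasing ::
  "(real^'n) set \<Rightarrow> (real^'n \<Rightarrow> real^'m) \<Rightarrow> bool" where
  "distance_decreasing \<Omega> f \<longleftrightarrow>
     (\<forall>x\<in>\<Omega>. \<forall>v. v \<noteq> 0 \<longrightarrow> norm (frechet_derivative f (at x) v) \<le> norm v)"

definition strictly_distance_decreasing ::
  "(real^'n) set \<Rightarrow> (real^'n \<Rightarrow> real^'m) \<Rightarrow> bool" where
  "strictly_distance_decreasing \<Omega> f \<longleftrightarrow>
     (\<forall>x\<in>\<Omega>. \<forall>v. v \<noteq> 0 \<longrightarrow> norm (frechet_derivative f (at x) v) < norm v)"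

text \<open>Submanifolds are given by a parametrization \<open>X\<close> over \<open>\<Omega>\<close>; the graph of \<open>f\<close> is
  parametrized by \<open>graph_map f\<close>, and a map defined on the graph is identified with
  its pull-back to \<open>\<Omega>\<close>.\<close>

definition graph_map :: "(real^'n \<Rightarrow> real^'m) \<Rightarrow> real^'n \<Rightarrow> (real^'n) \<times> (real^'m)" where
  "graph_map f x = (x, f x)"

definition volume_density :: "(real^'n \<Rightarrow> 'a::euclidean_space) \<Rightarrow> real^'n \<Rightarrow> real" where
  "volume_density Y x = sqrt (det (\<chi> i j. pderiv_at i Y x \<bullet> pderiv_at j Y x))"

definition volume_over :: "(real^'n) set \<Rightarrow> (real^'n \<Rightarrow> 'a::euclidean_space) \<Rightarrow> real" where
  "volume_over K Y = integral K (volume_density Y)"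

definition time_deriv :: "(real \<Rightarrow> 'b \<Rightarrow> 'a::real_normed_vector) \<Rightarrow> real \<Rightarrow> 'b \<Rightarrow> 'a" where
  "time_deriv F t x = vector_derivative (\<lambda>s. F s x) (at t)"

definition C1_family_on ::
  "real set \<Rightarrow> (real^'n) set \<Rightarrow> (real \<Rightarrow> real^'n \<Rightarrow> 'a::euclidean_space) \<Rightarrow> bool" where
  "C1_family_on I \<Omega> G \<longleftrightarrow>
     continuous_on (I \<times> \<Omega>) (\<lambda>(t, x). G t x) \<and>
     (\<forall>t\<in>I. \<forall>x\<in>\<Omega>. G t differentiable (at x)) \<and>
     (\<forall>v. continuous_on (I \<times> \<Omega>) (\<lambda>(t, x). frechet_derivative (G t) (at x) v))"

text \<open>A variation for times in \<open>{-\<epsilon><..<\<epsilon>}\<close>, supported in the compact set \<open>K\<close>, whose variation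
  field at time \<open>0\<close> is normal. The maps \<open>F\<close>, \<open>\<partial>\<^sub>tF\<close>, \<open>\<partial>\<^sub>t\<^sup>2F\<close> are required to be \<open>C\<^sup>1\<close> in the
  space variable, with joint continuity. This makes the volume twice
  differentiable in time and includes all jointly \<open>C\<^sup>3\<close> (in particular smooth) variations. Joint
  smoothness is not demanded because \<open>F 0 = X\<close> is only assumed \<open>C\<^sup>2\<close> and its normal fields
  are then a priori only \<open>C\<^sup>1\<close>.\<close>

definition normal_variation ::
  "(real^'n) set \<Rightarrow> (real^'n \<Rightarrow> 'a::euclidean_space) \<Rightarrow> real \<Rightarrow> (real^'n) set \<Rightarrow>
   (real \<Rightarrow> real^'n \<Rightarrow> 'a) \<Rightarrow> bool" where
  "normal_variation \<Omega> X \<epsilon> K F \<longleftrightarrow>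
     \<epsilon> > 0 \<and> compact K \<and> K \<subseteq> \<Omega> \<and>
     (\<forall>t\<in>{-\<epsilon><..<\<epsilon>}. \<forall>x\<in>\<Omega>. (\<lambda>s. F s x) differentiable (at t) \<and>
                           (\<lambda>s. time_deriv F s x) differentiable (at t)) \<and>
     C1_family_on {-\<epsilon><..<\<epsilon>} \<Omega> F \<and>
     C1_family_on {-\<epsilon><..<\<epsilon>} \<Omega> (time_deriv F) \<and>
     C1_family_on {-\<epsilon><..<\<epsilon>} \<Omega> (time_deriv (time_deriv F)) \<and>
     (\<forall>x\<in>\<Omega>. F 0 x = X x) \<and>
     (\<forall>t\<in>{-\<epsilon><..<\<epsilon>}. \<forall>x\<in>\<Omega> - K. F t x = X x) \<and>
     (\<forall>x\<in>\<Omega>. \<forall>v. time_deriv F 0 x \<bullet> frechet_derivative X (at x) v = 0)"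

definition has_second_derivative :: "(real \<Rightarrow> real) \<Rightarrow> real \<Rightarrow> real \<Rightarrow> bool" where
  "has_second_derivative A D t \<longleftrightarrow>
     (\<exists>A'. (\<forall>\<^sub>F s in nhds t. (A has_real_derivative A' s) (at s)) \<and>
           (A' has_real_derivative D) (at t))"

text \<open>The volume is taken over the support \<open>K\<close> of the variation: outside \<open>K\<close> nothing
  moves, so when the total volume over \<open>\<Omega>\<close> is finite this changes it only by a constant, and it
  also makes sense when the total volume is infinite.\<close>

definition stable_immersion :: "(real^'n) set \<Rightarrow> (real^'n \<Rightarrow> 'a::euclidean_space) \<Rightarrow> bool" where
  "stable_immersion \<Omega> X \<longleftrightarrow> (\<forall>\<epsilon> K F. normal_variation \<Omega> X \<epsilon> K F \<longrightarrow>
     (\<exists>D. has_second_derivative (\<lambda>t. volume_over K (F t)) D 0 \<and> D \<ge> 0))"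

definition strictly_stable_immersion :: "(real^'n) set \<Rightarrow> (real^'n \<Rightarrow> 'a::euclidean_space) \<Rightarrow> bool" where
  "strictly_stable_immersion \<Omega> X \<longleftrightarrow> (\<forall>\<epsilon> K F. normal_variation \<Omega> X \<epsilon> K F \<and>
     (\<exists>x\<in>\<Omega>. time_deriv F 0 x \<noteq> 0) \<longrightarrow>
     (\<exists>D. has_second_derivative (\<lambda>t. volume_over K (F t)) D 0 \<and> D > 0))"

end

theory Submission
  imports Defs
begin

text \<open>Write \<open>F\<^sub>t = (P\<^sub>t, Q\<^sub>t)\<close> for a variation of the graph and \<open>\<Phi>(p) = sqrt (det (1 + p\<^sup>T p))\<close> for the area
  density. For small \<open>t\<close> the map \<open>P\<^sub>t\<close> is a diffeomorphism, so \<open>F\<^sub>t\<close> parametrizes the graph of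
  \<open>h\<^sub>t = Q\<^sub>t \<circ> P\<^sub>t\<^sup>-\<^sup>1\<close>, the volume at time \<open>t\<close> is the integral of \<open>\<Phi>(Dh\<^sub>t)\<close>, and \<open>Dh\<^sub>t - Df = O(t)\<close>. The second
  derivative of \<open>\<Phi>\<close> at \<open>p\<close> is non-negative when all singular values of \<open>p\<close> are at most \<open>1\<close>, and it is
  bounded below by \<open>- O(t)\<close> when they are at most \<open>1 + O(t)\<close>. The minimal surface system says that the
  integral of \<open>D\<Phi>(Df)(Dh\<^sub>t - Df)\<close> vanishes, so the volume \<open>A\<close> satisfies \<open>A(t) \<ge> A(0) - O(|t|\<^sup>3)\<close>, which forces
  \<open>A'(0) = 0\<close> and \<open>A''(0) \<ge> 0\<close>. In the strict case the convexity is uniform on the support and yields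
  \<open>A(t) \<ge> A(0) + k \<integral>|D(h\<^sub>t - f)|\<^sup>2\<close>. By the Poincare inequality this exceeds \<open>A(0) + c t\<^sup>2\<close>, because the vertical
  part of a normal field vanishes only where the field does.\<close>

section \<open>Linear algebra of graph metrics\<close>

text \<open>The threshold 1 comes from a competition between two terms in the second derivative of
  the density. The negative term is governed by the eigenvalues \<lambda>^2/(1+\<lambda>^2), counted
  twice, and 1 - 2\<lambda>^2/(1+\<lambda>^2) = (1-\<lambda>^2)/(1+\<lambda>^2). The obstacle is
  regularity. Each h_t is obtained by inverting P_t at a fixed time. It is differentiable in space
  with Dh_t close to Df, but continuity of Dh_t and regularity of h_t in t are never established.
  The divergence theorem, the Poincare inequality and the change of variables are therefore set up
  for functions with merely bounded derivatives, and the first-order behaviour in time is read off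
  from \<open>height\<close>, which is expressed through \<open>F\<close> and \<open>f\<close>
  alone. Since Dh_t lives at the moved point P_t x, comparing it with Df there costs one derivative
  of Df, which the C^2 hypothesis supplies.\<close>

definition gmet :: "real^'n^'m \<Rightarrow> real^'n^'n" where
  "gmet p = mat 1 + transpose p ** p"

lemma inner_matrix_vector_transpose:
  fixes A :: "real^'n^'m"
  shows "w \<bullet> (A *v v) = (transpose A *v w) \<bullet> v"
  by (simp add: dot_lmul_matrix)

lemma inner_gmet:
  fixes p :: "real^'n^'m"
  shows "v \<bullet> (gmet p *v v) = v \<bullet> v + (p *v v) \<bullet> (p *v v)"
proof -
  have "v \<bullet> (transpose p *v (p *v v)) = (p *v v) \<bullet> (p *v v)"
    by (metis inner_matrix_vector_transpose transpose_transpose)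
  then show ?thesis
    unfolding gmet_def by (simp add: matrix_vector_mult_add_rdistrib inner_add_right 
        del: transpose_matrix_vector flip: matrix_vector_mul_assoc)
qed

lemma transpose_plus: "transpose (A + B) = transpose A + transpose (B :: 'a::ab_semigroup_add^'n^'m)"
  by (simp add: transpose_def vec_eq_iff)

lemma matrix_add_rdistrib: "(A + B) ** C = A ** C + B ** (C :: 'a::semiring_1^'p^'n)"
  by (simp add: matrix_matrix_mult_def vec_eq_iff sum.distrib distrib_right)

lemma transpose_gmet [simp]: "transpose (gmet p) = gmet p"
  by (simp add: gmet_def transpose_plus matrix_transpose_mul)

lemma invertible_gmet: "invertible (gmet p)"
proof -
  have "v = 0" if "gmet p *v v = 0" for v
  proof -
    have "v \<bullet> v + (p *v v) \<bullet> (p *v v) = 0"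
      using inner_gmet[of v p] that by simp
    then show "v = 0"
      by (smt (verit) inner_ge_zero inner_gt_zero_iff)
  qed
  then have "\<exists>B. B ** gmet p = mat 1"
    using matrix_left_invertible_ker by blast
  then show ?thesis
    by (simp add: invertible_left_inverse)
qed

lemma matrix_inv_mult:
  fixes A :: "real^'n^'n"
  assumes "invertible A"
  shows "A ** matrix_inv A = mat 1" "matrix_inv A ** A = mat 1"
proof -
  have "A ** matrix_inv A = mat 1 \<and> matrix_inv A ** A = mat 1"
    unfolding matrix_inv_def by (rule someI_ex) (use assms invertible_def in blast)
  then show "A ** matrix_inv A = mat 1" "matrix_inv A ** A = mat 1" by auto
qed

text \<open>Eigenvalues are avoided: along the segment from \<open>0\<close> to \<open>p\<close> the
  determinant never vanishes, since every \<open>gmet\<close> is invertible, and it equals 1 at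
  \<open>0\<close>, so the intermediate value theorem excludes a non-positive value at
  \<open>p\<close>.\<close>

lemma det_gmet_pos: "det (gmet p) > 0"
proof -
  have ne: "det (gmet (s *\<^sub>R p)) \<noteq> 0" for s
    using invertible_gmet invertible_det_nz by blast
  have cont: "continuous_on {0..1} (\<lambda>s::real. det (gmet (s *\<^sub>R p)))"
    unfolding det_def gmet_def matrix_matrix_mult_def transpose_def mat_def
    by (simp, intro continuous_intros)
  show ?thesis
  proof (rule ccontr)
    assume "\<not> ?thesis"
    then have "det (gmet (1 *\<^sub>R p)) \<le> 0" by simp
    moreover have "det (gmet (0 *\<^sub>R p)) \<ge> 0"
    proof -
      have "transpose (0 *\<^sub>R p) ** (0 *\<^sub>R p) = 0"
        by (simp add: matrix_matrix_mult_def zero_vec_def)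
      then have "gmet (0 *\<^sub>R p) = mat 1" by (simp add: gmet_def)
      then show ?thesis by simp
    qed
    ultimately obtain s where "det (gmet (s *\<^sub>R p)) = 0"
      using IVT2'[OF _ _ _ cont, of 0] by auto
    then show False using ne by blast
  qed
qed

definition ginv :: "real^'n^'m \<Rightarrow> real^'n^'n" where
  "ginv p = matrix_inv (gmet p)"

lemma ginv_mult: "gmet p ** ginv p = mat 1" "ginv p ** gmet p = mat 1"
  unfolding ginv_def by (simp_all add: matrix_inv_mult invertible_gmet)

lemma transpose_ginv [simp]: "transpose (ginv p) = ginv p"
proof -
  have "transpose (gmet p ** ginv p) = mat 1"
    by (simp add: ginv_mult)
  then have "transpose (ginv p) ** gmet p = mat 1"
    by (simp add: matrix_transpose_mul)
  then have "transpose (ginv p) ** gmet p ** ginv p = ginv p"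
    by simp
  then show ?thesis
    by (metis ginv_mult(1) matrix_mul_assoc matrix_mul_rid)
qed

text \<open>This replaces a square root of the positive definite matrix \<open>ginv p\<close>:
  sandwiching 1 + p^T p between two copies of its inverse writes the inverse as a sum of two Gram
  matrices, which is the form in which traces against \<open>ginv p\<close> are seen to be
  non-negative.\<close>

lemma ginv_decompose:
  "ginv p = ginv p ** ginv p + transpose (p ** ginv p) ** (p ** ginv p)"
proof -
  have "ginv p = ginv p ** gmet p ** ginv p"
    by (simp add: ginv_mult)
  also have "\<dots> = ginv p ** ginv p + transpose (p ** ginv p) ** (p ** ginv p)"
    unfolding gmet_def
    by (simp add: matrix_add_ldistrib matrix_add_rdistrib matrix_transpose_mul matrix_mul_assoc)
  finally show ?thesis .
qed

lemma matrix_mult_entry_right: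
  fixes S :: "real^'n^'m" and Y :: "real^'n^'n"
  shows "(S ** Y ** transpose S) $ k $ k = (\<Sum>i\<in>UNIV. S $ k $ i * (Y *v S $ k) $ i)"
proof -
  have "(S ** Y ** transpose S) $ k $ k = (\<Sum>j\<in>UNIV. (\<Sum>i\<in>UNIV. S $ k $ i * Y $ i $ j) * S $ k $ j)"
    by (simp add: matrix_matrix_mult_def transpose_def)
  also have "\<dots> = (\<Sum>j\<in>UNIV. \<Sum>i\<in>UNIV. S $ k $ i * (Y $ i $ j * S $ k $ j))"
    by (simp add: sum_distrib_right mult.assoc)
  also have "\<dots> = (\<Sum>i\<in>UNIV. \<Sum>j\<in>UNIV. S $ k $ i * (Y $ i $ j * S $ k $ j))"
    by (rule sum.swap)
  finally show ?thesis
    by (simp add: matrix_vector_mult_def sum_distrib_left)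
qed

lemma trace_sandwich_nonneg:
  fixes S :: "real^'n^'m" and Y :: "real^'n^'n"
  assumes "\<And>v. v \<bullet> (Y *v v) \<ge> 0"
  shows "trace (transpose S ** S ** Y) \<ge> 0"
proof -
  have "trace (transpose S ** S ** Y) = trace (S ** Y ** transpose S)"
    by (metis matrix_mul_assoc trace_mul_sym)
  also have "\<dots> = (\<Sum>k\<in>UNIV. (S $ k) \<bullet> (Y *v (S $ k)))"
    by (simp add: trace_def inner_vec_def matrix_mult_entry_right)
  also have "\<dots> \<ge> 0"
    by (simp add: assms sum_nonneg)
  finally show ?thesis .
qed

lemma trace_ginv_nonneg:
  assumes "\<And>v. v \<bullet> (Y *v v) \<ge> 0"
  shows "trace (ginv p ** Y) \<ge> 0"
proof -
  have "ginv p ** Y = transpose (ginv p) ** ginv p ** Y + transpose (p ** ginv p) ** (p ** ginv p) ** Y"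
    using arg_cong[OF ginv_decompose, of "\<lambda>Z. Z ** Y"] by (simp only: matrix_add_rdistrib transpose_ginv)
  then show ?thesis
    using trace_sandwich_nonneg[OF assms, where S = "ginv p"]
      trace_sandwich_nonneg[OF assms, where S = "p ** ginv p"] by (simp add: trace_add)
qed

text \<open>The inverse metric is handled through \<open>z\<close>, the solution of (1 + p^T p) z =
  v: estimates for \<open>ginv p\<close> become estimates for \<open>p\<close> applied to
  \<open>z\<close>, without a spectral decomposition.\<close>

lemma inner_ginv:
  fixes p :: "real^'n^'m"
  assumes "z = ginv p *v v"
  shows "v = z + transpose p *v (p *v z)" and "v \<bullet> z = z \<bullet> z + (p *v z) \<bullet> (p *v z)"
proof -
  have "gmet p *v z = v"
    using assms by (simp add: ginv_mult matrix_vector_mul_assoc)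
  then show "v = z + transpose p *v (p *v z)"
    unfolding gmet_def by (simp add: matrix_vector_mult_add_rdistrib 
        del: transpose_matrix_vector flip: matrix_vector_mul_assoc)
  show "v \<bullet> z = z \<bullet> z + (p *v z) \<bullet> (p *v z)"
    using \<open>gmet p *v z = v\<close> inner_gmet[of z p] by (simp add: inner_commute)
qed

lemma inner_ginv_nonneg: "v \<bullet> (ginv p *v v) \<ge> 0"
  using inner_ginv(2)[OF refl, of v p] by simp

lemma inner_ginv_le: "v \<bullet> (ginv p *v v) \<le> v \<bullet> v"
proof -
  define z where "z = ginv p *v v"
  note z = inner_ginv[OF z_def]
  have "v \<bullet> z - z \<bullet> z \<ge> 0" using z(2) by simp
  moreover have "(v - z) \<bullet> (v - z) \<ge> 0" by simp
  ultimately show ?thesis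
    unfolding z_def[symmetric] by (simp add: inner_diff_left inner_diff_right inner_commute)
qed

text \<open>The sharp constant is 1/2. Pairing \<open>v\<close> with the equation for
  \<open>z\<close> and splitting the cross term by Cauchy-Schwarz gives 1/3; any positive constant
  serves for strict convexity, so the rounder 1/4 is stated.\<close>

lemma inner_ginv_ge:
  fixes p :: "real^'n^'m"
  assumes p: "\<And>v. norm (p *v v) \<le> norm v"
  shows "v \<bullet> (ginv p *v v) \<ge> v \<bullet> v / 4"
proof -
  define z where "z = ginv p *v v"
  note z = inner_ginv[OF z_def]
  have "v \<bullet> v = v \<bullet> (z + transpose p *v (p *v z))"
    using arg_cong[OF z(1), of "\<lambda>w. v \<bullet> w"] .
  also have "\<dots> = v \<bullet> z + (p *v v) \<bullet> (p *v z)"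
    by (simp add: inner_add_right inner_matrix_vector_transpose[of v] del: transpose_matrix_vector)
  also have "(p *v v) \<bullet> (p *v z) \<le> norm v * norm (p *v z)"
    by (rule order_trans[OF norm_cauchy_schwarz mult_right_mono[OF p norm_ge_zero]])
  also have "\<dots> \<le> (v \<bullet> v + (p *v z) \<bullet> (p *v z)) / 2"
    using sum_squares_bound[of "norm v" "norm (p *v z)"] by (simp add: power2_norm_eq_inner)
  finally have "v \<bullet> v \<le> v \<bullet> z + (v \<bullet> v + (p *v z) \<bullet> (p *v z)) / 2" by simp
  then show ?thesis
    using z(2) inner_ge_zero[of z] inner_ge_zero[of "p *v z"] unfolding z_def[symmetric] by argo
qed

text \<open>The eigenvalues of \<open>p g\<^sup>-\<^sup>1 p\<^sup>T\<close> are \<open>\<lambda>\<^sup>2 / (1 + \<lambda>\<^sup>2)\<close> for the singular values \<open>\<lambda>\<close> of \<open>p\<close>.\<close>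

lemma inner_ginv_transpose_le:
  fixes p :: "real^'n^'m"
  assumes L: "\<And>v. norm (p *v v) \<le> L * norm v"
  shows "(transpose p *v w) \<bullet> (ginv p *v (transpose p *v w)) \<le> L\<^sup>2 / (1 + L\<^sup>2) * (w \<bullet> w)"
proof -
  define v where "v = transpose p *v w"
  define z where "z = ginv p *v v"
  note z = inner_ginv[OF z_def]
  define b where "b = v \<bullet> z"
  have b0: "b \<ge> 0" using z(2) by (simp add: b_def)
  have "(norm (p *v z))\<^sup>2 \<le> (L * norm z)\<^sup>2"
    by (simp add: L power_mono)
  then have pz: "(p *v z) \<bullet> (p *v z) \<le> L\<^sup>2 * (z \<bullet> z)"
    by (simp add: power_mult_distrib power2_norm_eq_inner)
  have "b = w \<bullet> (p *v z)"
    unfolding b_def v_def by (simp only: inner_matrix_vector_transpose)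
  \<comment> \<open>Since b = |z|^2 + |p z|^2 and |p z| <= L |z|, also |p z|^2 <= L^2/(1+L^2) * b.
    Cauchy-Schwarz then bounds b^2 by a multiple of b, and one factor b cancels.\<close>
  then have "b\<^sup>2 \<le> (w \<bullet> w) * ((p *v z) \<bullet> (p *v z))"
    using Cauchy_Schwarz_ineq by metis
  also have "(1 + L\<^sup>2) * \<dots> \<le> (w \<bullet> w) * (L\<^sup>2 * b)"
  proof -
    have "(1 + L\<^sup>2) * ((p *v z) \<bullet> (p *v z)) \<le> L\<^sup>2 * b"
      using pz z(2) by (simp add: b_def algebra_simps)
    then show ?thesis
      by (metis inner_ge_zero mult.left_commute mult_left_mono)
  qed
  finally have "(1 + L\<^sup>2) * (b * b) \<le> (w \<bullet> w * L\<^sup>2) * b"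
    by (simp add: power2_eq_square mult.assoc)
      (smt (verit, best) mult_left_mono zero_le_square)
  then have "(1 + L\<^sup>2) * b \<le> w \<bullet> w * L\<^sup>2 \<or> b = 0"
    using b0 by (metis mult.assoc mult_le_cancel_right order_less_le)
  moreover have "1 + L\<^sup>2 > 0" by (simp add: add_pos_nonneg)
  ultimately have "b \<le> L\<^sup>2 / (1 + L\<^sup>2) * (w \<bullet> w)"
    by (auto simp: field_simps)
  then show ?thesis
    unfolding b_def v_def z_def .
qed

section \<open>The second-order form of the area density\<close>

lemma matrix_scaleR_ldistrib: "(c *\<^sub>R A) ** B = c *\<^sub>R (A ** (B :: real^'p^'n))"
  by (simp add: matrix_matrix_mult_def vec_eq_iff sum_distrib_left mult.assoc)

lemma matrix_scaleR_rdistrib: "A ** (c *\<^sub>R B) = c *\<^sub>R (A ** (B :: real^'p^'n))"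
  by (simp add: matrix_matrix_mult_def vec_eq_iff sum_distrib_left mult.left_commute)

lemma bounded_bilinear_matrix_mult:
  "bounded_bilinear ((**) :: real^'n^'m \<Rightarrow> real^'p^'n \<Rightarrow> real^'p^'m)"
proof -
  have "bilinear ((**) :: real^'n^'m \<Rightarrow> real^'p^'n \<Rightarrow> real^'p^'m)"
    unfolding bilinear_def
    by (auto intro!: linearI simp: matrix_add_ldistrib matrix_add_rdistrib
        matrix_scaleR_rdistrib matrix_scaleR_ldistrib)
  then show ?thesis
    by (simp add: bilinear_conv_bounded_bilinear)
qed

lemma bounded_linear_transpose: "bounded_linear (transpose :: real^'n^'m \<Rightarrow> real^'m^'n)"
  by (auto intro!: linearI simp: linear_conv_bounded_linear[symmetric] transpose_plus transpose_scalar)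

lemma trace_transpose: "trace (transpose A) = trace A"
  by (simp add: trace_def transpose_def)

lemma trace_scaleR: "trace (c *\<^sub>R A) = c * trace (A :: real^'n^'n)"
  by (simp add: trace_def sum_distrib_left)

lemma bounded_linear_trace: "bounded_linear (trace :: real^'n^'n \<Rightarrow> real)"
  by (auto intro!: linearI simp: linear_conv_bounded_linear[symmetric] trace_add trace_scaleR)

lemma transpose_minus: "transpose (A - B) = transpose A - transpose (B :: real^'n^'m)"
  by (simp add: transpose_def vec_eq_iff)

lemma matrix_diff_rdistrib: "(A - B) ** C = A ** C - B ** (C :: real^'p^'n)"
  by (simp add: matrix_matrix_mult_def vec_eq_iff sum_subtractf algebra_simps)

lemma matrix_diff_ldistrib: "C ** (A - B) = C ** A - (C :: real^'p^'n) ** B"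
  by (simp add: matrix_matrix_mult_def vec_eq_iff sum_subtractf algebra_simps)

lemma inner_gram:
  fixes r :: "real^'n^'m"
  shows "v \<bullet> ((transpose r ** r) *v v) = (r *v v) \<bullet> (r *v v)"
  by (metis inner_matrix_vector_transpose matrix_vector_mul_assoc transpose_transpose)

text \<open>With B = p^T r the symmetric matrix is S = B + B^T, and splitting off the antisymmetric
  A = B - B^T gives tr(KSKS) = 4 tr(K B^T K B) - tr(K A^T K A), where the last trace is
  non-negative. Moreover B^T K B = r^T (p K p^T) r is at most L^2/(1+L^2) r^T r as a quadratic form.
  The factor in the conclusion is 1 - 2 L^2/(1+L^2), non-negative precisely for |L| <= 1; this is
  where the distance-decreasing condition acts.\<close>

lemma second_order_form_ge:
  fixes p r :: "real^'n^'m"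
  assumes L: "\<And>v. norm (p *v v) \<le> L * norm v"
  defines "K \<equiv> ginv p" and "S \<equiv> transpose p ** r + transpose r ** p"
  shows "trace (K ** (transpose r ** r)) - trace (K ** S ** K ** S) / 2
    \<ge> (1 - L\<^sup>2) / (1 + L\<^sup>2) * trace (K ** (transpose r ** r))"
proof -
  define B where "B = transpose p ** r"
  define A where "A = B - transpose B"
  define T where "T = trace (K ** (transpose r ** r))"
  have S: "S = B + transpose B"
    by (simp add: S_def B_def matrix_transpose_mul)
  have cyc: "trace (K ** B ** K ** transpose B) = trace (K ** transpose B ** K ** B)"
    by (metis matrix_mul_assoc trace_mul_sym)
  have "trace (K ** S ** K ** S) + trace (K ** transpose A ** K ** A)
      = 2 * trace (K ** B ** K ** transpose B) + 2 * trace (K ** transpose B ** K ** B)"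
    unfolding S A_def transpose_minus transpose_transpose
      matrix_add_rdistrib matrix_diff_rdistrib matrix_add_ldistrib matrix_diff_ldistrib trace_add trace_sub
    by simp
  then have 1: "trace (K ** S ** K ** S) = 4 * trace (K ** transpose B ** K ** B)
      - trace (K ** transpose A ** K ** A)"
    using cyc by simp
  have "trace (K ** (transpose A ** K ** A)) \<ge> 0"
    unfolding K_def
  proof (rule trace_ginv_nonneg)
    fix v
    have "v \<bullet> (transpose A ** ginv p ** A *v v) = (A *v v) \<bullet> (ginv p *v (A *v v))"
      by (metis inner_matrix_vector_transpose matrix_vector_mul_assoc transpose_transpose)
    then show "v \<bullet> (transpose A ** ginv p ** A *v v) \<ge> 0"
      by (simp add: inner_ginv_nonneg)
  qed
  then have 2: "trace (K ** transpose A ** K ** A) \<ge> 0"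
    by (simp add: matrix_mul_assoc)
  define c where "c = L\<^sup>2 / (1 + L\<^sup>2)"
  have "trace (K ** (c *\<^sub>R (transpose r ** r) - transpose B ** K ** B)) \<ge> 0"
    unfolding K_def
  proof (rule trace_ginv_nonneg)
    fix v
    have "v \<bullet> (transpose B ** ginv p ** B *v v) = (B *v v) \<bullet> (ginv p *v (B *v v))"
      by (metis inner_matrix_vector_transpose matrix_vector_mul_assoc transpose_transpose)
    moreover have "B *v v = transpose p *v (r *v v)"
      by (simp add: B_def matrix_vector_mul_assoc del: transpose_matrix_vector)
    ultimately have "v \<bullet> (transpose B ** ginv p ** B *v v) \<le> c * ((r *v v) \<bullet> (r *v v))"
      unfolding c_def using inner_ginv_transpose_le[OF L] by metis
    then show "v \<bullet> ((c *\<^sub>R (transpose r ** r) - transpose B ** ginv p ** B) *v v) \<ge> 0"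
      using inner_gram[of v r]
      by (simp add: matrix_vector_mult_diff_rdistrib inner_diff_right scaleR_matrix_vector_assoc[symmetric]
        del: transpose_matrix_vector)
  qed
  then have 3: "trace (K ** transpose B ** K ** B) \<le> c * T"
    unfolding matrix_diff_ldistrib trace_sub T_def
    by (simp add: matrix_scaleR_rdistrib trace_scaleR matrix_mul_assoc)
  have pos: "1 + L\<^sup>2 > 0" by (simp add: add_pos_nonneg)
  have "(1 - L\<^sup>2) / (1 + L\<^sup>2) * T = T - 2 * (c * T)"
    unfolding c_def using pos by (simp add: field_simps)
  then show ?thesis
    using 1 2 3 unfolding T_def by linarith
qed

lemma trace_ginv_gram:
  fixes p :: "real^'n^'m" and r :: "real^'n^'k"
  shows "trace (ginv p ** (transpose r ** r)) = (\<Sum>a\<in>UNIV. (r $ a) \<bullet> (ginv p *v (r $ a)))"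
proof -
  have "trace (ginv p ** (transpose r ** r)) = trace (r ** ginv p ** transpose r)"
    by (metis matrix_mul_assoc trace_mul_sym)
  then show ?thesis
    by (simp add: trace_def inner_vec_def matrix_mult_entry_right)
qed

lemma trace_ginv_gram_nonneg: "trace (ginv p ** (transpose r ** r)) \<ge> 0"
  by (simp add: trace_ginv_gram sum_nonneg inner_ginv_nonneg)

lemma trace_ginv_gram_le: "trace (ginv p ** (transpose r ** r)) \<le> r \<bullet> r"
  unfolding trace_ginv_gram inner_vec_def[of r r] by (intro sum_mono inner_ginv_le)

lemma trace_ginv_gram_ge:
  assumes "\<And>v. norm (p *v v) \<le> norm v"
  shows "trace (ginv p ** (transpose r ** r)) \<ge> r \<bullet> r / 4"
  unfolding trace_ginv_gram inner_vec_def[of r r] sum_divide_distrib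
  by (intro sum_mono inner_ginv_ge[OF assms])

section \<open>Derivatives of determinants and inverse matrices\<close>

lemma matrix_inv_cramer:
  fixes A :: "real^'n^'n"
  assumes "det A \<noteq> 0"
  shows "matrix_inv A $ i $ j = det (\<chi> k l. if l = i then axis j 1 $ k else A $ k $ l) / det A"
proof -
  have "A *v (matrix_inv A *v axis j 1) = axis j 1"
    using assms by (simp add: matrix_inv_mult invertible_det_nz matrix_vector_mul_assoc)
  then have "matrix_inv A *v axis j 1 = (\<chi> k. det (\<chi> i l. if l = k then axis j 1 $ i else A $ i $ l) / det A)"
    using cramer[OF assms] by blast
  then have "(matrix_inv A *v axis j 1) $ i = det (\<chi> k l. if l = i then axis j 1 $ k else A $ k $ l) / det A"
    by simp
  then show ?thesis
    by (simp add: matrix_vector_mult_basis column_def)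
qed

lemma differentiable_prod:
  fixes f :: "'i \<Rightarrow> 'a::real_normed_vector \<Rightarrow> real"
  assumes "\<And>i. i \<in> I \<Longrightarrow> f i differentiable (at x)"
  shows "(\<lambda>x. \<Prod>i\<in>I. f i x) differentiable (at x)"
  using assms by (induction I rule: infinite_finite_induct) auto

lemma differentiable_det:
  fixes M :: "'a::real_normed_vector \<Rightarrow> real^'n^'n"
  assumes "\<And>i j. (\<lambda>x. M x $ i $ j) differentiable (at x)"
  shows "(\<lambda>x. det (M x)) differentiable (at x)"
  unfolding det_def
  by (intro differentiable_sum differentiable_mult differentiable_prod differentiable_const finite_permutations)
     (auto intro!: differentiable_prod assms)

text \<open>In the Leibniz sum a permutation other than the identity moves at least two indices.
  After one factor has been differentiated, an off-diagonal entry of the identity matrix is still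
  left and kills the summand, so only the diagonal contributes.\<close>

lemma has_real_derivative_det_at_mat1:
  fixes M :: "real \<Rightarrow> real^'n^'n"
  assumes M: "(M has_vector_derivative M') (at s)" and s: "M s = mat 1"
  shows "((\<lambda>s. det (M s)) has_real_derivative trace M') (at s)"
proof -
  have ent: "((\<lambda>s. M s $ i $ j) has_derivative (\<lambda>h. h * M' $ i $ j)) (at s)" for i j
  proof -
    have "((\<lambda>s. M s $ i $ j) has_vector_derivative M' $ i $ j) (at s)"
      using bounded_linear.has_vector_derivative[OF bounded_linear_compose[OF bounded_linear_vec_nth bounded_linear_vec_nth] M]
      by simp
    then show ?thesis by (simp add: has_vector_derivative_def)
  qed
  have prod0: "(\<Prod>j\<in>UNIV - {i}. M s $ j $ q j) = (if q = id then 1 else 0)"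
    if q: "q permutes UNIV" for q :: "'n \<Rightarrow> 'n" and i
  proof (cases "q = id")
    case False
    have "\<exists>j. j \<noteq> i \<and> q j \<noteq> j"
    proof (rule ccontr)
      assume "\<not> ?thesis"
      then have *: "q j = j" if "j \<noteq> i" for j using that by blast
      then have "q i = i" using q by (metis permutes_def)
      with * have "q x = x" for x by (cases "x = i") auto
      then have "q = id" by (simp add: fun_eq_iff)
      with False show False by simp
    qed
    then obtain j where "j \<noteq> i" "q j \<noteq> j" by blast
    then have "\<exists>j\<in>UNIV - {i}. M s $ j $ q j = 0"
      using s by (intro bexI[of _ j]) (auto simp: mat_def)
    then show ?thesis using False by (simp add: prod_zero_iff)
  qed (use s in \<open>simp add: mat_def\<close>)
  have summand: "of_int (sign q) * (\<Sum>i\<in>UNIV. h * M' $ i $ q i * (\<Prod>j\<in>UNIV - {i}. M s $ j $ q j))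
      = (if q = id then (\<Sum>i\<in>UNIV. h * M' $ i $ i) else 0)" if "q permutes UNIV" for q :: "'n \<Rightarrow> 'n" and h :: real
    using prod0[OF permutes_id] that by (cases "q = id") (simp_all add: prod0 sign_id)
  have "((\<lambda>s. det (M s)) has_derivative (\<lambda>h. \<Sum>q\<in>{q. q permutes UNIV}.
      of_int (sign q) * (\<Sum>i\<in>UNIV. h * M' $ i $ q i * (\<Prod>j\<in>UNIV - {i}. M s $ j $ q j)))) (at s)"
    unfolding det_def
    by (intro has_derivative_sum has_derivative_mult_right has_derivative_prod ent)
  also have "(\<lambda>h. \<Sum>q\<in>{q. q permutes UNIV}.
      of_int (sign q) * (\<Sum>i\<in>UNIV. h * M' $ i $ q i * (\<Prod>j\<in>UNIV - {i}. M s $ j $ q j)))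
    = (\<lambda>h. \<Sum>q\<in>{q :: 'n \<Rightarrow> 'n. q permutes UNIV}. if q = id then (\<Sum>i\<in>UNIV. h * M' $ i $ i) else 0)"
    by (intro ext sum.cong refl summand) simp
  also have "\<dots> = (\<lambda>h. h * trace M')"
    by (simp add: sum.delta' finite_permutations permutes_id trace_def sum_distrib_left)
  finally show ?thesis
    by (simp add: has_field_derivative_def mult_commute_abs)
qed

text \<open>Jacobi's formula, moved to the identity matrix by the factorization det (M t) = det (M
  s) * det (N ** M t).\<close>

lemma has_real_derivative_det:
  fixes M :: "real \<Rightarrow> real^'n^'n"
  assumes M: "(M has_vector_derivative M') (at s)" and N: "M s ** N = mat 1" "N ** M s = mat 1"
  shows "((\<lambda>s. det (M s)) has_real_derivative det (M s) * trace (N ** M')) (at s)"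
proof -
  have "((\<lambda>s. N ** M s) has_vector_derivative N ** M') (at s)"
    by (rule bounded_linear.has_vector_derivative[OF bounded_bilinear.bounded_linear_right[OF bounded_bilinear_matrix_mult] M])
  from has_real_derivative_det_at_mat1[OF this N(2)]
  have "((\<lambda>t. det (M s) * det (N ** M t)) has_real_derivative det (M s) * trace (N ** M')) (at s)"
    by (rule DERIV_cmult)
  moreover have "det (M s) * det (N ** M t) = det (M t)" for t
    by (metis N(1) det_mul matrix_mul_assoc matrix_mul_lid)
  ultimately show ?thesis by simp
qed

lemma has_vector_derivative_componentwise:
  fixes g :: "real \<Rightarrow> 'a::euclidean_space"
  assumes "\<And>b. b \<in> Basis \<Longrightarrow> ((\<lambda>s. g s \<bullet> b) has_real_derivative g' \<bullet> b) (at t)"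
  shows "(g has_vector_derivative g') (at t)"
  unfolding has_vector_derivative_def
  by (subst has_derivative_componentwise_within)
     (use assms in \<open>auto simp: has_field_derivative_def mult_commute_abs\<close>)

text \<open>Differentiability comes first, from Cramer's rule, which makes the entries of the
  inverse quotients of determinants. The value of the derivative is then forced by differentiating N
  M = 1.\<close>

lemma has_vector_derivative_matrix_inv:
  fixes M :: "real \<Rightarrow> real^'n^'n"
  assumes M: "(M has_vector_derivative M') (at s)" and inv: "\<And>t. invertible (M t)"
  defines "N \<equiv> \<lambda>t. matrix_inv (M t)"
  shows "(N has_vector_derivative - (N s ** M' ** N s)) (at s)"
proof -
  have dM: "(\<lambda>t. M t $ i $ j) differentiable (at s)" for i j
    using bounded_linear.has_vector_derivative[OF bounded_linear_compose[OF bounded_linear_vec_nth bounded_linear_vec_nth] M]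
    by (auto intro: differentiableI_vector)
  have nz: "det (M t) \<noteq> 0" for t
    using inv invertible_det_nz by blast
  have "(\<lambda>t. N t $ i $ j) differentiable (at s)" for i j
  proof -
    have "(\<lambda>t. (\<chi> k l. if l = i then axis j 1 $ k else M t $ k $ l) $ k $ l) differentiable (at s)" for k l
      by (cases "l = i") (simp_all add: dM)
    then show ?thesis
      unfolding N_def matrix_inv_cramer[OF nz]
      by (intro differentiable_divide differentiable_det nz dM) auto
  qed
  then have "\<exists>D. ((\<lambda>t. N t $ i $ j) has_vector_derivative D) (at s)" for i j
    using vector_derivative_works by blast
  then obtain D where "\<And>i j. ((\<lambda>t. N t $ i $ j) has_vector_derivative D i j) (at s)"
    by metis
  then have N: "(N has_vector_derivative (\<chi> i j. D i j)) (at s)"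
    by (intro has_vector_derivative_componentwise)
       (auto simp: Basis_vec_def inner_axis has_real_derivative_iff_has_vector_derivative)
  have NM: "N t ** M t = mat 1" "M t ** N t = mat 1" for t
    unfolding N_def by (simp_all add: inv matrix_inv_mult)
  have "((\<lambda>t. N t ** M t) has_vector_derivative N s ** M' + (\<chi> i j. D i j) ** M s) (at s)"
    by (rule bounded_bilinear.has_vector_derivative[OF bounded_bilinear_matrix_mult N M])
  then have "((\<lambda>t. mat 1) has_vector_derivative N s ** M' + (\<chi> i j. D i j) ** M s) (at s)"
    by (simp add: NM)
  moreover have "((\<lambda>t. mat 1 :: real^'n^'n) has_vector_derivative 0) (at s)"
    by (rule has_vector_derivative_const)
  ultimately have "(\<chi> i j. D i j) ** M s = - (N s ** M')"
    using vector_derivative_unique_at by (metis eq_neg_iff_add_eq_0 add.commute)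
  then have "(\<chi> i j. D i j) ** M s ** N s = - (N s ** M') ** N s"
    by simp
  then have "(\<chi> i j. D i j) = - (N s ** M' ** N s)"
    using bounded_bilinear.minus_left[OF bounded_bilinear_matrix_mult]
    by (metis NM(2) matrix_mul_assoc matrix_mul_rid)
  with N show ?thesis by simp
qed

section \<open>Convexity of the area density\<close>

definition area_density :: "real^'n^'m \<Rightarrow> real" where
  "area_density p = sqrt (det (gmet p))"

lemma area_density_pos: "area_density p > 0"
  by (simp add: area_density_def det_gmet_pos)

text \<open>This is the differential of \<open>area_density\<close> at \<open>p\<close>: pairing it
  with \<open>r\<close> under the trace gives the derivative in direction \<open>r\<close>. At the
  Jacobian of \<open>f\<close> its entries are the quantities whose divergence the minimal surface
  system sets to zero.\<close>

definition area_flux :: "real^'n^'m \<Rightarrow> real^'m^'n" where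
  "area_flux p = area_density p *\<^sub>R (ginv p ** transpose p)"

lemma has_vector_derivative_gmet_line:
  fixes p r :: "real^'n^'m"
  shows "((\<lambda>s. gmet (p + s *\<^sub>R r)) has_vector_derivative
    transpose (p + s *\<^sub>R r) ** r + transpose r ** (p + s *\<^sub>R r)) (at s)"
proof -
  have 1: "((\<lambda>s. p + s *\<^sub>R r) has_vector_derivative r) (at s)"
    by (auto intro!: derivative_eq_intros)
  have 2: "((\<lambda>s. transpose (p + s *\<^sub>R r)) has_vector_derivative transpose r) (at s)"
    by (rule bounded_linear.has_vector_derivative[OF bounded_linear_transpose 1])
  have "((\<lambda>s. transpose (p + s *\<^sub>R r) ** (p + s *\<^sub>R r)) has_vector_derivative
    transpose (p + s *\<^sub>R r) ** r + transpose r ** (p + s *\<^sub>R r)) (at s)"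
    by (rule bounded_bilinear.has_vector_derivative[OF bounded_bilinear_matrix_mult 2 1])
  from has_vector_derivative_add[OF has_vector_derivative_const[of "mat 1"] this]
  show ?thesis unfolding gmet_def by simp
qed

text \<open>\<open>\<tau>\<close> is the logarithmic derivative of the determinant of the metric
  along the line. In the second derivative its square enters with a positive sign and may be dropped
  in lower bounds; what remains is the form estimated in
  \<open>second_order_form_ge\<close>.\<close>

lemma area_density_line_derivs:
  fixes p r :: "real^'n^'m"
  defines "q \<equiv> \<lambda>s. p + s *\<^sub>R r"
  defines "S \<equiv> \<lambda>s. transpose (q s) ** r + transpose r ** q s"
  defines "\<tau> \<equiv> \<lambda>s. trace (ginv (q s) ** S s)"
  shows "((\<lambda>s. area_density (q s)) has_real_derivative area_density (q s) * \<tau> s / 2) (at s)" (is ?D1)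
    and "((\<lambda>s. area_density (q s) * \<tau> s / 2) has_real_derivative
      area_density (q s) * ((\<tau> s)\<^sup>2 / 4 + trace (ginv (q s) ** (transpose r ** r))
        - trace (ginv (q s) ** S s ** ginv (q s) ** S s) / 2)) (at s)" (is ?D2)
proof -
  have M: "((\<lambda>s. gmet (q s)) has_vector_derivative S s) (at s)"
    unfolding q_def S_def by (rule has_vector_derivative_gmet_line)
  have "((\<lambda>s. det (gmet (q s))) has_real_derivative det (gmet (q s)) * \<tau> s) (at s)"
    unfolding \<tau>_def by (rule has_real_derivative_det[OF M ginv_mult])
  then have "((\<lambda>s. area_density (q s)) has_real_derivative
      inverse (sqrt (det (gmet (q s)))) / 2 * (det (gmet (q s)) * \<tau> s)) (at s)"
    unfolding area_density_def
    by (rule DERIV_chain2[where f = sqrt and g = "\<lambda>s. det (gmet (q s))", OF DERIV_real_sqrt[OF det_gmet_pos]])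
  also have "inverse (sqrt (det (gmet (q s)))) / 2 * (det (gmet (q s)) * \<tau> s) = area_density (q s) * \<tau> s / 2"
    unfolding area_density_def
    using det_gmet_pos[of "q s"] real_sqrt_pow2[of "det (gmet (q s))"]
    by (simp add: field_simps power2_eq_square)
  finally show D1: ?D1 .
  have K: "((\<lambda>s. ginv (q s)) has_vector_derivative - (ginv (q s) ** S s ** ginv (q s))) (at s)"
    unfolding ginv_def by (rule has_vector_derivative_matrix_inv[OF M invertible_gmet])
  have q1: "(q has_vector_derivative r) (at s)"
    unfolding q_def by (auto intro!: derivative_eq_intros)
  have q2: "((\<lambda>s. transpose (q s)) has_vector_derivative transpose r) (at s)"
    by (rule bounded_linear.has_vector_derivative[OF bounded_linear_transpose q1])
  have S': "(S has_vector_derivative transpose r ** r + transpose r ** r) (at s)"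
    unfolding S_def
    by (intro has_vector_derivative_add q1 q2
        bounded_linear.has_vector_derivative[OF bounded_bilinear.bounded_linear_left[OF bounded_bilinear_matrix_mult]]
        bounded_linear.has_vector_derivative[OF bounded_bilinear.bounded_linear_right[OF bounded_bilinear_matrix_mult]])
  have "(\<tau> has_vector_derivative trace (ginv (q s) ** (transpose r ** r + transpose r ** r)
      + - (ginv (q s) ** S s ** ginv (q s)) ** S s)) (at s)"
    unfolding \<tau>_def
    by (intro bounded_linear.has_vector_derivative[OF bounded_linear_trace]
        bounded_bilinear.has_vector_derivative[OF bounded_bilinear_matrix_mult] K S')
  then have t1: "(\<tau> has_real_derivative 2 * trace (ginv (q s) ** (transpose r ** r))
      - trace (ginv (q s) ** S s ** ginv (q s) ** S s)) (at s)"
    unfolding has_real_derivative_iff_has_vector_derivative matrix_add_ldistrib trace_add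
      bounded_bilinear.minus_left[OF bounded_bilinear_matrix_mult]
      linear_neg[OF bounded_linear.linear[OF bounded_linear_trace]]
    by simp
  show ?D2
    by (rule DERIV_cong[OF DERIV_cdivide[OF DERIV_mult[OF D1 t1]]])
       (simp add: field_simps power2_eq_square)
qed

lemma trace_area_flux:
  fixes p r :: "real^'n^'m"
  shows "trace (area_flux p ** r) = area_density p * trace (ginv p ** (transpose p ** r + transpose r ** p)) / 2"
proof -
  have "trace (ginv p ** (transpose r ** p)) = trace (transpose (ginv p ** (transpose r ** p)))"
    by (simp only: trace_transpose)
  also have "\<dots> = trace (transpose p ** r ** ginv p)"
    by (simp add: matrix_transpose_mul)
  also have "\<dots> = trace (ginv p ** transpose p ** r)"
    by (metis matrix_mul_assoc trace_mul_sym)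
  finally show ?thesis
    by (simp add: area_flux_def matrix_scaleR_ldistrib trace_scaleR matrix_add_ldistrib trace_add matrix_mul_assoc)
qed

text \<open>The operator bound is required along the whole segment because the Lagrange remainder
  sits at an unknown intermediate point. The factor (1-L^2)/(1+L^2) is kept with its sign, so that
  the same expansion gives a small loss for L >= 1 and a gain for 0 <= L < 1.\<close>

lemma area_density_taylor:
  fixes p r :: "real^'n^'m"
  assumes L: "\<And>s v. 0 \<le> s \<Longrightarrow> s \<le> 1 \<Longrightarrow> norm ((p + s *\<^sub>R r) *v v) \<le> L * norm v"
  obtains s where "0 \<le> s" "s \<le> 1"
    "area_density (p + r) \<ge> area_density p + trace (area_flux p ** r)
      + area_density (p + s *\<^sub>R r) * ((1 - L\<^sup>2) / (1 + L\<^sup>2)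
         * trace (ginv (p + s *\<^sub>R r) ** (transpose r ** r))) / 2"
proof -
  define q where "q = (\<lambda>s. p + s *\<^sub>R r)"
  define S where "S = (\<lambda>s. transpose (q s) ** r + transpose r ** q s)"
  define \<tau> where "\<tau> = (\<lambda>s. trace (ginv (q s) ** S s))"
  define f2 where "f2 = (\<lambda>s. area_density (q s) * ((\<tau> s)\<^sup>2 / 4 + trace (ginv (q s) ** (transpose r ** r))
        - trace (ginv (q s) ** S s ** ginv (q s) ** S s) / 2))"
  define diff where "diff = (\<lambda>m::nat. if m = 0 then (\<lambda>s. area_density (q s))
     else if m = 1 then (\<lambda>s. area_density (q s) * \<tau> s / 2) else f2)"
  have D1: "((\<lambda>s. area_density (q s)) has_real_derivative area_density (q t) * \<tau> t / 2) (at t)" for t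
    unfolding q_def S_def \<tau>_def by (rule area_density_line_derivs(1))
  have D2: "((\<lambda>s. area_density (q s) * \<tau> s / 2) has_real_derivative f2 t) (at t)" for t
    unfolding f2_def q_def S_def \<tau>_def by (rule area_density_line_derivs(2))
  have "\<forall>m t. m < 2 \<and> 0 \<le> t \<and> t \<le> 1 \<longrightarrow> DERIV (diff m) t :> diff (Suc m) t"
    unfolding less_2_cases_iff by (auto simp: diff_def intro: D1 D2)
  from Maclaurin[of 1 2 diff, OF _ _ refl this] obtain t where t: "0 < t" "t < 1"
    "diff 0 1 = (\<Sum>m<2. diff m 0 / fact m * 1 ^ m) + diff 2 t / fact 2 * 1 ^ 2"
    by auto
  have q1: "q 1 = p + r" "q 0 = p" by (simp_all add: q_def)
  have comb: "a + d + x / 2 \<le> e" if "e = a + b + c / 2" "b = d" "x \<le> c" for a b c d e x :: real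
    using that by simp
  have "area_density (p + r) = area_density p + area_density p * \<tau> 0 / 2 + f2 t / 2"
    using t(3) by (simp add: diff_def q1 numeral_2_eq_2)
  moreover have "area_density p * \<tau> 0 / 2 = trace (area_flux p ** r)"
    unfolding trace_area_flux \<tau>_def S_def q1 ..
  moreover have "f2 t \<ge> area_density (q t) * ((1 - L\<^sup>2) / (1 + L\<^sup>2)
         * trace (ginv (q t) ** (transpose r ** r)))"
  proof -
    have "norm (q t *v v) \<le> L * norm v" for v
      using L t by (simp add: q_def)
    from second_order_form_ge[OF this, of r]
    have "trace (ginv (q t) ** (transpose r ** r)) - trace (ginv (q t) ** S t ** ginv (q t) ** S t) / 2
      \<ge> (1 - L\<^sup>2) / (1 + L\<^sup>2) * trace (ginv (q t) ** (transpose r ** r))"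
      by (simp add: S_def)
    moreover have "(\<tau> t)\<^sup>2 / 4 \<ge> 0" by simp
    ultimately show ?thesis
      unfolding f2_def by (intro mult_left_mono less_imp_le[OF area_density_pos]) linarith
  qed
  ultimately have "area_density (p + r) \<ge> area_density p + trace (area_flux p ** r)
      + area_density (q t) * ((1 - L\<^sup>2) / (1 + L\<^sup>2) * trace (ginv (q t) ** (transpose r ** r))) / 2"
    by (rule comb)
  then show ?thesis
    using t by (intro that[of t]) (simp_all only: q_def less_imp_le)
qed

text \<open>The form of the error is chosen for L = 1 + O(t) and r = O(t): then L^2 - 1 is O(t), the
  whole loss is of third order in t, and it is invisible to a second derivative.\<close>

lemma area_density_almost_convex:
  fixes p r :: "real^'n^'m"
  assumes L: "\<And>s v. 0 \<le> s \<Longrightarrow> s \<le> 1 \<Longrightarrow> norm ((p + s *\<^sub>R r) *v v) \<le> L * norm v" and "L \<ge> 1"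
    and M: "\<And>s. 0 \<le> s \<Longrightarrow> s \<le> 1 \<Longrightarrow> area_density (p + s *\<^sub>R r) \<le> M"
  shows "area_density (p + r) \<ge> area_density p + trace (area_flux p ** r) - M * (L\<^sup>2 - 1) * (norm r)\<^sup>2"
proof -
  obtain s where s: "0 \<le> s" "s \<le> 1" and
    *: "area_density (p + r) \<ge> area_density p + trace (area_flux p ** r)
      + area_density (p + s *\<^sub>R r) * ((1 - L\<^sup>2) / (1 + L\<^sup>2)
         * trace (ginv (p + s *\<^sub>R r) ** (transpose r ** r))) / 2"
    using area_density_taylor[OF L] by metis
  define T where "T = trace (ginv (p + s *\<^sub>R r) ** (transpose r ** r))"
  have T: "0 \<le> T" "T \<le> (norm r)\<^sup>2"
    unfolding T_def power2_norm_eq_inner by (rule trace_ginv_gram_nonneg trace_ginv_gram_le)+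
  have L1: "L\<^sup>2 \<ge> 1" using \<open>L \<ge> 1\<close> by simp
  have k: "0 \<le> (L\<^sup>2 - 1) / (1 + L\<^sup>2)" "(L\<^sup>2 - 1) / (1 + L\<^sup>2) \<le> L\<^sup>2 - 1"
    using L1 by (auto simp: divide_le_eq mult_le_cancel_left1)
  have M0: "M > 0" using M[OF s] area_density_pos[of "p + s *\<^sub>R r"] by linarith
  have "area_density (p + s *\<^sub>R r) * ((L\<^sup>2 - 1) / (1 + L\<^sup>2) * T) \<le> M * ((L\<^sup>2 - 1) * (norm r)\<^sup>2)"
    by (intro mult_mono M s k T mult_nonneg_nonneg less_imp_le[OF M0] less_imp_le[OF area_density_pos])
       (use L1 in auto)
  then have 1: "area_density (p + s *\<^sub>R r) * ((L\<^sup>2 - 1) / (1 + L\<^sup>2) * T) \<le> M * (L\<^sup>2 - 1) * (norm r)\<^sup>2"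
    by (simp only: mult.assoc)
  have 2: "0 \<le> M * (L\<^sup>2 - 1) * (norm r)\<^sup>2"
    using M0 L1 by simp
  have neg: "(1 - L\<^sup>2) / (1 + L\<^sup>2) = - ((L\<^sup>2 - 1) / (1 + L\<^sup>2))"
    by (simp add: minus_divide_left)
  have 3: "area_density (p + s *\<^sub>R r) * ((1 - L\<^sup>2) / (1 + L\<^sup>2) * T)
      = - (area_density (p + s *\<^sub>R r) * ((L\<^sup>2 - 1) / (1 + L\<^sup>2) * T))"
    by (simp only: neg mult_minus_left mult_minus_right)
  have "a - d \<le> e" if "a + y / 2 \<le> e" "y = - x" "x \<le> d" "0 \<le> d" for a d e x y :: real
    using that by simp
  from this[OF *[folded T_def] 3 1 2] show ?thesis .
qed

lemma area_density_strictly_convex: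
  fixes p r :: "real^'n^'m"
  assumes L: "\<And>s v. 0 \<le> s \<Longrightarrow> s \<le> 1 \<Longrightarrow> norm ((p + s *\<^sub>R r) *v v) \<le> L * norm v" and "0 \<le> L" "L \<le> 1"
    and m: "\<And>s. 0 \<le> s \<Longrightarrow> s \<le> 1 \<Longrightarrow> area_density (p + s *\<^sub>R r) \<ge> m" "m \<ge> 0"
  shows "area_density (p + r) \<ge> area_density p + trace (area_flux p ** r) + m * (1 - L\<^sup>2) / 16 * (norm r)\<^sup>2"
proof -
  obtain s where s: "0 \<le> s" "s \<le> 1" and
    *: "area_density (p + r) \<ge> area_density p + trace (area_flux p ** r)
      + area_density (p + s *\<^sub>R r) * ((1 - L\<^sup>2) / (1 + L\<^sup>2)
         * trace (ginv (p + s *\<^sub>R r) ** (transpose r ** r))) / 2"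
    using area_density_taylor[OF L] by metis
  define T where "T = trace (ginv (p + s *\<^sub>R r) ** (transpose r ** r))"
  have T: "T \<ge> (norm r)\<^sup>2 / 4"
    unfolding T_def power2_norm_eq_inner
    by (rule trace_ginv_gram_ge[OF order_trans[OF L[OF s] mult_left_le_one_le]]) (use assms(2,3) in auto)
  have L1: "L\<^sup>2 \<le> 1" using assms(2,3) by (simp add: power_le_one)
  have k: "(1 - L\<^sup>2) / (1 + L\<^sup>2) \<ge> (1 - L\<^sup>2) / 2"
    using L1 by (intro divide_left_mono) (auto simp: add_pos_nonneg)
  \<comment> \<open>The 16 of the conclusion is 2 * 4 * 2: a 2 bounds 1 + L^2, the 4 comes from
    \<open>trace_ginv_gram_ge\<close>, and the last 2 from the Taylor remainder.\<close>
  have "m * ((1 - L\<^sup>2) / 2 * ((norm r)\<^sup>2 / 4)) \<le> area_density (p + s *\<^sub>R r) * ((1 - L\<^sup>2) / (1 + L\<^sup>2) * T)"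
    by (intro mult_mono m s k T mult_nonneg_nonneg less_imp_le[OF area_density_pos])
       (use L1 in auto)
  note half = this
  have half_le: "c \<le> b / 2" if "c = a / 2" "a \<le> b" for a b c :: real
    using that by simp
  have "m * (1 - L\<^sup>2) / 16 * (norm r)\<^sup>2 \<le> area_density (p + s *\<^sub>R r) * ((1 - L\<^sup>2) / (1 + L\<^sup>2) * T) / 2"
    by (intro half_le[OF _ half]) simp
  then show ?thesis
    using * unfolding T_def[symmetric] by (meson add_left_mono order_trans)
qed

lemma continuous_on_area_density: "continuous_on UNIV (area_density :: real^'n^'m \<Rightarrow> real)"
  unfolding area_density_def det_def gmet_def matrix_matrix_mult_def transpose_def mat_def
  by (simp, intro continuous_intros)

lemma area_density_bounds:
  assumes "0 \<le> N"
  obtains m M where "0 < m" "\<And>p :: real^'n^'m. norm p \<le> N \<Longrightarrow> m \<le> area_density p"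
    "\<And>p :: real^'n^'m. norm p \<le> N \<Longrightarrow> area_density p \<le> M"
proof -
  have ne: "cball (0 :: real^'n^'m) N \<noteq> {}" using assms by simp
  have c: "continuous_on (cball (0 :: real^'n^'m) N) area_density"
    using continuous_on_area_density continuous_on_subset by blast
  obtain p p' :: "real^'n^'m" where "\<forall>q\<in>cball (0 :: real^'n^'m) N. area_density p \<le> area_density q"
    "\<forall>q\<in>cball (0 :: real^'n^'m) N. area_density q \<le> area_density p'"
    using continuous_attains_inf[OF compact_cball ne c] continuous_attains_sup[OF compact_cball ne c] by blast
  then show ?thesis
    by (intro that[of "area_density p" "area_density p'"]) (auto simp: area_density_pos)
qed

lemma norm_matrix_le:
  fixes r :: "real^'n^'m"
  assumes "\<And>i. norm (r *v axis i 1) \<le> B"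
  shows "norm r \<le> real CARD('m) * (real CARD('n) * B)"
proof -
  have ent: "\<bar>r $ a $ i\<bar> \<le> B" for a i
    using component_le_norm_cart[of "r *v axis i 1" a] assms[of i]
    by (simp add: matrix_vector_mult_basis column_def)
  have "norm r \<le> (\<Sum>a\<in>UNIV. norm (r $ a))"
    unfolding norm_vec_def by (rule L2_set_le_sum) simp
  also have "\<dots> \<le> (\<Sum>a\<in>(UNIV :: 'm set). \<Sum>i\<in>(UNIV :: 'n set). B)"
    by (intro sum_mono order_trans[OF norm_le_l1_cart] ent)
  finally show ?thesis by simp
qed

lemma abs_entry_le_norm_matrix: "\<bar>r $ a $ i\<bar> \<le> norm (r :: real^'n^'m)"
  by (rule order_trans[OF component_le_norm_cart Finite_Cartesian_Product.norm_nth_le])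

section \<open>The flux of a minimal graph\<close>

lemma C1_onI:
  assumes "\<And>x. x \<in> S \<Longrightarrow> (u has_derivative u' x) (at x)"
    and "\<And>v. continuous_on S (\<lambda>x. u' x v)"
  shows "C1_on S u"
proof -
  have "frechet_derivative u (at x) = u' x" if "x \<in> S" for x
    using frechet_derivative_at[OF assms(1)[OF that]] by simp
  then show ?thesis
    unfolding C1_on_def using assms by (auto simp: differentiable_def cong: continuous_on_cong)
qed

lemma C1_onD:
  assumes "C1_on S u"
  shows "x \<in> S \<Longrightarrow> (u has_derivative frechet_derivative u (at x)) (at x)"
    and "continuous_on S (\<lambda>x. frechet_derivative u (at x) v)"
    and "continuous_on S u"
  using assms frechet_derivative_works unfolding C1_on_def
  by (auto intro!: differentiable_imp_continuous_on
      simp: differentiable_on_def differentiable_at_withinI)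

lemma C1_on_cong:
  assumes "open S" "C1_on S u" "\<And>x. x \<in> S \<Longrightarrow> u x = w x"
  shows "C1_on S w"
proof (rule C1_onI)
  show "(w has_derivative frechet_derivative u (at x)) (at x)" if "x \<in> S" for x
    by (rule has_derivative_transform_within_open[OF C1_onD(1)[OF assms(2) that] assms(1) that assms(3)])
qed (rule C1_onD[OF assms(2)])

lemma C1_on_const: "C1_on S (\<lambda>x. c)"
  by (rule C1_onI[where u' = "\<lambda>x v. 0"]) auto

lemma C1_on_bounded_linear:
  assumes "C1_on S u" "bounded_linear L"
  shows "C1_on S (\<lambda>x. L (u x))"
proof (rule C1_onI)
  show "((\<lambda>x. L (u x)) has_derivative (\<lambda>v. L (frechet_derivative u (at x) v))) (at x)" if "x \<in> S" for x
    by (rule bounded_linear.has_derivative[OF assms(2) C1_onD(1)[OF assms(1) that]])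
qed (intro bounded_linear.continuous_on[OF assms(2)] C1_onD[OF assms(1)])

lemma C1_on_add:
  assumes "C1_on S u" "C1_on S w"
  shows "C1_on S (\<lambda>x. u x + w x)"
  by (rule C1_onI, rule has_derivative_add)
     (auto intro!: C1_onD[OF assms(1)] C1_onD[OF assms(2)] continuous_intros)

lemma C1_on_mult:
  fixes u w :: "'a::euclidean_space \<Rightarrow> real"
  assumes "C1_on S u" "C1_on S w"
  shows "C1_on S (\<lambda>x. u x * w x)"
  by (rule C1_onI, rule has_derivative_mult)
     (auto intro!: C1_onD[OF assms(1)] C1_onD[OF assms(2)] continuous_intros)

lemma C1_on_sum:
  assumes "\<And>i. i \<in> I \<Longrightarrow> C1_on S (u i)"
  shows "C1_on S (\<lambda>x. \<Sum>i\<in>I. u i x)"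
  using assms by (induction I rule: infinite_finite_induct) (auto intro!: C1_on_const C1_on_add)

lemma C1_on_prod:
  fixes u :: "'i \<Rightarrow> 'a::euclidean_space \<Rightarrow> real"
  assumes "\<And>i. i \<in> I \<Longrightarrow> C1_on S (u i)"
  shows "C1_on S (\<lambda>x. \<Prod>i\<in>I. u i x)"
  using assms by (induction I rule: infinite_finite_induct) (auto intro!: C1_on_const C1_on_mult)

lemma C1_on_inverse:
  fixes u :: "'a::euclidean_space \<Rightarrow> real"
  assumes "C1_on S u" "\<And>x. x \<in> S \<Longrightarrow> u x \<noteq> 0"
  shows "C1_on S (\<lambda>x. inverse (u x))"
proof (rule C1_onI)
  show "((\<lambda>x. inverse (u x)) has_derivative
      (\<lambda>v. - (inverse (u x) * frechet_derivative u (at x) v * inverse (u x)))) (at x)" if "x \<in> S" for x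
    by (rule Deriv.has_derivative_inverse[OF assms(2)[OF that] C1_onD(1)[OF assms(1) that]])
qed (use assms(2) in \<open>force intro!: C1_onD[OF assms(1)] continuous_intros\<close>)

lemma C1_on_sqrt:
  fixes u :: "'a::euclidean_space \<Rightarrow> real"
  assumes "C1_on S u" "\<And>x. x \<in> S \<Longrightarrow> u x > 0"
  shows "C1_on S (\<lambda>x. sqrt (u x))"
proof (rule C1_onI)
  show "((\<lambda>x. sqrt (u x)) has_derivative (\<lambda>v. frechet_derivative u (at x) v * (inverse (sqrt (u x)) / 2))) (at x)"
    if "x \<in> S" for x
    by (rule has_derivative_real_sqrt[OF assms(2)[OF that] C1_onD(1)[OF assms(1) that]])
qed (use assms(2) in \<open>force intro!: C1_onD[OF assms(1)] continuous_intros\<close>)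

lemma C1_on_det:
  fixes M :: "'a::euclidean_space \<Rightarrow> real^'n^'n"
  assumes "\<And>i j. C1_on S (\<lambda>x. M x $ i $ j)"
  shows "C1_on S (\<lambda>x. det (M x))"
  unfolding det_def by (intro C1_on_sum C1_on_mult C1_on_const C1_on_prod assms)

lemma C1_on_matrix_inv:
  fixes M :: "'a::euclidean_space \<Rightarrow> real^'n^'n"
  assumes "open S" "\<And>i j. C1_on S (\<lambda>x. M x $ i $ j)" "\<And>x. x \<in> S \<Longrightarrow> det (M x) \<noteq> 0"
  shows "C1_on S (\<lambda>x. matrix_inv (M x) $ i $ j)"
proof (rule C1_on_cong[OF assms(1)])
  have "C1_on S (\<lambda>x. (\<chi> k l. if l = i then axis j 1 $ k else M x $ k $ l) $ k $ l)" for k l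
    using assms(2) by (cases "l = i") (auto intro: C1_on_const)
  then show "C1_on S (\<lambda>x. det (\<chi> k l. if l = i then axis j 1 $ k else M x $ k $ l) * inverse (det (M x)))"
    by (intro C1_on_mult C1_on_inverse C1_on_det assms(2,3))
qed (simp add: matrix_inv_cramer assms(3) divide_inverse)

section \<open>The Jacobian of \<open>f\<close> and the divergence form of the system\<close>

definition jac :: "(real^'n \<Rightarrow> real^'m) \<Rightarrow> real^'n \<Rightarrow> real^'n^'m" where
  "jac f x = matrix (frechet_derivative f (at x))"

lemma frechet_derivative_component:
  assumes "f differentiable (at x)"
  shows "frechet_derivative (\<lambda>y. f y $ a) (at x) v = frechet_derivative f (at x) v $ a"
proof -
  have "((\<lambda>y. f y $ a) has_derivative (\<lambda>v. frechet_derivative f (at x) v $ a)) (at x)"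
    by (intro bounded_linear.has_derivative[OF bounded_linear_vec_nth]) (use assms frechet_derivative_works in blast)
  then show ?thesis using frechet_derivative_at by metis
qed

lemma pderiv_at_component:
  assumes "f differentiable (at x)"
  shows "pderiv_at i (\<lambda>y. f y $ a) x = jac f x $ a $ i"
  using frechet_derivative_component[OF assms] by (simp add: pderiv_at_def jac_def matrix_def)

lemma jac_mult:
  assumes "f differentiable (at x)"
  shows "jac f x *v v = frechet_derivative f (at x) v"
  using assms by (simp add: jac_def matrix_works has_derivative_linear frechet_derivative_works)

lemma graph_metric_eq_gmet:
  assumes "f differentiable (at x)"
  shows "graph_metric f x = gmet (jac f x)"
  by (simp add: graph_metric_def gmet_def pderiv_at_component[OF assms] vec_eq_iff mat_def
      matrix_matrix_mult_def transpose_def)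

lemma C1_on_jac:
  assumes "open S" "C2_on S f"
  shows "C1_on S (\<lambda>x. jac f x $ a $ i)"
proof -
  have "C1_on S (\<lambda>x. frechet_derivative f (at x) (axis i 1) $ a)"
    using assms(2) by (intro C1_on_bounded_linear[OF _ bounded_linear_vec_nth]) (simp add: C2_on_def)
  then show ?thesis by (simp add: jac_def matrix_def)
qed

lemma C1_on_gmet_jac:
  assumes "open S" "C2_on S f"
  shows "C1_on S (\<lambda>x. gmet (jac f x) $ i $ j)"
  by (simp add: gmet_def matrix_matrix_mult_def transpose_def)
     (intro C1_on_add C1_on_const C1_on_sum C1_on_mult C1_on_jac assms)

lemma C1_on_area_density_jac:
  assumes "open S" "C2_on S f"
  shows "C1_on S (\<lambda>x. area_density (jac f x))"
  unfolding area_density_def by (intro C1_on_sqrt C1_on_det C1_on_gmet_jac assms det_gmet_pos)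

lemma C1_on_flux_term:
  assumes "open S" "C2_on S f"
  shows "C1_on S (\<lambda>x. area_density (jac f x) * ginv (jac f x) $ i $ j * jac f x $ a $ j)"
  unfolding ginv_def
  by (intro C1_on_mult C1_on_area_density_jac C1_on_matrix_inv C1_on_gmet_jac C1_on_jac assms
      less_imp_neq[OF det_gmet_pos, symmetric])

lemma area_flux_nth:
  "area_flux p $ i $ a = (\<Sum>j\<in>UNIV. area_density p * ginv p $ i $ j * p $ a $ j)"
  by (simp add: area_flux_def matrix_matrix_mult_def transpose_def sum_distrib_left mult.assoc)

lemma C1_on_area_flux:
  assumes "open S" "C2_on S f"
  shows "C1_on S (\<lambda>x. area_flux (jac f x) $ i $ a)"
  unfolding area_flux_nth by (intro C1_on_sum C1_on_flux_term assms)

text \<open>The system differentiates each (i, j) term separately, whereas a flux entry is already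
  summed over j. Pulling that sum inside the derivative is legitimate because every single term is
  C^1.\<close>

lemma area_flux_divergence_free:
  fixes f :: "real^'n \<Rightarrow> real^'m"
  assumes "open S" "minimal_surface_solution S f" "x \<in> S"
  shows "(\<Sum>i\<in>UNIV. frechet_derivative (\<lambda>y. area_flux (jac f y) $ i $ a) (at x) (axis i 1)) = 0"
proof -
  have C2: "C2_on S f" using assms(2) by (simp add: minimal_surface_solution_def)
  then have df: "f differentiable (at y)" if "y \<in> S" for y
    using that by (simp add: C2_on_def C1_on_def)
  define h where "h = (\<lambda>i j y. area_density (jac f y) * ginv (jac f y) $ i $ j * jac f y $ a $ j)"
  have h: "(h i j has_derivative frechet_derivative (h i j) (at x)) (at x)" for i j
    unfolding h_def by (rule C1_onD(1)[OF C1_on_flux_term[OF assms(1) C2] assms(3)])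
  have "pderiv_at i (\<lambda>y. sqrt (det (graph_metric f y)) * matrix_inv (graph_metric f y) $ i $ j
                        * pderiv_at j (\<lambda>z. f z $ a) y) x = frechet_derivative (h i j) (at x) (axis i 1)" for i j
  proof -
    have "((\<lambda>y. sqrt (det (graph_metric f y)) * matrix_inv (graph_metric f y) $ i $ j
                        * pderiv_at j (\<lambda>z. f z $ a) y) has_derivative frechet_derivative (h i j) (at x)) (at x)"
      by (rule has_derivative_transform_within_open[OF h assms(1,3)])
         (simp add: h_def area_density_def ginv_def graph_metric_eq_gmet df pderiv_at_component)
    from frechet_derivative_at[OF this, symmetric] show ?thesis by (simp only: pderiv_at_def)
  qed
  moreover have "frechet_derivative (\<lambda>y. area_flux (jac f y) $ i $ a) (at x) (axis i 1)
      = (\<Sum>j\<in>UNIV. frechet_derivative (h i j) (at x) (axis i 1))" for i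
  proof -
    have "((\<lambda>y. area_flux (jac f y) $ i $ a) has_derivative (\<lambda>v. \<Sum>j\<in>UNIV. frechet_derivative (h i j) (at x) v)) (at x)"
      unfolding area_flux_nth h_def[symmetric, THEN fun_cong, THEN fun_cong, THEN fun_cong]
      by (intro has_derivative_sum h)
    from frechet_derivative_at[OF this, symmetric] show ?thesis by (simp only:)
  qed
  moreover have "(\<Sum>i\<in>UNIV. \<Sum>j\<in>UNIV. pderiv_at i (\<lambda>y. sqrt (det (graph_metric f y))
      * matrix_inv (graph_metric f y) $ i $ j * pderiv_at j (\<lambda>z. f z $ a) y) x) = 0"
    using assms(2,3) unfolding minimal_surface_solution_def by blast
  ultimately show ?thesis by (simp only:)
qed

section \<open>Integration by parts with compactly supported test functions\<close>

lemma integrable_on_compact: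
  fixes g :: "'a::euclidean_space \<Rightarrow> real"
  assumes "compact K" "continuous_on K g"
  shows "g integrable_on K"
  using set_borel_integral_eq_integral(1)[of K g] borel_integrable_compact[OF assms]
  by (simp add: set_integrable_def)

lemma has_real_derivative_along_line:
  fixes u :: "'b::real_normed_vector \<Rightarrow> 'a::real_inner"
  assumes "(u has_derivative u') (at (x + s *\<^sub>R v))"
  shows "((\<lambda>s. u (x + s *\<^sub>R v) \<bullet> b) has_real_derivative u' v \<bullet> b) (at s)"
proof -
  have "((\<lambda>s. u (x + s *\<^sub>R v)) has_derivative (\<lambda>d. u' (d *\<^sub>R v))) (at s)"
    by (rule has_derivative_compose[where f = "\<lambda>s. x + s *\<^sub>R v" and g = u, OF _ assms])
       (auto intro!: derivative_eq_intros)
  from bounded_linear.has_derivative[OF bounded_linear_inner_left this, of b]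
  show ?thesis
    using linear_scale[OF has_derivative_linear[OF assms]]
    by (simp add: has_field_derivative_def mult_commute_abs)
qed

lemma has_integral_directional_derivative_compact_support:
  fixes w :: "'a::euclidean_space \<Rightarrow> real"
  assumes K: "compact K" and w: "\<And>x. (w has_derivative w' x) (at x)"
    and supp: "\<And>x. x \<notin> K \<Longrightarrow> w x = 0" and bd: "\<And>x. x \<in> K \<Longrightarrow> \<bar>w' x v\<bar> \<le> B"
  shows "((\<lambda>x. w' x v) has_integral 0) K"
proof -
  have w0: "w' x v = 0" if "x \<notin> K" for x
  proof -
    have "(w has_derivative (\<lambda>v. 0)) (at x)"
      by (rule has_derivative_transform_within_open
          [OF has_derivative_const open_Compl[OF compact_imp_closed[OF K]]]) (use that supp in auto)
    then show ?thesis using has_derivative_unique[OF w] by metis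
  qed
  \<comment> \<open>The absolute value matters when \<open>K\<close> is empty, where
    \<open>B\<close> may be negative.\<close>
  have bd': "\<bar>w' x v\<bar> \<le> \<bar>B\<bar>" for x
    using bd[of x] w0[of x] by (cases "x \<in> K") auto
  have contw: "continuous_on UNIV w"
    using w by (intro has_derivative_continuous_on) (auto intro: has_derivative_at_withinI)
  obtain R where "R > 0" "\<forall>x\<in>K. norm x \<le> R"
    using compact_imp_bounded[OF K] bounded_pos by metis
  then have R: "K \<subseteq> cball 0 R" "R > 0" by auto
  obtain a b where ab: "K \<subseteq> cbox a b"
    using K compact_imp_bounded bounded_subset_cbox_symmetric by metis
  obtain I where I: "(w has_integral I) (cbox a b)"
    using integrable_continuous[of a b w] continuous_on_subset[OF contw] by (auto simp: integrable_on_def)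
  have shift: "((\<lambda>x. w (x + c)) has_integral I) UNIV" for c
  proof (rule has_integral_on_superset)
    show "((\<lambda>x. w (x + c)) has_integral I) (cbox (a - c) (b - c))"
      using I by (intro has_integral_shift_cbox) simp
    show "w (x + c) = 0" if "x \<notin> cbox (a - c) (b - c)" for x
    proof (rule supp)
      have "x + c \<notin> cbox a b"
        using that by (simp add: mem_box inner_diff_left inner_add_left algebra_simps)
      then show "x + c \<notin> K" using ab by blast
    qed
  qed auto
  \<comment> \<open>Steps of size at most 1 keep all difference quotients supported in one ball of
    radius \<open>R + norm v\<close>, which provides an integrable majorant.\<close>
  define h where "h = (\<lambda>k. inverse (real (Suc k)))"
  define g where "g = (\<lambda>k x. (w (x + h k *\<^sub>R v) - w x) / h k)"
  have h: "0 < h k" "h k \<le> 1" for k by (auto simp: h_def inverse_le_1_iff)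
  have gI: "(g k has_integral 0) UNIV" for k
  proof -
    have "((\<lambda>x. w (x + h k *\<^sub>R v) - w (x + 0)) has_integral I - I) UNIV"
      by (intro has_integral_diff shift)
    from has_integral_divide[OF this, of "h k"] show ?thesis by (simp add: g_def)
  qed
  have dline: "((\<lambda>s. w (x + s *\<^sub>R v)) has_real_derivative w' (x + s *\<^sub>R v) v) (at s)" for x s
    using has_real_derivative_along_line[where x = x and s = s and v = v and b = 1, OF w] by simp
  have gb: "\<bar>g k x\<bar> \<le> \<bar>B\<bar>" for k x
  proof -
    have "norm (w (x + h k *\<^sub>R v) - w (x + 0 *\<^sub>R v)) \<le> \<bar>B\<bar> * norm (h k - 0)"
      by (rule field_differentiable_bound[where S = UNIV and f = "\<lambda>s. w (x + s *\<^sub>R v)", OF convex_UNIV dline])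
         (use bd' in auto)
    then show ?thesis using h[of k] by (simp add: g_def divide_le_eq)
  qed
  have g0: "g k x = 0" if "x \<notin> cball 0 (R + norm v)" for k x
  proof -
    have nx: "norm x > R + norm v" using that by simp
    have "norm x \<le> norm (x + h k *\<^sub>R v) + norm (h k *\<^sub>R v)"
      using norm_triangle_ineq4[of "x + h k *\<^sub>R v" "h k *\<^sub>R v"] by simp
    moreover have "norm (h k *\<^sub>R v) \<le> norm v"
      using h[of k] by (simp add: mult_left_le_one_le)
    ultimately have "norm (x + h k *\<^sub>R v) > R" using nx by linarith
    moreover have "norm x > R" using nx norm_ge_zero[of v] by linarith
    ultimately have "x + h k *\<^sub>R v \<notin> K" "x \<notin> K" using R by (auto simp: subset_iff)
    then show ?thesis by (simp add: g_def supp)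
  qed
  define H where "H = (\<lambda>x :: 'a. if x \<in> cball 0 (R + norm v) then \<bar>B\<bar> else 0)"
  have H: "H integrable_on UNIV"
    unfolding H_def integrable_restrict_UNIV by (intro integrable_on_compact) auto
  have lim: "(\<lambda>k. g k x) \<longlonglongrightarrow> w' x v" for x
  proof -
    have "((\<lambda>s. (w (x + s *\<^sub>R v) - w x) / s) \<longlongrightarrow> w' x v) (at 0)"
      using dline[of x 0] by (simp add: DERIV_def)
    moreover have "filterlim h (at 0) sequentially"
      unfolding h_def filterlim_at using LIMSEQ_inverse_real_of_nat by auto
    ultimately show ?thesis unfolding g_def by (rule filterlim_compose)
  qed
  have dom: "norm (g k x) \<le> H x" for k x
    using gb[of k x] g0[of x k] by (auto simp: H_def)
  have "(\<lambda>x. w' x v) integrable_on UNIV" "(\<lambda>k. integral UNIV (g k)) \<longlonglongrightarrow> integral UNIV (\<lambda>x. w' x v)"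
    using dominated_convergence[of g UNIV H "\<lambda>x. w' x v"] gI H dom lim by (auto simp: integrable_on_def)
  moreover have "integral UNIV (g k) = 0" for k using gI by (rule integral_unique)
  ultimately have "(\<lambda>x. w' x v) integrable_on UNIV" "integral UNIV (\<lambda>x. w' x v) = 0"
    by (simp_all add: LIMSEQ_const_iff)
  then have "((\<lambda>x. w' x v) has_integral 0) UNIV"
    by (simp add: has_integral_iff)
  moreover have "(\<lambda>x. if x \<in> K then w' x v else 0) = (\<lambda>x. w' x v)"
    using w0 by (intro ext) simp
  ultimately show ?thesis
    by (subst has_integral_restrict_UNIV[symmetric]) (simp only:)
qed

lemma C1_on_bounded_on_compact:
  fixes a :: "'a::euclidean_space \<Rightarrow> real"
  assumes "C1_on S a" "compact K" "K \<subseteq> S"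
  obtains B where "B > 0" "\<And>x. x \<in> K \<Longrightarrow> \<bar>a x\<bar> \<le> B" "\<And>x. x \<in> K \<Longrightarrow> \<bar>frechet_derivative a (at x) v\<bar> \<le> B"
proof -
  have "bounded (a ` K)" "bounded ((\<lambda>x. frechet_derivative a (at x) v) ` K)"
    by (intro compact_imp_bounded compact_continuous_image assms(2)
        continuous_on_subset[OF _ assms(3)] C1_onD[OF assms(1)])+
  then obtain B1 B2 where "B1 > 0" "\<forall>x\<in>K. \<bar>a x\<bar> \<le> B1" "\<forall>x\<in>K. \<bar>frechet_derivative a (at x) v\<bar> \<le> B2"
    unfolding bounded_pos by auto
  then show ?thesis
    by (intro that[of "max B1 B2"]) force+
qed

text \<open>The coefficient \<open>a\<close> is controlled on \<open>\<Omega>\<close> only, but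
  \<open>a * u\<close> vanishes outside \<open>K\<close>, so it is differentiable everywhere: on
  \<open>K\<close> by the product rule, and on the open complement because it is zero there.\<close>

lemma has_integral_by_parts_compact_support:
  fixes a u :: "'a::euclidean_space \<Rightarrow> real"
  assumes \<Omega>: "open \<Omega>" and K: "compact K" "K \<subseteq> \<Omega>" and a: "C1_on \<Omega> a"
    and u: "\<And>x. (u has_derivative u' x) (at x)"
    and supp: "\<And>x. x \<notin> K \<Longrightarrow> u x = 0" and bd: "\<And>x. x \<in> K \<Longrightarrow> \<bar>u' x v\<bar> \<le> B"
  shows "((\<lambda>x. frechet_derivative a (at x) v * u x + a x * u' x v) has_integral 0) K"
proof -
  define w where "w = (\<lambda>x. a x * u x)"
  define w' where "w' = (\<lambda>x v. if x \<in> K then a x * u' x v + frechet_derivative a (at x) v * u x else 0)"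
  obtain A where A: "A > 0" "\<And>x. x \<in> K \<Longrightarrow> \<bar>a x\<bar> \<le> A" "\<And>x. x \<in> K \<Longrightarrow> \<bar>frechet_derivative a (at x) v\<bar> \<le> A"
    using C1_on_bounded_on_compact[OF a K] by metis
  have "continuous_on K u"
    using u by (intro has_derivative_continuous_on) (auto intro: has_derivative_at_withinI)
  then have "bounded (u ` K)"
    by (intro compact_imp_bounded compact_continuous_image K)
  then obtain C where C: "C > 0" "\<And>x. x \<in> K \<Longrightarrow> \<bar>u x\<bar> \<le> C"
    unfolding bounded_pos by auto
  have "((\<lambda>x. w' x v) has_integral 0) K"
  proof (rule has_integral_directional_derivative_compact_support[OF K(1)])
    show "(w has_derivative w' x) (at x)" for x
    proof (cases "x \<in> K")
      case True
      then have "(w has_derivative (\<lambda>v. a x * u' x v + frechet_derivative a (at x) v * u x)) (at x)"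
        unfolding w_def using K(2) by (intro has_derivative_mult u C1_onD(1)[OF a]) auto
      then show ?thesis using True by (simp add: w'_def)
    next
      case False
      have "(w has_derivative (\<lambda>v. 0)) (at x)"
        by (rule has_derivative_transform_within_open
          [OF has_derivative_const open_Compl[OF compact_imp_closed[OF K(1)]]])
           (use False supp in \<open>auto simp: w_def\<close>)
      then show ?thesis using False by (simp add: w'_def)
    qed
    show "w x = 0" if "x \<notin> K" for x using supp[OF that] by (simp add: w_def)
    show "\<bar>w' x v\<bar> \<le> A * B + A * C" if x: "x \<in> K" for x
    proof -
      have "\<bar>a x * u' x v\<bar> \<le> A * B" "\<bar>frechet_derivative a (at x) v * u x\<bar> \<le> A * C"
        unfolding abs_mult using A C bd x by (auto intro!: mult_mono simp: less_imp_le)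
      then show ?thesis using x unfolding w'_def by simp
    qed
  qed
  then show ?thesis
    by (rule has_integral_eq[rotated]) (simp add: w'_def)
qed

text \<open>The weak form of the minimal surface system. In the sum of the integrations by parts
  over all i and \<alpha>, the terms carrying derivatives of the flux collect into its divergence
  and disappear.\<close>

lemma flux_has_integral_zero:
  fixes f :: "real^'n \<Rightarrow> real^'m"
  assumes \<Omega>: "open \<Omega>" and f: "minimal_surface_solution \<Omega> f" and K: "compact K" "K \<subseteq> \<Omega>"
    and u: "\<And>x. (u has_derivative u' x) (at x)"
    and supp: "\<And>x. x \<notin> K \<Longrightarrow> u x = 0" and bd: "\<And>x v. x \<in> K \<Longrightarrow> norm (u' x v) \<le> B * norm v"
  shows "((\<lambda>x. trace (area_flux (jac f x) ** matrix (u' x))) has_integral 0) K"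
proof -
  define F where "F = (\<lambda>i \<alpha> x. area_flux (jac f x) $ i $ \<alpha>)"
  have C2: "C2_on \<Omega> f" using f by (simp add: minimal_surface_solution_def)
  have comp: "((\<lambda>x. frechet_derivative (F i \<alpha>) (at x) (axis i 1) * u x $ \<alpha> + F i \<alpha> x * u' x (axis i 1) $ \<alpha>)
      has_integral 0) K" for i \<alpha>
  proof (rule has_integral_by_parts_compact_support[OF \<Omega> K])
    show "C1_on \<Omega> (F i \<alpha>)" unfolding F_def by (rule C1_on_area_flux[OF \<Omega> C2])
    show "((\<lambda>x. u x $ \<alpha>) has_derivative (\<lambda>v. u' x v $ \<alpha>)) (at x)" for x
      by (rule bounded_linear.has_derivative[OF bounded_linear_vec_nth u])
    show "u x $ \<alpha> = 0" if "x \<notin> K" for x using supp[OF that] by simp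
    show "\<bar>u' x (axis i 1) $ \<alpha>\<bar> \<le> B" if "x \<in> K" for x
      using bd[OF that, of "axis i 1"] component_le_norm_cart[of "u' x (axis i 1)" \<alpha>] by simp
  qed
  have "((\<lambda>x. \<Sum>i\<in>UNIV. \<Sum>\<alpha>\<in>UNIV. frechet_derivative (F i \<alpha>) (at x) (axis i 1) * u x $ \<alpha>
      + F i \<alpha> x * u' x (axis i 1) $ \<alpha>) has_integral (\<Sum>i\<in>(UNIV::'n set). \<Sum>\<alpha>\<in>(UNIV::'m set). 0)) K"
    by (intro has_integral_sum comp) auto
  then have "((\<lambda>x. \<Sum>i\<in>UNIV. \<Sum>\<alpha>\<in>UNIV. frechet_derivative (F i \<alpha>) (at x) (axis i 1) * u x $ \<alpha>
      + F i \<alpha> x * u' x (axis i 1) $ \<alpha>) has_integral 0) K"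
    by simp
  then show ?thesis
  proof (rule has_integral_eq[rotated])
    fix x assume x: "x \<in> K"
    have "(\<Sum>i\<in>UNIV. \<Sum>\<alpha>\<in>UNIV. frechet_derivative (F i \<alpha>) (at x) (axis i 1) * u x $ \<alpha>)
      = (\<Sum>\<alpha>\<in>UNIV. (\<Sum>i\<in>UNIV. frechet_derivative (F i \<alpha>) (at x) (axis i 1)) * u x $ \<alpha>)"
      by (subst sum.swap) (simp add: sum_distrib_right)
    also have "\<dots> = 0"
      using area_flux_divergence_free[OF \<Omega> f] x K(2) by (simp add: F_def subset_iff)
    finally show "(\<Sum>i\<in>UNIV. \<Sum>\<alpha>\<in>UNIV. frechet_derivative (F i \<alpha>) (at x) (axis i 1) * u x $ \<alpha>
      + F i \<alpha> x * u' x (axis i 1) $ \<alpha>) = trace (area_flux (jac f x) ** matrix (u' x))"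
      by (simp add: sum.distrib trace_def matrix_matrix_mult_def matrix_def F_def)
  qed
qed

text \<open>Obtained by integrating the divergence of \<open>x\<^sub>i u\<^sup>2\<close> and absorbing the cross term.\<close>

lemma poincare_inequality_compact_support:
  fixes u :: "real^'n \<Rightarrow> real"
  assumes K: "compact K" and R: "\<And>x. x \<in> K \<Longrightarrow> \<bar>x $ i\<bar> \<le> R"
    and u: "\<And>x. (u has_derivative u' x) (at x)"
    and supp: "\<And>x. x \<notin> K \<Longrightarrow> u x = 0" and bd: "\<And>x. x \<in> K \<Longrightarrow> \<bar>u' x (axis i 1)\<bar> \<le> B"
  shows "(\<lambda>x. (u x)\<^sup>2) integrable_on K" "(\<lambda>x. (u' x (axis i 1))\<^sup>2) integrable_on K"
    "integral K (\<lambda>x. (u x)\<^sup>2) \<le> 4 * R\<^sup>2 * integral K (\<lambda>x. (u' x (axis i 1))\<^sup>2)"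
proof -
  define e :: "real^'n" where "e = axis i 1"
  have contu: "continuous_on K u"
    using u by (intro has_derivative_continuous_on) (auto intro: has_derivative_at_withinI)
  show u2: "(\<lambda>x. (u x)\<^sup>2) integrable_on K"
    by (intro integrable_on_compact K continuous_intros contu)
  have "((\<lambda>x. u' x e) has_integral 0) K"
    using bd unfolding e_def
    by (intro has_integral_directional_derivative_compact_support[OF K u supp]) auto
  then have d: "(\<lambda>x. u' x e) integrable_on K" by (auto simp: integrable_on_def)
  have dabs: "(\<lambda>x. u' x e) absolutely_integrable_on K"
    by (rule absolutely_integrable_integrable_bound[OF _ d, of "\<lambda>x. B"])
       (use bd in \<open>auto simp: e_def intro!: integrable_on_compact K\<close>)
  have Ks: "K \<in> sets lebesgue"
    using K by (simp add: compact_imp_closed lmeasurable_compact fmeasurableD)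
  \<comment> \<open>The derivative need not be continuous, so its square is integrated as a product
    of a bounded measurable function with an absolutely integrable one.\<close>
  have d2abs: "(\<lambda>x. u' x e * u' x e) absolutely_integrable_on K"
  proof (rule absolutely_integrable_bounded_measurable_product[OF bilinear_times _ Ks _ dabs])
    show "(\<lambda>x. u' x e) \<in> borel_measurable (lebesgue_on K)"
      using dabs Ks by (simp add: absolutely_integrable_measurable)
    show "bounded ((\<lambda>x. u' x e) ` K)"
      using bd by (auto simp: bounded_iff e_def intro!: exI[of _ B])
  qed
  then show d2: "(\<lambda>x. (u' x (axis i 1))\<^sup>2) integrable_on K"
    unfolding power2_eq_square e_def[symmetric] by (rule set_lebesgue_integral_eq_integral(1))
  have "bounded (u ` K)"
    by (intro compact_imp_bounded compact_continuous_image K contu)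
  then obtain C where C: "C > 0" "\<And>x. x \<in> K \<Longrightarrow> \<bar>u x\<bar> \<le> C"
    unfolding bounded_pos by auto
  have W: "((\<lambda>x. (u x)\<^sup>2 + x $ i * (2 * u x * u' x e)) has_integral 0) K"
  proof -
    have dx: "((\<lambda>x :: real^'n. x $ i) has_derivative (\<lambda>v. v $ i)) (at x)" for x
      by (rule bounded_linear_imp_has_derivative[OF bounded_linear_vec_nth])
    then have C1: "C1_on UNIV (\<lambda>x :: real^'n. x $ i)"
      by (rule C1_onI) (rule continuous_on_const)
    have du2: "((\<lambda>x. (u x)\<^sup>2) has_derivative (\<lambda>v. 2 * u x * u' x v)) (at x)" for x
      by (rule has_derivative_eq_rhs[OF has_derivative_power[OF u]]) (simp add: fun_eq_iff)
    have "\<bar>2 * u x * u' x e\<bar> \<le> 2 * C * B" if "x \<in> K" for x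
      unfolding abs_mult using C bd that by (intro mult_mono) (auto simp: e_def)
    from has_integral_by_parts_compact_support[OF open_UNIV K subset_UNIV C1 du2 _ this]
    show ?thesis
      using supp by (simp add: frechet_derivative_at[OF dx, symmetric] e_def)
  qed
  show "integral K (\<lambda>x. (u x)\<^sup>2) \<le> 4 * R\<^sup>2 * integral K (\<lambda>x. (u' x (axis i 1))\<^sup>2)"
  proof -
    define I J where "I = integral K (\<lambda>x. (u x)\<^sup>2)" and "J = integral K (\<lambda>x. (u' x e)\<^sup>2)"
    have IJ: "((\<lambda>x. (u x)\<^sup>2) has_integral I) K" "((\<lambda>x. (u' x e)\<^sup>2) has_integral J) K"
      using u2 d2 by (auto simp: I_def J_def e_def has_integral_integral)
    \<comment> \<open>The weights 1/2 and 2 R^2 are chosen so that, by |x_i| <= R, the integrand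
      dominates 2 (u/2 + x_i u')^2. The last summand is the divergence, with integral zero; it
      cancels the subtracted u^2 and leaves the cross term.\<close>
    have "0 \<le> (1/2) * I + 2 * R\<^sup>2 * J - I + 0"
    proof (rule has_integral_nonneg)
      show "((\<lambda>x. (1/2) * (u x)\<^sup>2 + 2 * R\<^sup>2 * (u' x e)\<^sup>2 - (u x)\<^sup>2 + ((u x)\<^sup>2 + x $ i * (2 * u x * u' x e)))
        has_integral (1/2) * I + 2 * R\<^sup>2 * J - I + 0) K"
        by (intro has_integral_add has_integral_diff has_integral_mult_right IJ W)
      show "0 \<le> (1/2) * (u x)\<^sup>2 + 2 * R\<^sup>2 * (u' x e)\<^sup>2 - (u x)\<^sup>2 + ((u x)\<^sup>2 + x $ i * (2 * u x * u' x e))"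
        if x: "x \<in> K" for x
      proof -
        have "(x $ i)\<^sup>2 \<le> R\<^sup>2"
          using R[OF x] by (metis abs_ge_zero abs_le_square_iff abs_of_nonneg order_trans)
        then have "(x $ i)\<^sup>2 * (u' x e)\<^sup>2 \<le> R\<^sup>2 * (u' x e)\<^sup>2"
          by (rule mult_right_mono) simp
        moreover have "0 \<le> (u x / 2 + x $ i * u' x e)\<^sup>2" by simp
        moreover have "(u x / 2 + x $ i * u' x e)\<^sup>2 = (u x)\<^sup>2 / 4 + x $ i * (u x * u' x e) + (x $ i)\<^sup>2 * (u' x e)\<^sup>2"
          by (simp add: power2_eq_square algebra_simps)
        ultimately show ?thesis by (simp add: algebra_simps)
      qed
    qed
    then show ?thesis unfolding I_def J_def e_def by simp
  qed
qed

section \<open>Families depending on time\<close>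

abbreviation joint_continuous ::
  "real set \<Rightarrow> 'a::topological_space set \<Rightarrow> (real \<Rightarrow> 'a \<Rightarrow> 'b::topological_space) \<Rightarrow> bool" where
  "joint_continuous U K g \<equiv> continuous_on (U \<times> K) (\<lambda>p. g (fst p) (snd p))"

text \<open>Differentiability is asked in time alone; the space variable enters through joint
  continuity, which compactness turns into uniformity. The derivative is an argument, so that sums,
  products and square roots carry explicit derivatives that can be differentiated once more.\<close>

definition time_C1 ::
  "real set \<Rightarrow> 'a::topological_space set \<Rightarrow> (real \<Rightarrow> 'a \<Rightarrow> real) \<Rightarrow> (real \<Rightarrow> 'a \<Rightarrow> real) \<Rightarrow> bool" where
  "time_C1 U K g g' \<longleftrightarrow> joint_continuous U K g \<and> joint_continuous U K g' \<and>
     (\<forall>t\<in>U. \<forall>x\<in>K. ((\<lambda>s. g s x) has_real_derivative g' t x) (at t))"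

definition time_C2 :: "real set \<Rightarrow> 'a::topological_space set \<Rightarrow> (real \<Rightarrow> 'a \<Rightarrow> real) \<Rightarrow> bool" where
  "time_C2 U K g \<longleftrightarrow> (\<exists>g' g''. time_C1 U K g g' \<and> time_C1 U K g' g'')"

lemma slice_continuous:
  assumes "joint_continuous U K g" "t \<in> U"
  shows "continuous_on K (g t)"
proof -
  have "continuous_on K ((\<lambda>p. g (fst p) (snd p)) \<circ> (\<lambda>x. (t, x)))"
    using assms(2) by (intro continuous_on_compose continuous_intros continuous_on_subset[OF assms(1)]) auto
  then show ?thesis by (simp add: o_def)
qed

lemma uniform_in_parameter:
  fixes g :: "real \<Rightarrow> 'a::metric_space \<Rightarrow> 'b::metric_space"
  assumes "joint_continuous U K g" "open U" "compact K" "t \<in> U" "e > 0"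
  obtains d where "d > 0" "{t - d..t + d} \<subseteq> U"
    "\<And>s x. \<bar>s - t\<bar> \<le> d \<Longrightarrow> x \<in> K \<Longrightarrow> dist (g s x) (g t x) \<le> e"
proof -
  obtain c where c: "c > 0" "cball t c \<subseteq> U"
    using assms(2,4) open_contains_cball by metis
  have "compact (cball t c \<times> K)" using assms(3) by (intro compact_Times) auto
  moreover have "continuous_on (cball t c \<times> K) (\<lambda>p. g (fst p) (snd p))"
    by (rule continuous_on_subset[OF assms(1)]) (use c(2) in auto)
  ultimately have "uniformly_continuous_on (cball t c \<times> K) (\<lambda>p. g (fst p) (snd p))"
    by (rule compact_uniformly_continuous[rotated])
  then obtain d where d: "d > 0" and
    *: "\<And>p q. p \<in> cball t c \<times> K \<Longrightarrow> q \<in> cball t c \<times> K \<Longrightarrow> dist q p < d \<Longrightarrow>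
      dist (g (fst q) (snd q)) (g (fst p) (snd p)) < e"
    using \<open>e > 0\<close> unfolding uniformly_continuous_on_def by metis
  show ?thesis
  proof (rule that[of "min c (d / 2)"])
    show "min c (d / 2) > 0" using c d by simp
    show "{t - min c (d / 2)..t + min c (d / 2)} \<subseteq> U"
      using c(2) by (force simp: dist_real_def)
    show "dist (g s x) (g t x) \<le> e" if "\<bar>s - t\<bar> \<le> min c (d / 2)" "x \<in> K" for s x
      using *[of "(t, x)" "(s, x)"] that c d by (auto simp: dist_real_def dist_Pair_Pair less_imp_le abs_minus_commute)
  qed
qed

lemma has_real_derivative_integral_compact:
  fixes g :: "real \<Rightarrow> 'a::euclidean_space \<Rightarrow> real"
  assumes K: "compact K" and U: "open U" "t \<in> U"
    and C1: "time_C1 U K g g'"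
  shows "((\<lambda>s. integral K (g s)) has_real_derivative integral K (g' t)) (at t)"
proof -
  have g: "joint_continuous U K g" and g': "joint_continuous U K g'"
    and d: "\<And>s x. s \<in> U \<Longrightarrow> x \<in> K \<Longrightarrow> ((\<lambda>s. g s x) has_real_derivative g' s x) (at s)"
    using C1 by (auto simp: time_C1_def)
  have slice: "h s integrable_on K" if "s \<in> U" "joint_continuous U K h" for s and h :: "real \<Rightarrow> 'a \<Rightarrow> real"
    by (rule integrable_on_compact[OF K slice_continuous[OF that(2,1)]])
  define V where "V = integral K (\<lambda>x. 1 :: real)"
  have one: "(\<lambda>x. 1 :: real) integrable_on K" by (intro integrable_on_compact K continuous_intros)
  have V: "V \<ge> 0" unfolding V_def by (intro integral_nonneg one) auto
  show ?thesis
    unfolding has_field_derivative_def has_derivative_at_alt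
  proof (intro conjI allI impI)
    show "bounded_linear ((*) (integral K (g' t)))" by (rule bounded_linear_mult_right)
    fix e :: real assume "e > 0"
    \<comment> \<open>The added 1 covers a compact set of measure zero.\<close>
    then have e: "e / (V + 1) > 0" using V by simp
    obtain d where d0: "d > 0" "{t - d..t + d} \<subseteq> U"
      and du: "\<And>s x. \<bar>s - t\<bar> \<le> d \<Longrightarrow> x \<in> K \<Longrightarrow> dist (g' s x) (g' t x) \<le> e / (V + 1)"
      using uniform_in_parameter[OF g' U(1) K U(2) e] by metis
    show "\<exists>d>0. \<forall>y. norm (y - t) < d \<longrightarrow>
      norm (integral K (g y) - integral K (g t) - integral K (g' t) * (y - t)) \<le> e * norm (y - t)"
    proof (intro exI[of _ d] conjI allI impI d0)
      fix y assume y: "norm (y - t) < d"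
      then have yI: "y \<in> {t - d..t + d}" by (simp add: abs_less_iff)
      then have yU: "y \<in> U" using d0(2) by blast
      have bd: "\<bar>g y x - g t x - g' t x * (y - t)\<bar> \<le> e / (V + 1) * \<bar>y - t\<bar>" if x: "x \<in> K" for x
      proof -
        define f where "f = (\<lambda>s. g s x - g' t x * s)"
        have "norm (f y - f t) \<le> e / (V + 1) * norm (y - t)"
        proof (rule field_differentiable_bound[where S = "{t - d..t + d}" and f' = "\<lambda>s. g' s x - g' t x"])
          show "(f has_field_derivative g' s x - g' t x) (at s within {t - d..t + d})"
            if "s \<in> {t - d..t + d}" for s
          proof -
            have "((\<lambda>s. g s x) has_real_derivative g' s x) (at s within {t - d..t + d})"
              by (rule has_field_derivative_at_within[OF d]) (use that d0(2) x in auto)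
            then show ?thesis unfolding f_def by (auto intro!: derivative_eq_intros)
          qed
          show "norm (g' s x - g' t x) \<le> e / (V + 1)" if "s \<in> {t - d..t + d}" for s
            using du[of s x] x that by (simp add: dist_real_def abs_le_iff)
        qed (use yI d0 in simp_all)
        then show ?thesis by (simp add: f_def algebra_simps)
      qed
      have i1: "(\<lambda>x. g y x - g t x - g' t x * (y - t)) integrable_on K"
        by (intro integrable_diff integrable_on_mult_left slice yU U(2) g g')
      have "integral K (g y) - integral K (g t) - integral K (g' t) * (y - t)
        = integral K (\<lambda>x. g y x - g t x - g' t x * (y - t))"
        by (simp add: integral_diff integrable_diff integrable_on_mult_left slice yU U(2) g g')
      also have "norm \<dots> \<le> integral K (\<lambda>x. e / (V + 1) * \<bar>y - t\<bar> * 1)"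
        using bd by (intro integral_norm_bound_integral i1 integrable_on_mult_right one) auto
      also have "\<dots> = e / (V + 1) * \<bar>y - t\<bar> * V"
        unfolding V_def by (rule integral_mult_right)
      also have "\<dots> = e * (V / (V + 1)) * \<bar>y - t\<bar>" by simp
      also have "\<dots> \<le> e * 1 * \<bar>y - t\<bar>"
        using V \<open>e > 0\<close> by (intro mult_right_mono mult_left_mono) auto
      finally show "norm (integral K (g y) - integral K (g t) - integral K (g' t) * (y - t)) \<le> e * norm (y - t)"
        by simp
    qed
  qed
qed

section \<open>Calculus of functions twice differentiable in time\<close>

lemma time_C1_const: "time_C1 U K (\<lambda>t x. c) (\<lambda>t x. 0)"
  by (simp add: time_C1_def)

lemma time_C1_add:
  assumes "time_C1 U K g g'" "time_C1 U K h h'"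
  shows "time_C1 U K (\<lambda>t x. g t x + h t x) (\<lambda>t x. g' t x + h' t x)"
  using assms unfolding time_C1_def by (auto intro!: continuous_intros DERIV_add)

lemma time_C1_mult:
  assumes "time_C1 U K g g'" "time_C1 U K h h'"
  shows "time_C1 U K (\<lambda>t x. g t x * h t x) (\<lambda>t x. g' t x * h t x + h' t x * g t x)"
  using assms unfolding time_C1_def by (auto intro!: continuous_intros DERIV_mult)

lemma time_C1_inverse:
  assumes "time_C1 U K g g'" "\<And>t x. t \<in> U \<Longrightarrow> x \<in> K \<Longrightarrow> g t x \<noteq> 0"
  shows "time_C1 U K (\<lambda>t x. inverse (g t x)) (\<lambda>t x. - (inverse (g t x) * g' t x * inverse (g t x)))"
  using assms unfolding time_C1_def by (auto intro!: continuous_intros DERIV_inverse')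

text \<open>The derivative is written with the constant 1/2 as a separate factor, so that the rules
  for products and constants apply to it again when the second derivative is formed.\<close>

lemma time_C1_sqrt:
  assumes "time_C1 U K g g'" "\<And>t x. t \<in> U \<Longrightarrow> x \<in> K \<Longrightarrow> g t x > 0"
  shows "time_C1 U K (\<lambda>t x. sqrt (g t x)) (\<lambda>t x. inverse (sqrt (g t x)) * (g' t x * (1/2)))"
proof -
  have "((\<lambda>s. sqrt (g s x)) has_real_derivative inverse (sqrt (g t x)) / 2 * g' t x) (at t)"
    if "t \<in> U" "x \<in> K" for t x
    using assms that unfolding time_C1_def
    by (intro DERIV_chain2[where f = sqrt, OF DERIV_real_sqrt]) auto
  moreover have "\<forall>p\<in>U \<times> K. sqrt (g (fst p) (snd p)) \<noteq> 0" using assms(2) by force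
  ultimately show ?thesis
    using assms(1) unfolding time_C1_def by (auto intro!: continuous_intros)
qed

lemma time_C2_const: "time_C2 U K (\<lambda>t x. c)"
  unfolding time_C2_def by (intro exI conjI) (rule time_C1_const)+

lemma time_C2_add:
  assumes "time_C2 U K g" "time_C2 U K h"
  shows "time_C2 U K (\<lambda>t x. g t x + h t x)"
  using assms unfolding time_C2_def by (blast intro: time_C1_add)

lemma time_C2_mult:
  assumes "time_C2 U K g" "time_C2 U K h"
  shows "time_C2 U K (\<lambda>t x. g t x * h t x)"
proof -
  obtain g' g'' h' h'' where "time_C1 U K g g'" "time_C1 U K g' g''" "time_C1 U K h h'" "time_C1 U K h' h''"
    using assms unfolding time_C2_def by blast
  from time_C1_mult[OF this(1,3)] time_C1_add[OF time_C1_mult[OF this(2,3)] time_C1_mult[OF this(4,1)]]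
  show ?thesis unfolding time_C2_def by blast
qed

lemma time_C2_sum:
  assumes "\<And>i. i \<in> I \<Longrightarrow> time_C2 U K (g i)"
  shows "time_C2 U K (\<lambda>t x. \<Sum>i\<in>I. g i t x)"
  using assms by (induction I rule: infinite_finite_induct) (auto intro!: time_C2_const time_C2_add)

lemma time_C2_prod:
  assumes "\<And>i. i \<in> I \<Longrightarrow> time_C2 U K (g i)"
  shows "time_C2 U K (\<lambda>t x. \<Prod>i\<in>I. g i t x)"
  using assms by (induction I rule: infinite_finite_induct) (auto intro!: time_C2_const time_C2_mult)

lemma time_C2_det:
  fixes M :: "real \<Rightarrow> 'a::topological_space \<Rightarrow> real^'n^'n"
  assumes "\<And>i j. time_C2 U K (\<lambda>t x. M t x $ i $ j)"
  shows "time_C2 U K (\<lambda>t x. det (M t x))"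
  unfolding det_def by (intro time_C2_sum time_C2_mult time_C2_const time_C2_prod assms)

lemma time_C2_sqrt:
  assumes "time_C2 U K g" and pos: "\<And>t x. t \<in> U \<Longrightarrow> x \<in> K \<Longrightarrow> g t x > 0"
  shows "time_C2 U K (\<lambda>t x. sqrt (g t x))"
proof -
  obtain g' g'' where g: "time_C1 U K g g'" "time_C1 U K g' g''"
    using assms(1) unfolding time_C2_def by blast
  have sq: "time_C1 U K (\<lambda>t x. sqrt (g t x)) (\<lambda>t x. inverse (sqrt (g t x)) * (g' t x * (1/2)))"
    using g(1) pos by (rule time_C1_sqrt)
  have "sqrt (g t x) \<noteq> 0" if "t \<in> U" "x \<in> K" for t x using pos[OF that] by simp
  from time_C1_mult[OF time_C1_inverse[OF sq this] time_C1_mult[OF g(2) time_C1_const]] sq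
  show ?thesis unfolding time_C2_def by blast
qed

lemma time_C2_mono:
  assumes "time_C2 U L g" "V \<subseteq> U" "K \<subseteq> L"
  shows "time_C2 V K g"
proof -
  have "V \<times> K \<subseteq> U \<times> L" using assms(2,3) by auto
  then have "time_C1 U L h h' \<Longrightarrow> time_C1 V K h h'" for h h'
    using assms(2,3) continuous_on_subset unfolding time_C1_def by blast
  then show ?thesis using assms(1) unfolding time_C2_def by blast
qed

lemma time_C2_continuous: "time_C2 U K g \<Longrightarrow> joint_continuous U K g"
  by (auto simp: time_C2_def time_C1_def)

lemma time_C2_integral:
  fixes g :: "real \<Rightarrow> 'a::euclidean_space \<Rightarrow> real"
  assumes "time_C2 U K g" "compact K" "open U" "t \<in> U"
  shows "\<exists>D. has_second_derivative (\<lambda>s. integral K (g s)) D t"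
proof -
  obtain g' g'' where g: "time_C1 U K g g'" "time_C1 U K g' g''"
    using assms(1) unfolding time_C2_def by blast
  note D = has_real_derivative_integral_compact[OF assms(2,3)]
  have "\<forall>\<^sub>F s in nhds t. ((\<lambda>s. integral K (g s)) has_real_derivative integral K (g' s)) (at s)"
    using D[OF _ g(1)] assms(3,4) eventually_nhds by blast
  with D[OF assms(4) g(2)] show ?thesis
    unfolding has_second_derivative_def
    by (intro exI[of _ "integral K (g'' t)"] exI[of _ "\<lambda>s. integral K (g' s)"] conjI)
qed

text \<open>A one-sided second-order bound suffices: no first variation formula is needed to see that the
  first derivative vanishes.\<close>

lemma second_derivative_ge:
  assumes sd: "has_second_derivative A D 0" and \<delta>: "\<delta> > 0"
    and low: "\<And>t. \<bar>t\<bar> < \<delta> \<Longrightarrow> A t \<ge> A 0 - C * \<bar>t\<bar> ^ 3"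
    and up: "\<And>t. 0 < t \<Longrightarrow> t < \<delta> \<Longrightarrow> A t \<ge> A 0 + c * t\<^sup>2 - C * t ^ 3"
  shows "D \<ge> 2 * c"
proof (rule ccontr)
  obtain A' where A': "\<forall>\<^sub>F s in nhds 0. (A has_real_derivative A' s) (at s)"
    and D: "(A' has_real_derivative D) (at 0)"
    using sd unfolding has_second_derivative_def by blast
  obtain \<rho> where \<rho>: "\<rho> > 0" "\<And>s. \<bar>s\<bar> < \<rho> \<Longrightarrow> (A has_real_derivative A' s) (at s)"
    using A' unfolding eventually_nhds_metric by (auto simp: dist_real_def)
  \<comment> \<open>For |t| <= 1 the cubic error is at most |C| t^2, so adding this term makes 0 a
    local minimum, while the derivative at 0 is unchanged.\<close>
  have "((\<lambda>t. A t + \<bar>C\<bar> * t\<^sup>2) has_real_derivative A' 0 + 0) (at 0)"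
    using \<rho> by (auto intro!: derivative_eq_intros)
  then have "A' 0 + 0 = 0"
  proof (rule DERIV_local_min)
    show "0 < min \<delta> 1" using \<delta> by simp
    show "\<forall>y. \<bar>0 - y\<bar> < min \<delta> 1 \<longrightarrow> A 0 + \<bar>C\<bar> * 0\<^sup>2 \<le> A y + \<bar>C\<bar> * y\<^sup>2"
    proof (intro allI impI)
      fix y :: real assume y: "\<bar>0 - y\<bar> < min \<delta> 1"
      have "\<bar>y\<bar> ^ 3 \<le> \<bar>y\<bar>\<^sup>2" using y by (intro power_decreasing) auto
      then have "C * \<bar>y\<bar> ^ 3 \<le> \<bar>C\<bar> * y\<^sup>2" by (intro mult_mono) auto
      then show "A 0 + \<bar>C\<bar> * 0\<^sup>2 \<le> A y + \<bar>C\<bar> * y\<^sup>2" using low[of y] y by simp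
    qed
  qed
  then have A0: "A' 0 = 0" by simp
  assume "\<not> 2 * c \<le> D"
  then obtain d where d: "D < d" "d < 2 * c" using dense by (metis not_le)
  have "((\<lambda>h. A' h / h) \<longlongrightarrow> D) (at 0)"
    using D unfolding DERIV_def by (simp add: A0)
  from order_tendstoD(2)[OF this d(1)]
  obtain \<eta> where \<eta>: "\<eta> > 0" "\<And>h. h \<noteq> 0 \<Longrightarrow> \<bar>h\<bar> < \<eta> \<Longrightarrow> A' h / h < d"
    unfolding eventually_at by (auto simp: dist_real_def)
  \<comment> \<open>Below \<open>q\<close> the cubic error is smaller than the gap (c - d/2) t^2
    between the assumed quadratic growth and the growth that a second derivative below
    \<open>d\<close> permits.\<close>
  define q where "q = (c - d / 2) / (\<bar>C\<bar> + 1)"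
  have q: "q > 0" using d by (simp add: q_def)
  define t where "t = min (min \<rho> \<eta>) (min \<delta> q) / 2"
  have t: "0 < t" "t < \<rho>" "t < \<eta>" "t < \<delta>" "t < q"
    unfolding t_def using \<rho>(1) \<eta>(1) \<delta> q by auto
  \<comment> \<open>Near 0 the quotient A'(s)/s is below \<open>d\<close>, so A(s) - d/2 s^2 has a
    non-positive derivative.\<close>
  have "A t - d / 2 * t\<^sup>2 \<le> A 0 - d / 2 * 0\<^sup>2"
  proof (rule DERIV_nonpos_imp_nonincreasing[of 0 t "\<lambda>s. A s - d / 2 * s\<^sup>2"])
    fix s assume s: "0 \<le> s" "s \<le> t"
    have "((\<lambda>s. A s - d / 2 * s\<^sup>2) has_real_derivative A' s - d * s) (at s)"
      using \<rho>(2)[of s] s t by (auto intro!: derivative_eq_intros)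
    moreover have "A' s - d * s \<le> 0"
      using \<eta>(2)[of s] s t A0 by (cases "s = 0") (auto simp: divide_less_eq)
    ultimately show "\<exists>y. ((\<lambda>s. A s - d / 2 * s\<^sup>2) has_real_derivative y) (at s) \<and> y \<le> 0" by blast
  qed (use t in simp)
  with up[OF t(1,4)] have "(c - d / 2) * t\<^sup>2 \<le> C * t * t\<^sup>2"
    by (simp add: algebra_simps power3_eq_cube power2_eq_square)
  then have "c - d / 2 \<le> C * t" using t(1) by simp
  also have "\<dots> \<le> (\<bar>C\<bar> + 1) * t" using t(1) by (intro mult_right_mono) auto
  also have "\<dots> < c - d / 2" using t(5) by (simp add: q_def less_divide_eq mult.commute add_nonneg_pos)
  finally show False by simp
qed

lemma integral_square_pos:
  fixes W :: "real^'n \<Rightarrow> real"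
  assumes K: "compact K" and N: "open N" "x0 \<in> N" "N \<subseteq> K" and W: "continuous_on K W" "W x0 \<noteq> 0"
  shows "integral K (\<lambda>x. (W x)\<^sup>2) > 0"
proof -
  obtain a b where ab: "x0 \<in> box a b" "cbox a b \<subseteq> N"
    using N(1,2) open_contains_cbox by (metis)
  have contW: "continuous_on S (\<lambda>x. (W x)\<^sup>2)" if "S \<subseteq> K" for S
    by (intro continuous_intros continuous_on_subset[OF W(1) that])
  have cK: "cbox a b \<subseteq> K" using ab N by blast
  have iK: "(\<lambda>x. (W x)\<^sup>2) integrable_on K" and ic: "(\<lambda>x. (W x)\<^sup>2) integrable_on cbox a b"
    using K contW cK by (auto intro: integrable_on_compact)
  have "integral (cbox a b) (\<lambda>x. (W x)\<^sup>2) \<noteq> 0"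
  proof
    assume "integral (cbox a b) (\<lambda>x. (W x)\<^sup>2) = 0"
    then have "((\<lambda>x. (W x)\<^sup>2) has_integral 0) (cbox a b)" using ic by (metis has_integral_integral)
    from has_integral_0_cbox_imp_0[OF contW[OF cK] _ this, of x0] ab(1) box_subset_cbox[of a b]
    show False using W(2) by auto
  qed
  moreover have "integral (cbox a b) (\<lambda>x. (W x)\<^sup>2) \<ge> 0" by (intro integral_nonneg ic) auto
  moreover have "integral (cbox a b) (\<lambda>x. (W x)\<^sup>2) \<le> integral K (\<lambda>x. (W x)\<^sup>2)"
    by (intro integral_subset_le cK ic iK) auto
  ultimately show ?thesis by linarith
qed

text \<open>Interchange of \<open>\<partial>\<^sub>t\<close> and the spatial derivative: differentiate the spatial difference quotients
  in time and pass to the limit.\<close>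

lemma frechet_derivative_time_derivative_inner:
  fixes G H :: "real \<Rightarrow> real^'n \<Rightarrow> 'a::euclidean_space"
  assumes U: "open U" and \<Omega>: "open \<Omega>" and t: "t \<in> U" and x: "x \<in> \<Omega>" and b: "b \<in> Basis"
    and GH: "\<And>t x. t \<in> U \<Longrightarrow> x \<in> \<Omega> \<Longrightarrow> ((\<lambda>s. G s x) has_vector_derivative H t x) (at t)"
    and G: "C1_family_on U \<Omega> G" and H: "C1_family_on U \<Omega> H"
  shows "((\<lambda>s. frechet_derivative (G s) (at x) v \<bullet> b) has_real_derivative
    frechet_derivative (H t) (at x) v \<bullet> b) (at t)"
proof -
  let ?E = "\<lambda>s. frechet_derivative (G s) (at x) v \<bullet> b"
  have dG: "(G s has_derivative frechet_derivative (G s) (at y)) (at y)"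
    and dH: "(H s has_derivative frechet_derivative (H s) (at y)) (at y)" if "s \<in> U" "y \<in> \<Omega>" for s y
    using G H that unfolding C1_family_on_def by (auto simp: frechet_derivative_works)
  obtain c0 where c0: "c0 > 0" "cball x c0 \<subseteq> \<Omega>"
    using \<Omega> x open_contains_cball by metis
  define c where "c = c0 / (norm v + 1)"
  have c: "c > 0" using c0 by (simp add: c_def add_nonneg_pos)
  have line: "x + s *\<^sub>R v \<in> \<Omega>" if "\<bar>s\<bar> < c" for s
  proof -
    have "\<bar>s\<bar> * norm v \<le> c * (norm v + 1)"
      using that by (intro mult_mono) auto
    also have "\<dots> = c0" by (simp add: c_def add_nonneg_eq_0_iff)
    finally show ?thesis using c0(2) by (auto simp: dist_norm)
  qed
  obtain d0 where d0: "d0 > 0" "cball t d0 \<subseteq> U"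
    using U t open_contains_cball by metis
  define I where "I = {t - d0<..<t + d0}"
  have IU: "s \<in> U" if "s \<in> cball t d0" for s using that d0 by blast
  have II: "s \<in> cball t d0" if "s \<in> I" for s
    using that by (auto simp: I_def dist_real_def abs_le_iff)
  define D where "D = (\<lambda>\<tau> s. frechet_derivative (H s) (at (x + \<tau> *\<^sub>R v)) v)"
  have contD: "continuous_on ({-c<..<c} \<times> cball t d0) (\<lambda>p. D (fst p) (snd p))"
  proof -
    have "continuous_on (U \<times> \<Omega>) (\<lambda>p. frechet_derivative (H (fst p)) (at (snd p)) v)"
      using H unfolding C1_family_on_def by (simp add: case_prod_unfold)
    then have "continuous_on ({-c<..<c} \<times> cball t d0)
      ((\<lambda>p. frechet_derivative (H (fst p)) (at (snd p)) v) \<circ> (\<lambda>q. (snd q, x + fst q *\<^sub>R v)))"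
      by (intro continuous_on_compose continuous_intros continuous_on_subset
          [where t = "(\<lambda>q. (snd q, x + fst q *\<^sub>R v)) ` ({-c<..<c} \<times> cball t d0)"])
         (use line IU in \<open>force simp: abs_less_iff\<close>)+
    then show ?thesis by (simp add: o_def D_def)
  qed
  \<comment> \<open>With \<open>real n + 2\<close> even the first step is strictly below
    \<open>c\<close>, so every point \<open>x + h n *\<^sub>R v\<close> lies in
    \<open>\<Omega>\<close>.\<close>
  define h where "h = (\<lambda>n. c / (real n + 2))"
  have h: "0 < h n" "h n < c" for n using c by (auto simp: h_def divide_less_eq)
  have hlim: "h \<longlonglongrightarrow> 0" unfolding h_def by real_asymp
  define f f' where "f = (\<lambda>n s. (G s (x + h n *\<^sub>R v) \<bullet> b - G s x \<bullet> b) / h n)"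
    and "f' = (\<lambda>n s. (H s (x + h n *\<^sub>R v) \<bullet> b - H s x \<bullet> b) / h n)"
  have df: "((\<lambda>s. f n s) has_real_derivative f' n s) (at s)" if s: "s \<in> U" for n s
  proof -
    have "((\<lambda>s. G s y \<bullet> b) has_real_derivative H s y \<bullet> b) (at s)" if "y \<in> \<Omega>" for y
      using bounded_linear.has_vector_derivative[OF bounded_linear_inner_left GH[OF s that], of b]
      by (simp add: has_real_derivative_iff_has_vector_derivative)
    moreover have "x + h n *\<^sub>R v \<in> \<Omega>" using h[of n] by (intro line) simp
    ultimately show ?thesis unfolding f_def f'_def using x by (intro DERIV_cdivide DERIV_diff) auto
  qed
  have flim: "(\<lambda>n. f n s) \<longlonglongrightarrow> ?E s" if s: "s \<in> U" for s
  proof -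
    have "((\<lambda>\<tau>. G s (x + \<tau> *\<^sub>R v) \<bullet> b) has_real_derivative ?E s) (at 0)"
      using dG[OF s x] by (intro has_real_derivative_along_line) simp
    then have "((\<lambda>\<tau>. (G s (x + \<tau> *\<^sub>R v) \<bullet> b - G s x \<bullet> b) / \<tau>) \<longlongrightarrow> ?E s) (at 0)"
      by (simp add: DERIV_def)
    moreover have "filterlim h (at 0) sequentially"
      unfolding filterlim_at using hlim h by (auto simp: less_imp_neq[symmetric] order_less_imp_not_eq2)
    ultimately show ?thesis unfolding f_def by (rule filterlim_compose)
  qed
  \<comment> \<open>Exchanging limit and time derivative needs uniform convergence of the
    differentiated quotients. It follows from the mean value theorem in the space direction and
    uniform continuity of \<open>D\<close> on a compact time interval.\<close>
  have unif: "\<forall>\<^sub>F n in sequentially. \<forall>s\<in>I. \<bar>f' n s - D 0 s \<bullet> b\<bar> \<le> e" if e: "e > 0" for e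
  proof -
    obtain d where d: "d > 0" "{0 - d..0 + d} \<subseteq> {-c<..<c}"
      and de: "\<And>\<tau> s. \<bar>\<tau> - 0\<bar> \<le> d \<Longrightarrow> s \<in> cball t d0 \<Longrightarrow> dist (D \<tau> s) (D 0 s) \<le> e"
      using uniform_in_parameter[OF contD _ compact_cball _ e, of 0] c by auto
    have "\<forall>\<^sub>F n in sequentially. h n < d"
      using order_tendstoD(2)[OF hlim d(1)] .
    then show ?thesis
    proof (rule eventually_mono, intro ballI)
      fix n s assume n: "h n < d" and s: "s \<in> I"
      define \<phi> where "\<phi> = (\<lambda>\<tau>. H s (x + \<tau> *\<^sub>R v) \<bullet> b - \<tau> * (D 0 s \<bullet> b))"
      have "norm (\<phi> (h n) - \<phi> 0) \<le> e * norm (h n - 0)"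
      proof (rule field_differentiable_bound[where S = "{0..h n}" and f' = "\<lambda>\<tau>. D \<tau> s \<bullet> b - D 0 s \<bullet> b"])
        fix \<tau> assume \<tau>: "\<tau> \<in> {0..h n}"
        have "((\<lambda>\<tau>. H s (x + \<tau> *\<^sub>R v) \<bullet> b) has_real_derivative D \<tau> s \<bullet> b) (at \<tau>)"
          unfolding D_def using \<tau> h[of n] s by (intro has_real_derivative_along_line dH IU II line) auto
        then have "(\<phi> has_real_derivative D \<tau> s \<bullet> b - D 0 s \<bullet> b) (at \<tau>)"
          unfolding \<phi>_def by (auto intro!: derivative_eq_intros)
        then show "(\<phi> has_real_derivative D \<tau> s \<bullet> b - D 0 s \<bullet> b) (at \<tau> within {0..h n})"
          by (rule has_field_derivative_at_within)
        have "\<bar>(D \<tau> s - D 0 s) \<bullet> b\<bar> \<le> norm (D \<tau> s - D 0 s)"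
          using b by (rule Basis_le_norm)
        also have "\<dots> \<le> e" using de[of \<tau> s] \<tau> n II[OF s] by (simp add: dist_norm)
        finally show "norm (D \<tau> s \<bullet> b - D 0 s \<bullet> b) \<le> e" by (simp add: inner_diff_left)
      qed (use h[of n] in auto)
      moreover have "f' n s - D 0 s \<bullet> b = (\<phi> (h n) - \<phi> 0) / h n"
        using h[of n] by (simp add: f'_def \<phi>_def field_simps)
      ultimately show "\<bar>f' n s - D 0 s \<bullet> b\<bar> \<le> e"
        using h[of n] by (simp add: abs_divide divide_le_eq)
    qed
  qed
  \<comment> \<open>The limit theorem returns some limit function \<open>g\<close>; it is the
    spatial derivative because both are pointwise limits of the same quotients.\<close>
  have "\<exists>g. \<forall>s\<in>I. (\<lambda>n. f n s) \<longlonglongrightarrow> g s \<and> (g has_derivative (\<lambda>d. (D 0 s \<bullet> b) * d)) (at s within I)"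
  proof (rule has_derivative_sequence)
    show "convex I" by (simp add: I_def)
    show "t \<in> I" using d0 by (simp add: I_def)
    show "(\<lambda>n. f n t) \<longlonglongrightarrow> ?E t" by (rule flim[OF t])
    show "(f n has_derivative (*) (f' n s)) (at s within I)" if "s \<in> I" for n s
      using has_field_derivative_at_within[OF df[OF IU[OF II[OF that]]]]
      by (rule has_field_derivative_imp_has_derivative)
    show "\<forall>\<^sub>F n in sequentially. \<forall>s\<in>I. \<forall>d. norm (f' n s * d - (D 0 s \<bullet> b) * d) \<le> e * norm d" if "e > 0" for e
      using unif[OF that]
      by (rule eventually_mono) (auto simp: left_diff_distrib[symmetric] abs_mult intro!: mult_right_mono)
  qed
  then obtain g where g: "\<And>s. s \<in> I \<Longrightarrow> (\<lambda>n. f n s) \<longlonglongrightarrow> g s"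
    "\<And>s. s \<in> I \<Longrightarrow> (g has_derivative (\<lambda>d. (D 0 s \<bullet> b) * d)) (at s within I)" by blast
  have tI: "t \<in> I" "open I" using d0 by (auto simp: I_def)
  have "(g has_derivative (\<lambda>d. (D 0 t \<bullet> b) * d)) (at t)"
    using g(2)[OF tI(1)] at_within_open[OF tI] by simp
  then have "(?E has_derivative (\<lambda>d. (D 0 t \<bullet> b) * d)) (at t)"
  proof (rule has_derivative_transform_within_open[OF _ tI(2,1)])
    show "g s = ?E s" if "s \<in> I" for s
      using g(1)[OF that] flim[OF IU[OF II[OF that]]] by (rule LIMSEQ_unique)
  qed
  then show ?thesis by (simp add: has_field_derivative_def D_def)
qed

lemma time_lipschitz:
  fixes g :: "real \<Rightarrow> 'a::topological_space \<Rightarrow> 'b::euclidean_space"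
  assumes K: "compact K" and d: "{- d..d} \<subseteq> U" "d \<ge> 0"
    and g: "\<And>s x. s \<in> U \<Longrightarrow> x \<in> K \<Longrightarrow> ((\<lambda>s. g s x) has_vector_derivative g' s x) (at s)"
    and cont: "joint_continuous U K g'"
  obtains C where "C \<ge> 0" "\<And>t x. \<bar>t\<bar> \<le> d \<Longrightarrow> x \<in> K \<Longrightarrow> norm (g t x - g 0 x) \<le> C * \<bar>t\<bar>"
proof -
  have "compact ({- d..d} \<times> K)" using K by (intro compact_Times) auto
  moreover have "continuous_on ({- d..d} \<times> K) (\<lambda>p. g' (fst p) (snd p))"
    by (rule continuous_on_subset[OF cont]) (use d in auto)
  ultimately have "bounded ((\<lambda>p. g' (fst p) (snd p)) ` ({- d..d} \<times> K))"
    by (intro compact_imp_bounded compact_continuous_image)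
  then obtain C where C: "C > 0" "\<And>s x. s \<in> {- d..d} \<Longrightarrow> x \<in> K \<Longrightarrow> norm (g' s x) \<le> C"
    unfolding bounded_pos by force
  show ?thesis
  proof (rule that[of C])
    show "norm (g t x - g 0 x) \<le> C * \<bar>t\<bar>" if t: "\<bar>t\<bar> \<le> d" and x: "x \<in> K" for t x
    proof -
      have "norm (g t x - g 0 x) \<le> C * norm (t - 0)"
      proof (rule differentiable_bound[where S = "{- d..d}" and f = "\<lambda>s. g s x" and f' = "\<lambda>s h. h *\<^sub>R g' s x"])
        fix s assume s: "s \<in> {- d..d}"
        show "((\<lambda>s. g s x) has_derivative (\<lambda>h. h *\<^sub>R g' s x)) (at s within {- d..d})"
        proof (rule has_derivative_at_withinI)
          have "s \<in> U" using s d by blast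
          from g[OF this x] show "((\<lambda>s. g s x) has_derivative (\<lambda>h. h *\<^sub>R g' s x)) (at s)"
            by (simp only: has_vector_derivative_def)
        qed
        show "onorm (\<lambda>h. h *\<^sub>R g' s x) \<le> C"
        proof (rule onorm_le)
          show "norm (h *\<^sub>R g' s x) \<le> C * norm h" for h
            using mult_left_mono[OF C(2)[OF s x], of "\<bar>h\<bar>"] by (simp add: mult.commute)
        qed
      qed (use t d in auto)
      then show ?thesis by simp
    qed
  qed (use C in simp)
qed

lemma linear_expand_axis:
  fixes L :: "real^'n \<Rightarrow> 'b::real_vector"
  assumes "linear L"
  shows "L v = (\<Sum>i\<in>UNIV. v $ i *\<^sub>R L (axis i 1))"
proof -
  have "L v = L (\<Sum>i\<in>UNIV. v $ i *\<^sub>R axis i 1)"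
    using basis_expansion[of v] by (simp add: scalar_mult_eq_scaleR)
  then show ?thesis by (simp add: linear_sum[OF assms] linear_scale[OF assms])
qed

lemma norm_linear_le_sum_axis:
  fixes L :: "real^'n \<Rightarrow> 'b::real_normed_vector"
  assumes "linear L" "\<And>i. norm (L (axis i 1)) \<le> B"
  shows "norm (L v) \<le> real CARD('n) * B * norm v"
proof -
  have "L v = (\<Sum>i\<in>UNIV. v $ i *\<^sub>R L (axis i 1))" by (rule linear_expand_axis[OF assms(1)])
  also have "norm \<dots> \<le> (\<Sum>i\<in>(UNIV::'n set). norm v * B)"
    by (rule sum_norm_le) (auto intro!: mult_mono component_le_norm_cart assms(2))
  finally show ?thesis by (simp add: ac_simps)
qed

section \<open>Reparametrization and change of variables\<close>

text \<open>\<open>P\<close> is the identity plus a 1/2-Lipschitz map, so Banach's fixed point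
  theorem inverts it globally, without an inverse function theorem and its shrinking neighbourhoods.
  Being the identity off \<open>K\<close>, it maps \<open>K\<close> onto itself, so the comparison
  graph lies over the same compact set.\<close>

lemma graph_reparametrization:
  fixes P :: "real^'n \<Rightarrow> real^'n" and Q f :: "real^'n \<Rightarrow> 'b::real_normed_vector"
  assumes \<Omega>: "open \<Omega>" and K: "compact K" "K \<subseteq> \<Omega>"
    and dP: "\<And>x. x \<in> \<Omega> \<Longrightarrow> (P has_derivative DP x) (at x)"
    and dQ: "\<And>x. x \<in> \<Omega> \<Longrightarrow> (Q has_derivative DQ x) (at x)"
    and small: "\<And>x v. x \<in> \<Omega> \<Longrightarrow> norm (DP x v - v) \<le> norm v / 2"
    and off: "\<And>x. x \<in> \<Omega> - K \<Longrightarrow> P x = x" "\<And>x. x \<in> \<Omega> - K \<Longrightarrow> Q x = f x"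
  obtains h Dh where "inj_on P K" "P ` K = K" "\<And>x. x \<in> \<Omega> \<Longrightarrow> P x \<in> \<Omega>"
    "\<And>y. y \<in> \<Omega> \<Longrightarrow> (h has_derivative Dh y) (at y)"
    "\<And>y. y \<in> \<Omega> - K \<Longrightarrow> h y = f y"
    "\<And>x. x \<in> \<Omega> \<Longrightarrow> h (P x) = Q x"
    "\<And>x v. x \<in> \<Omega> \<Longrightarrow> Dh (P x) (DP x v) = DQ x v"
proof -
  \<comment> \<open>Extending by the identity serves two purposes: the derivative bound becomes a
    Lipschitz bound, since the whole space is convex while \<open>\<Omega>\<close> may not be, and
    the fixed point argument runs in a complete space.\<close>
  define Pe where "Pe = (\<lambda>x. if x \<in> \<Omega> then P x else x)"
  define \<eta> where "\<eta> = (\<lambda>x. Pe x - x)"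
  define E where "E = (\<lambda>x v. if x \<in> \<Omega> then DP x v - v else 0)"
  have Pe_off: "Pe x = x" if "x \<notin> K" for x using that off by (auto simp: Pe_def)
  have dPe: "(Pe has_derivative DP x) (at x)" if "x \<in> \<Omega>" for x
    by (rule has_derivative_transform_within_open[OF dP[OF that] \<Omega> that]) (simp add: Pe_def)
  have dE: "(\<eta> has_derivative E x) (at x)" for x
  proof (cases "x \<in> \<Omega>")
    case True
    have "(\<eta> has_derivative (\<lambda>v. DP x v - v)) (at x)"
      unfolding \<eta>_def by (rule has_derivative_diff[OF dPe[OF True] has_derivative_ident])
    then show ?thesis using True by (simp add: E_def)
  next
    case False
    have "(\<eta> has_derivative (\<lambda>v. 0)) (at x)"
      by (rule has_derivative_transform_within_open
          [OF has_derivative_const open_Compl[OF compact_imp_closed[OF K(1)]]])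
         (use False K(2) Pe_off in \<open>auto simp: \<eta>_def\<close>)
    then show ?thesis using False by (simp add: E_def)
  qed
  have lip: "norm (\<eta> x - \<eta> y) \<le> 1/2 * norm (x - y)" for x y
  proof (rule differentiable_bound[where S = UNIV and f' = E])
    show "(\<eta> has_derivative E z) (at z within UNIV)" for z using dE by simp
    show "onorm (E z) \<le> 1/2" for z
      by (rule onorm_le) (use small in \<open>simp add: E_def\<close>)
  qed auto
  have Pe\<eta>: "Pe x = x + \<eta> x" for x by (simp add: \<eta>_def)
  have expand: "norm (x - y) \<le> 2 * norm (Pe x - Pe y)" for x y
  proof -
    have "x - y = (Pe x - Pe y) - (\<eta> x - \<eta> y)" by (simp add: Pe\<eta>)
    then have "norm (x - y) \<le> norm (Pe x - Pe y) + norm (\<eta> x - \<eta> y)"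
      using norm_triangle_ineq4[of "Pe x - Pe y" "\<eta> x - \<eta> y"] by simp
    with lip[of x y] show ?thesis by simp
  qed
  have inj: "inj Pe"
  proof (rule injI)
    show "x = y" if "Pe x = Pe y" for x y using expand[of x y] that by simp
  qed
  have surj: "\<exists>x. Pe x = y" for y
  proof -
    \<comment> \<open>A preimage of \<open>y\<close> is the same as a fixed point of the contraction
      x -> y - \<eta>(x).\<close>
    have "\<exists>!x. y - \<eta> x = x"
    proof (rule banach_fix_type)
      show "\<forall>x z. dist (y - \<eta> x) (y - \<eta> z) \<le> 1/2 * dist x z"
        using lip by (simp add: dist_norm norm_minus_commute)
    qed auto
    then obtain x where "y - \<eta> x = x" by blast
    then have "Pe x = y" by (simp add: Pe\<eta> algebra_simps)
    then show ?thesis by blast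
  qed
  define g where "g = inv Pe"
  have "surj Pe" using surj unfolding surj_def by metis
  then have Pg: "Pe (g y) = y" for y unfolding g_def by (rule surj_f_inv_f)
  have gP: "g (Pe x) = x" for x unfolding g_def by (rule inv_f_f[OF inj])
  have g_off: "g y = y" if "y \<notin> K" for y using gP[of y] Pe_off[OF that] by simp
  have PeK: "x \<in> K \<longleftrightarrow> Pe x \<in> K" for x
  proof
    assume "x \<in> K"
    show "Pe x \<in> K"
    proof (rule ccontr)
      assume "Pe x \<notin> K"
      from g_off[OF this] have "x = Pe x" by (simp only: gP)
      with \<open>x \<in> K\<close> \<open>Pe x \<notin> K\<close> show False by simp
    qed
  next
    assume "Pe x \<in> K"
    then show "x \<in> K" using Pe_off[of x] by (cases "x \<in> K") auto
  qed
  have g\<Omega>: "g y \<in> \<Omega>" if "y \<in> \<Omega>" for y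
    using that g_off[of y] PeK[of "g y", unfolded Pg] K(2) by (cases "y \<in> K") auto
  have contg: "continuous (at y) g" for y
  proof -
    have "((\<lambda>z. 2 * norm (z - y)) \<longlongrightarrow> 2 * norm (y - y)) (at y)"
      by (intro tendsto_intros)
    then have lim: "((\<lambda>z. 2 * norm (z - y)) \<longlongrightarrow> 0) (at y)" by simp
    have "norm (g z - g y) \<le> 2 * norm (z - y)" for z
      using expand[of "g z" "g y"] by (simp add: Pg)
    then have "((\<lambda>z. g z - g y) \<longlongrightarrow> 0) (at y)"
      by (intro Lim_null_comparison[OF _ lim]) simp
    then show ?thesis by (simp add: continuous_at LIM_zero_iff)
  qed
  have "\<exists>G. linear G \<and> (\<forall>v. G (DP x v) = v)" if x: "x \<in> \<Omega>" for x
  proof -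
    have lin: "linear (DP x)" using dP[OF x] by (rule has_derivative_linear)
    have "v = 0" if "DP x v = 0" for v
      using small[OF x, of v] that by simp
    then have "inj (DP x)" using lin by (simp add: linear_injective_0)
    then show ?thesis using linear_injective_isomorphism[OF lin] by blast
  qed
  then obtain G where G: "\<And>x. x \<in> \<Omega> \<Longrightarrow> linear (G x)" "\<And>x v. x \<in> \<Omega> \<Longrightarrow> G x (DP x v) = v"
    by metis
  have dg: "(g has_derivative G (g y)) (at y)" if y: "y \<in> \<Omega>" for y
  proof (rule has_derivative_inverse_basic[where f = Pe and T = UNIV])
    show "(Pe has_derivative DP (g y)) (at (g y))" by (rule dPe[OF g\<Omega>[OF y]])
    show "bounded_linear (G (g y))"
      using G(1)[OF g\<Omega>[OF y]] by (simp add: linear_conv_bounded_linear)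
    show "G (g y) \<circ> DP (g y) = id" using G(2)[OF g\<Omega>[OF y]] by (simp add: fun_eq_iff)
  qed (auto simp: contg Pg)
  show ?thesis
  proof (rule that[of "\<lambda>y. Q (g y)" "\<lambda>y v. DQ (g y) (G (g y) v)"])
    have PPe: "P x = Pe x" if "x \<in> \<Omega>" for x using that by (simp add: Pe_def)
    show "inj_on P K" 
    proof (rule inj_onI)
      fix x y assume xy: "x \<in> K" "y \<in> K" "P x = P y"
      then have "x \<in> \<Omega>" "y \<in> \<Omega>" using K(2) by auto
      then have "Pe x = Pe y" using PPe[of x] PPe[of y] xy(3) by simp
      then show "x = y" by (rule injD[OF inj])
    qed
    show "P ` K = K"
    proof (intro equalityI subsetI)
      fix y assume "y \<in> P ` K"
      then show "y \<in> K" using PPe K(2) PeK by auto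
    next
      fix y assume "y \<in> K"
      then have "g y \<in> K" "P (g y) = y" using PeK[of "g y", unfolded Pg] Pg[of y] PPe[of "g y"] K(2) by auto
      then show "y \<in> P ` K" using image_eqI[of y P "g y" K] by simp
    qed
    show P\<Omega>: "P x \<in> \<Omega>" if "x \<in> \<Omega>" for x
      using that PPe PeK[of x] Pe_off[of x] K(2) by (cases "x \<in> K") auto
    show "((\<lambda>y. Q (g y)) has_derivative (\<lambda>v. DQ (g y) (G (g y) v))) (at y)" if "y \<in> \<Omega>" for y
      by (rule has_derivative_compose[where f = g and g = Q, OF dg[OF that] dQ[OF g\<Omega>[OF that]]])
    show "Q (g y) = f y" if "y \<in> \<Omega> - K" for y
      using that g_off[of y] off(2)[of y] by simp
    show "Q (g (P x)) = Q x" if "x \<in> \<Omega>" for x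
      using that by (simp add: PPe gP)
    show "DQ (g (P x)) (G (g (P x)) (DP x v)) = DQ x v" if "x \<in> \<Omega>" for x v
      using that by (simp add: PPe gP G)
  qed
qed

text \<open>The change of variables theorem of the library is available only for well-ordered index
  types, so it is transported along an enumeration of the index type.\<close>

typedef ('a::finite) enum_index = "{..<CARD('a)}"
  by (rule exI[of _ 0]) simp

instance enum_index :: (finite) finite
proof
  have "(UNIV :: 'a enum_index set) = Abs_enum_index ` {..<CARD('a)}"
    by (metis (mono_tags, lifting) Abs_enum_index_cases UNIV_eq_I image_eqI)
  then show "finite (UNIV :: 'a enum_index set)"
    by (metis finite_imageI finite_lessThan)
qed

instantiation enum_index :: (finite) wellorder
begin

definition "a \<le> b \<longleftrightarrow> Rep_enum_index a \<le> Rep_enum_index b"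
definition "a < b \<longleftrightarrow> Rep_enum_index a < Rep_enum_index b"

instance
proof
  fix P :: "'a enum_index \<Rightarrow> bool" and a :: "'a enum_index"
  assume step: "\<And>x. (\<And>y. y < x \<Longrightarrow> P y) \<Longrightarrow> P x"
  show "P a"
  proof (induction a rule: measure_induct_rule[of Rep_enum_index])
    case (less x)
    show ?case by (rule step, rule less.IH) (simp only: less_enum_index_def)
  qed
qed (auto simp: less_eq_enum_index_def less_enum_index_def Rep_enum_index_inject)

end

lemma ex_enum_index_bij: "\<exists>\<pi> :: 'n::finite enum_index \<Rightarrow> 'n. bij \<pi>"
proof -
  have "CARD('n enum_index) = CARD('n)"
    using type_definition.card[OF type_definition_enum_index] by simp
  then show ?thesis
    by (intro finite_same_card_bij) auto
qed

definition reindex :: "('k \<Rightarrow> 'n) \<Rightarrow> real^'n \<Rightarrow> real^'k" where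
  "reindex \<pi> x = (\<chi> k. x $ \<pi> k)"

lemma reindex_inv:
  assumes "bij \<pi>"
  shows "reindex \<pi> (reindex (inv \<pi>) x) = x" "reindex (inv \<pi>) (reindex \<pi> y) = y"
  using assms by (simp_all add: reindex_def vec_eq_iff bij_is_inj bij_is_surj surj_f_inv_f)

lemma linear_reindex: "linear (reindex \<pi>)"
  by (auto intro!: linearI simp: reindex_def vec_eq_iff)

lemma bounded_linear_reindex: "bounded_linear (reindex \<pi> :: real^'n \<Rightarrow> real^'k)"
  using linear_reindex linear_conv_bounded_linear by blast

lemma reindex_cbox:
  fixes \<pi> :: "'k::finite \<Rightarrow> 'n::finite"
  assumes "bij \<pi>"
  shows "reindex \<pi> ` cbox a b = cbox (reindex \<pi> a) (reindex \<pi> b)"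
proof (intro equalityI subsetI)
  fix y assume y: "y \<in> cbox (reindex \<pi> a) (reindex \<pi> b)"
  have "a $ i \<le> y $ inv \<pi> i \<and> y $ inv \<pi> i \<le> b $ i" for i
    using y[unfolded mem_box_cart, rule_format, of "inv \<pi> i"] assms
    by (simp add: reindex_def bij_is_surj surj_f_inv_f)
  then have "reindex (inv \<pi>) y \<in> cbox a b" by (simp add: mem_box_cart reindex_def)
  then show "y \<in> reindex \<pi> ` cbox a b" by (metis assms image_eqI reindex_inv(1))
qed (auto simp: mem_box_cart reindex_def)

lemma content_reindex_cbox:
  fixes \<pi> :: "'k::finite \<Rightarrow> 'n::finite"
  assumes "bij \<pi>"
  shows "Henstock_Kurzweil_Integration.content (reindex \<pi> ` cbox a b) = Henstock_Kurzweil_Integration.content (cbox a b)"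
proof (cases "cbox a b = {}")
  case False
  moreover have "cbox (reindex \<pi> a) (reindex \<pi> b) \<noteq> {}"
    using False unfolding reindex_cbox[OF assms, symmetric] by simp
  moreover have "(\<Prod>k\<in>UNIV. b $ \<pi> k - a $ \<pi> k) = (\<Prod>i\<in>UNIV. b $ i - a $ i)"
    by (rule prod.reindex_bij_betw[OF assms])
  ultimately show ?thesis
    unfolding reindex_cbox[OF assms] by (simp add: content_cbox_cart reindex_def)
qed simp

text \<open>Renaming coordinates maps boxes to boxes of the same content in both directions, so the
  integral is transported box by box; boundedness of \<open>A\<close> provides the enclosing
  box.\<close>

lemma has_integral_reindex:
  fixes \<pi> :: "'k::finite \<Rightarrow> 'n::finite" and f :: "real^'n \<Rightarrow> real"
  assumes \<pi>: "bij \<pi>" and f: "(f has_integral I) A" and "bounded A"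
  shows "((\<lambda>y. f (reindex (inv \<pi>) y)) has_integral I) (reindex \<pi> ` A)"
proof -
  note inv = reindex_inv[OF \<pi>]
  have \<pi>': "bij (inv \<pi>)" using \<pi> by (rule bij_imp_bij_inv)
  obtain a b where ab: "A \<subseteq> cbox a b"
    using \<open>bounded A\<close> bounded_subset_cbox_symmetric by metis
  define f1 where "f1 = (\<lambda>x. if x \<in> A then f x else 0)"
  have "(f1 has_integral I) (cbox a b)"
    using f ab unfolding f1_def by (simp add: has_integral_restrict)
  then have "((\<lambda>y. f1 (reindex (inv \<pi>) y)) has_integral (1 / 1) *\<^sub>R I) (reindex \<pi> ` cbox a b)"
  proof (intro has_integral_twiddle)
    show "\<exists>w z. reindex (inv \<pi>) ` cbox u v = cbox w z" for u v :: "real^'k"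
      using reindex_cbox[OF \<pi>'] by blast
    show "\<exists>w z. reindex \<pi> ` cbox u v = cbox w z" for u v :: "real^'n"
      using reindex_cbox[OF \<pi>] by blast
    show "continuous (at y) (reindex (inv \<pi>))" for y :: "real^'k"
      by (rule linear_continuous_at[OF bounded_linear_reindex])
  qed (simp_all add: inv content_reindex_cbox[OF \<pi>'])
  moreover have "f1 (reindex (inv \<pi>) y) = (if y \<in> reindex \<pi> ` A then f (reindex (inv \<pi>) y) else 0)" for y
    unfolding f1_def using inv by (metis (no_types, lifting) imageE image_eqI)
  moreover have "reindex \<pi> ` A \<subseteq> reindex \<pi> ` cbox a b" using ab by blast
  ultimately show ?thesis
    by (simp add: has_integral_restrict)
qed

text \<open>Conjugation by \<open>\<pi>\<close> is a sign-preserving bijection between the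
  permutations of the two index types and matches the Leibniz sums term by term.\<close>

lemma det_reindex:
  fixes M :: "real^'n^'n" and \<pi> :: "'k::finite \<Rightarrow> 'n"
  assumes \<pi>: "bij \<pi>"
  shows "det (\<chi> k l. M $ \<pi> k $ \<pi> l) = det M"
proof -
  have inv: "inv \<pi> (\<pi> k) = k" "\<pi> (inv \<pi> i) = i" for k i
    using \<pi> by (simp_all add: bij_is_inj bij_is_surj surj_f_inv_f)
  have sgn: "sign (\<pi> \<circ> q \<circ> inv \<pi>) = sign q" if "q permutes UNIV" for q
  proof -
    have "map_permutation UNIV \<pi> q = \<pi> \<circ> q \<circ> inv \<pi>"
      using \<pi> by (simp add: map_permutation_def restrict_id_def fun_eq_iff bij_is_surj)
    then show ?thesis
      using sign_map_permutation[of \<pi> UNIV q] \<pi> that by (simp add: bij_is_inj)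
  qed
  have perm: "\<pi> \<circ> q \<circ> inv \<pi> permutes UNIV" if "q permutes UNIV" for q
    using that \<pi> by (intro bij_imp_permutes bij_comp bij_imp_bij_inv) (auto dest: permutes_bij)
  have perm': "inv \<pi> \<circ> q \<circ> \<pi> permutes UNIV" if "q permutes UNIV" for q
    using that \<pi> by (intro bij_imp_permutes bij_comp bij_imp_bij_inv) (auto dest: permutes_bij)
  have "det (\<chi> k l. M $ \<pi> k $ \<pi> l)
    = (\<Sum>q\<in>{q. q permutes (UNIV::'k set)}. of_int (sign q) * (\<Prod>k\<in>UNIV. M $ \<pi> k $ \<pi> (q k)))"
    by (simp add: det_def)
  also have "\<dots> = (\<Sum>p\<in>{p. p permutes (UNIV::'n set)}. of_int (sign p) * (\<Prod>i\<in>UNIV. M $ i $ p i))"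
  proof (rule sum.reindex_bij_witness[of _ "\<lambda>p. inv \<pi> \<circ> p \<circ> \<pi>" "\<lambda>q. \<pi> \<circ> q \<circ> inv \<pi>"])
    fix q :: "'k \<Rightarrow> 'k" assume q: "q \<in> {q. q permutes UNIV}"
    have "(\<Prod>i\<in>UNIV. M $ i $ (\<pi> \<circ> q \<circ> inv \<pi>) i) = (\<Prod>k\<in>UNIV. M $ \<pi> k $ (\<pi> \<circ> q \<circ> inv \<pi>) (\<pi> k))"
      by (rule prod.reindex_bij_betw[OF \<pi>, symmetric])
    then show "of_int (sign (\<pi> \<circ> q \<circ> inv \<pi>)) * (\<Prod>i\<in>UNIV. M $ i $ (\<pi> \<circ> q \<circ> inv \<pi>) i)
      = of_int (sign q) * (\<Prod>k\<in>UNIV. M $ \<pi> k $ \<pi> (q k))"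
      using sgn q by (simp add: inv)
  qed (use perm perm' in \<open>auto simp: fun_eq_iff inv\<close>)
  finally show ?thesis by (simp add: det_def)
qed

lemma matrix_reindex:
  fixes \<pi> :: "'k::finite \<Rightarrow> 'n::finite"
  assumes "bij \<pi>"
  shows "matrix (\<lambda>v. reindex \<pi> (L (reindex (inv \<pi>) v))) = (\<chi> k l. matrix L $ \<pi> k $ \<pi> l)"
proof -
  have "reindex (inv \<pi>) (axis l 1) = (axis (\<pi> l) 1 :: real^'n)" for l
  proof -
    have "inv \<pi> i = l \<longleftrightarrow> i = \<pi> l" for i
      using assms by (metis bij_inv_eq_iff)
    then show ?thesis by (simp add: reindex_def vec_eq_iff axis_def)
  qed
  then show ?thesis by (simp add: matrix_def reindex_def vec_eq_iff)
qed

lemma bounded_linear_vec1: "bounded_linear (vec :: real \<Rightarrow> real^1)"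
  by (auto intro!: linearI simp: linear_conv_bounded_linear[symmetric] vec_eq_iff)

text \<open>Continuity is assumed for the pulled-back product and not for \<open>\<phi>\<close>;
  integrability of \<open>\<phi>\<close> on the image is part of the conclusion. In the application
  \<open>\<phi>\<close> is the density of a comparison map, whose derivative is not known to be
  continuous.\<close>

lemma has_integral_image_compact:
  fixes g :: "real^'n \<Rightarrow> real^'n" and \<phi> :: "real^'n \<Rightarrow> real"
  assumes K: "compact K" and g: "\<And>x. x \<in> K \<Longrightarrow> (g has_derivative g' x) (at x)" and inj: "inj_on g K"
    and cont: "continuous_on K (\<lambda>x. \<bar>det (matrix (g' x))\<bar> * \<phi> (g x))"
  shows "(\<phi> has_integral integral K (\<lambda>x. \<bar>det (matrix (g' x))\<bar> * \<phi> (g x))) (g ` K)"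
proof -
  obtain \<pi> :: "'n enum_index \<Rightarrow> 'n" where \<pi>: "bij \<pi>" using ex_enum_index_bij by blast
  have \<pi>': "bij (inv \<pi>)" "inv (inv \<pi>) = \<pi>" using \<pi> by (simp_all add: bij_imp_bij_inv inv_inv_eq)
  define R where "R = (reindex \<pi> :: real^'n \<Rightarrow> _)"
  define S where "S = (reindex (inv \<pi>) :: _ \<Rightarrow> real^'n)"
  have RS: "R (S y) = y" "S (R x) = x" for x y
    unfolding R_def S_def using reindex_inv[OF \<pi>] by auto
  have blR: "bounded_linear R" and blS: "bounded_linear S"
    unfolding R_def S_def by (rule bounded_linear_reindex)+
  define K2 where "K2 = R ` K"
  define g2 where "g2 = (\<lambda>y. R (g (S y)))"
  define g2' where "g2' = (\<lambda>y v. R (g' (S y) (S v)))"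
  define \<psi> where "\<psi> = (\<lambda>x. \<bar>det (matrix (g' x))\<bar> * \<phi> (g x))"
  define b where "b = integral K \<psi>"
  have contg: "continuous_on K g"
    using g by (intro has_derivative_continuous_on) (auto intro: has_derivative_at_withinI)
  have K2: "compact K2" unfolding K2_def
    by (intro compact_continuous_image K linear_continuous_on blR)
  have S2: "S y \<in> K" if "y \<in> K2" for y using that RS by (auto simp: K2_def)
  have dg2: "(g2 has_derivative g2' y) (at y within K2)" if "y \<in> K2" for y
  proof -
    have "((\<lambda>y. g (S y)) has_derivative (\<lambda>v. g' (S y) (S v))) (at y)"
      by (rule has_derivative_compose[where f = S and g = g,
          OF bounded_linear_imp_has_derivative[OF blS] g[OF S2[OF that]]])
    from has_derivative_at_withinI[OF bounded_linear.has_derivative[OF blR this]] show ?thesis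
      by (simp only: g2_def g2'_def)
  qed
  have inj2: "inj_on g2 K2"
  proof (rule inj_onI)
    fix y z assume *: "y \<in> K2" "z \<in> K2" "g2 y = g2 z"
    then have "S (g2 y) = S (g2 z)" by simp
    then have "g (S y) = g (S z)" by (simp add: g2_def RS(2))
    then have "S y = S z" using inj S2 * by (auto dest: inj_onD)
    then show "y = z" by (metis RS(1))
  qed
  have det2: "det (matrix (g2' y)) = det (matrix (g' (S y)))" for y
    unfolding g2'_def R_def S_def matrix_reindex[OF \<pi>] by (rule det_reindex[OF \<pi>])
  have Sg2: "S (g2 y) = g (S y)" for y by (simp add: g2_def RS)
  have eq: "\<bar>det (matrix (g2' y))\<bar> * \<phi> (S (g2 y)) = \<psi> (S y)" for y
    by (simp add: det2 Sg2 \<psi>_def)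
  have contS: "continuous_on K2 (\<lambda>y. \<psi> (S y))"
    by (rule continuous_on_compose2[OF cont[folded \<psi>_def] linear_continuous_on[OF blS]]) (use S2 in auto)
  have "(\<psi> has_integral b) K"
    unfolding b_def \<psi>_def by (intro integrable_integral integrable_on_compact K cont)
  from has_integral_reindex[OF \<pi> this compact_imp_bounded[OF K]]
  have b2: "((\<lambda>y. \<psi> (S y)) has_integral b) K2" by (simp add: R_def S_def K2_def)
  have "(\<lambda>y. norm (\<psi> (S y))) integrable_on K2"
    by (intro integrable_on_compact K2 continuous_on_norm contS)
  then have abs2: "(\<lambda>y. \<psi> (S y)) absolutely_integrable_on K2"
    using b2 by (auto simp: absolutely_integrable_on_def integrable_on_def)
  \<comment> \<open>The integrand is made \<open>real^1\<close>-valued to fit the vector-valued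
    change of variables formula.\<close>
  have ab: "(\<lambda>y. \<bar>det (matrix (g2' y))\<bar> *\<^sub>R (vec (\<phi> (S (g2 y))) :: real^1)) absolutely_integrable_on K2"
    unfolding absolutely_integrable_on_1_iff using abs2 by (simp add: eq)
  have int: "integral K2 (\<lambda>y. \<bar>det (matrix (g2' y))\<bar> *\<^sub>R (vec (\<phi> (S (g2 y))) :: real^1)) = vec b"
  proof -
    have "((\<lambda>y. (vec (\<psi> (S y)) :: real^1)) has_integral vec b) K2"
      using has_integral_linear[OF b2 bounded_linear_vec1] by (simp add: o_def)
    then show ?thesis
    proof (intro integral_unique, elim has_integral_eq[rotated])
      show "vec (\<psi> (S y)) = \<bar>det (matrix (g2' y))\<bar> *\<^sub>R (vec (\<phi> (S (g2 y))) :: real^1)" for y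
        unfolding eq[symmetric] by (simp add: vec_eq_iff)
    qed
  qed
  have K2s: "K2 \<in> sets lebesgue"
    using K2 by (simp add: lmeasurable_compact fmeasurableD)
  have "(\<lambda>z. (vec (\<phi> (S z)) :: real^1)) absolutely_integrable_on (g2 ` K2)
      \<and> integral (g2 ` K2) (\<lambda>z. (vec (\<phi> (S z)) :: real^1)) = vec b"
    using has_absolute_integral_change_of_variables[OF K2s dg2 inj2, of "\<lambda>z. vec (\<phi> (S z)) :: real^1" "vec b"]
      ab int by blast
  then have "((\<lambda>z. (vec (\<phi> (S z)) :: real^1)) has_integral vec b) (g2 ` K2)"
    by (simp add: has_integral_iff set_lebesgue_integral_eq_integral(1))
  from has_integral_linear[OF this bounded_linear_vec_nth[of 1]]
  have "((\<lambda>z. \<phi> (S z)) has_integral b) (g2 ` K2)"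
    by (simp add: o_def)
  moreover have "g2 ` K2 = R ` (g ` K)"
    by (auto simp: g2_def K2_def image_image RS)
  moreover have "bounded (R ` (g ` K))"
    by (intro compact_imp_bounded compact_continuous_image linear_continuous_on blR contg K)
  ultimately have "((\<lambda>x. \<phi> (S (R x))) has_integral b) (S ` (R ` (g ` K)))"
    using has_integral_reindex[OF \<pi>'(1), of "\<lambda>z. \<phi> (S z)" b "R ` (g ` K)"]
    by (simp add: \<pi>'(2) R_def S_def)
  then show ?thesis
    by (simp add: RS image_image b_def \<psi>_def)
qed

section \<open>Variations of a distance-decreasing minimal graph\<close>

locale graph_variation =
  fixes \<Omega> :: "(real^'n) set" and f :: "real^'n \<Rightarrow> real^'m"
    and \<epsilon> :: real and K :: "(real^'n) set"
    and F :: "real \<Rightarrow> real^'n \<Rightarrow> (real^'n) \<times> (real^'m)"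
  assumes open_\<Omega>: "open \<Omega>" and min: "minimal_surface_solution \<Omega> f"
    and dd: "distance_decreasing \<Omega> f"
    and nv: "normal_variation \<Omega> (graph_map f) \<epsilon> K F"
begin

section \<open>Regularity of the varied family and of its volume\<close>

definition U :: "real set" where "U = {-\<epsilon><..<\<epsilon>}"

definition D :: "real \<Rightarrow> real^'n \<Rightarrow> real^'n \<Rightarrow> (real^'n) \<times> (real^'m)" where
  "D t x = frechet_derivative (F t) (at x)"

definition Df :: "real^'n \<Rightarrow> real^'n \<Rightarrow> real^'m" where
  "Df x = frechet_derivative f (at x)"

lemma eps: "\<epsilon> > 0" and compact_K: "compact K" and K_sub: "K \<subseteq> \<Omega>"
  and F_off: "t \<in> U \<Longrightarrow> x \<in> \<Omega> - K \<Longrightarrow> F t x = (x, f x)"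
  and F_0: "x \<in> \<Omega> \<Longrightarrow> F 0 x = (x, f x)"
  and fam0: "C1_family_on U \<Omega> F"
  and fam1: "C1_family_on U \<Omega> (time_deriv F)"
  and fam2: "C1_family_on U \<Omega> (time_deriv (time_deriv F))"
  using nv unfolding normal_variation_def U_def graph_map_def by auto

lemma open_U: "open U" and zero_U: "0 \<in> U"
  using eps by (auto simp: U_def)

lemma time_derivs:
  assumes "t \<in> U" "x \<in> \<Omega>"
  shows "((\<lambda>s. F s x) has_vector_derivative time_deriv F t x) (at t)"
    "((\<lambda>s. time_deriv F s x) has_vector_derivative time_deriv (time_deriv F) t x) (at t)"
  using nv assms unfolding normal_variation_def U_def time_deriv_def
  by (auto simp: vector_derivative_works[symmetric])

lemma C2: "C2_on \<Omega> f"
  using min by (simp add: minimal_surface_solution_def)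

lemma df: "x \<in> \<Omega> \<Longrightarrow> (f has_derivative Df x) (at x)"
  and df_diff: "x \<in> \<Omega> \<Longrightarrow> f differentiable (at x)"
  using C2 unfolding C2_on_def C1_on_def Df_def by (auto simp: frechet_derivative_works)

lemma Df_contraction: "x \<in> \<Omega> \<Longrightarrow> norm (Df x v) \<le> norm v"
  using dd linear_0[OF has_derivative_linear[OF df]]
  unfolding distance_decreasing_def Df_def[symmetric] by (cases "v = 0") auto

lemma dF: "t \<in> U \<Longrightarrow> x \<in> \<Omega> \<Longrightarrow> (F t has_derivative D t x) (at x)"
  using fam0 unfolding C1_family_on_def D_def by (auto simp: frechet_derivative_works)

text \<open>The open set \<open>S\<close> is a parameter because the situation occurs twice: on all
  of \<open>\<Omega>\<close> at time 0, and on \<open>\<Omega> - K\<close> at every time.\<close>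

lemma D_graph:
  assumes t: "t \<in> U" and S: "open S" "S \<subseteq> \<Omega>" "x \<in> S" and eq: "\<And>y. y \<in> S \<Longrightarrow> F t y = (y, f y)"
  shows "D t x v = (v, Df x v)"
proof -
  have x: "x \<in> \<Omega>" using S by blast
  have "((\<lambda>y. (y, f y)) has_derivative (\<lambda>v. (v, Df x v))) (at x)"
    by (intro has_derivative_Pair has_derivative_ident df x)
  then have "(F t has_derivative (\<lambda>v. (v, Df x v))) (at x)"
    by (rule has_derivative_transform_within_open[OF _ S(1,3)]) (simp add: eq)
  with dF[OF t x] have "D t x = (\<lambda>v. (v, Df x v))" by (rule has_derivative_unique)
  then show ?thesis by simp
qed

lemma D_0: "x \<in> \<Omega> \<Longrightarrow> D 0 x v = (v, Df x v)"
  by (rule D_graph[OF zero_U open_\<Omega>]) (auto simp: F_0)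

lemma D_off: "t \<in> U \<Longrightarrow> x \<in> \<Omega> - K \<Longrightarrow> D t x v = (v, Df x v)"
  using compact_K by (intro D_graph[where S = "\<Omega> - K"]) (auto simp: F_off open_\<Omega> open_Diff compact_imp_closed)

lemma D_time_derivative_inner:
  assumes "t \<in> U" "x \<in> \<Omega>" "b \<in> Basis"
  shows "((\<lambda>s. D s x v \<bullet> b) has_real_derivative frechet_derivative (time_deriv F t) (at x) v \<bullet> b) (at t)"
    "((\<lambda>s. frechet_derivative (time_deriv F s) (at x) v \<bullet> b) has_real_derivative
      frechet_derivative (time_deriv (time_deriv F) t) (at x) v \<bullet> b) (at t)"
  unfolding D_def
  by (rule frechet_derivative_time_derivative_inner[OF open_U open_\<Omega> assms time_derivs(1) fam0 fam1],
      assumption+)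
     (rule frechet_derivative_time_derivative_inner[OF open_U open_\<Omega> assms time_derivs(2) fam1 fam2],
      assumption+)

lemma cont_families:
  "joint_continuous U \<Omega> F"
  "continuous_on (U \<times> \<Omega>) (\<lambda>p. time_deriv F (fst p) (snd p))"
  "continuous_on (U \<times> \<Omega>) (\<lambda>p. D (fst p) (snd p) v)"
  "continuous_on (U \<times> \<Omega>) (\<lambda>p. frechet_derivative (time_deriv F (fst p)) (at (snd p)) v)"
  "continuous_on (U \<times> \<Omega>) (\<lambda>p. frechet_derivative (time_deriv (time_deriv F) (fst p)) (at (snd p)) v)"
  using fam0 fam1 fam2 unfolding C1_family_on_def D_def by (simp_all add: case_prod_unfold)

lemma time_C2_D_inner:
  assumes "b \<in> Basis"
  shows "time_C2 U \<Omega> (\<lambda>t x. D t x v \<bullet> b)"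
  unfolding time_C2_def time_C1_def
  by (intro exI[of _ "\<lambda>t x. frechet_derivative (time_deriv F t) (at x) v \<bullet> b"]
      exI[of _ "\<lambda>t x. frechet_derivative (time_deriv (time_deriv F) t) (at x) v \<bullet> b"] conjI ballI
      D_time_derivative_inner assms continuous_on_inner cont_families continuous_on_const)

lemma joint_continuous_K: "joint_continuous U \<Omega> g \<Longrightarrow> joint_continuous U K g"
  by (rule continuous_on_subset) (use K_sub in auto)

definition gram :: "real \<Rightarrow> real^'n \<Rightarrow> real^'n^'n" where
  "gram t x = (\<chi> i j. D t x (axis i 1) \<bullet> D t x (axis j 1))"

lemma volume_density_gram: "volume_density (F t) x = sqrt (det (gram t x))"
  by (simp add: volume_density_def gram_def pderiv_at_def D_def)

lemma time_C2_gram: "time_C2 U \<Omega> (\<lambda>t x. gram t x $ i $ j)"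
proof -
  have "time_C2 U \<Omega> (\<lambda>t x. \<Sum>b\<in>Basis. (D t x (axis i 1) \<bullet> b) * (D t x (axis j 1) \<bullet> b))"
    by (intro time_C2_sum time_C2_mult time_C2_D_inner)
  then show ?thesis by (simp add: gram_def euclidean_inner[symmetric])
qed

lemma gram_eq: "gram t x = transpose (matrix (\<lambda>v. fst (D t x v))) ** matrix (\<lambda>v. fst (D t x v))
    + transpose (matrix (\<lambda>v. snd (D t x v))) ** matrix (\<lambda>v. snd (D t x v))"
  by (simp add: gram_def vec_eq_iff matrix_matrix_mult_def transpose_def matrix_def inner_prod_def inner_vec_def)

lemma gram_0: "x \<in> \<Omega> \<Longrightarrow> gram 0 x = gmet (jac f x)"
  by (simp add: gram_eq zero_U D_0 gmet_def jac_def Df_def[symmetric] matrix_id_mat_1[unfolded id_def] flip: eta_contract_eq)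

lemma norm_jac_le: "y \<in> \<Omega> \<Longrightarrow> norm (jac f y) \<le> real CARD('m) * real CARD('n)"
proof -
  assume y: "y \<in> \<Omega>"
  have "norm (jac f y *v axis i 1) \<le> 1" for i
    using Df_contraction[OF y, of "axis i 1"] by (simp add: jac_mult df_diff y flip: Df_def)
  then have "norm (jac f y) \<le> real CARD('m) * (real CARD('n) * 1)" by (rule norm_matrix_le)
  then show ?thesis by simp
qed

text \<open>The square root in the density is smooth only where the Gram determinant is positive. At
  time 0 the determinant is at least \<open>m\<^sup>2\<close> on \<open>K\<close>; joint continuity
  and compactness keep it above half of that for small times.\<close>

lemma volume_has_second_derivative:
  "\<exists>A. has_second_derivative (\<lambda>t. volume_over K (F t)) A 0"
proof -
  have C2g: "time_C2 U K (\<lambda>t x. det (gram t x))"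
    by (intro time_C2_det time_C2_mono[OF _ subset_refl K_sub] time_C2_gram)
  then have cont: "continuous_on (U \<times> K) (\<lambda>p. det (gram (fst p) (snd p)))"
    by (rule time_C2_continuous)
  obtain m where m: "0 < m"
    "\<And>p :: real^'n^'m. norm p \<le> real CARD('m) * real CARD('n) \<Longrightarrow> m \<le> area_density p"
    using area_density_bounds[of "real CARD('m) * real CARD('n)"] by (metis of_nat_0_le_iff of_nat_mult)
  have m0: "m\<^sup>2 \<le> det (gram 0 x)" if "x \<in> K" for x
  proof -
    have x: "x \<in> \<Omega>" using that K_sub by blast
    have "m\<^sup>2 \<le> (area_density (jac f x))\<^sup>2"
      by (rule power_mono[OF m(2)[OF norm_jac_le[OF x]] less_imp_le[OF m(1)]])
    also have "\<dots> = det (gram 0 x)"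
      unfolding gram_0[OF x] area_density_def by (rule real_sqrt_pow2[OF less_imp_le[OF det_gmet_pos]])
    finally show ?thesis .
  qed
  have "m\<^sup>2 / 2 > 0" using m(1) by simp
  from uniform_in_parameter[OF cont open_U compact_K zero_U this] obtain d where d: "d > 0" "{0 - d..0 + d} \<subseteq> U"
    and close: "\<And>s x. \<bar>s - 0\<bar> \<le> d \<Longrightarrow> x \<in> K \<Longrightarrow> dist (det (gram s x)) (det (gram 0 x)) \<le> m\<^sup>2 / 2"
    by metis
  have pos: "det (gram t x) > 0" if "t \<in> {-d<..<d}" "x \<in> K" for t x
  proof -
    have "dist (det (gram t x)) (det (gram 0 x)) \<le> m\<^sup>2 / 2" using that by (intro close) auto
    moreover have "a > 0" if "\<bar>a - b\<bar> \<le> c / 2" "c \<le> b" "c > 0" for a b c :: real using that by argo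
    ultimately show ?thesis using m0[OF that(2)] m(1) by (simp add: dist_real_def)
  qed
  have "{-d<..<d} \<subseteq> U" using d(2) by auto
  then have "time_C2 {-d<..<d} K (\<lambda>t x. det (gram t x))"
    by (rule time_C2_mono[OF C2g _ subset_refl])
  then have "time_C2 {-d<..<d} K (\<lambda>t x. sqrt (det (gram t x)))"
    using pos by (rule time_C2_sqrt)
  then have "\<exists>A. has_second_derivative (\<lambda>t. integral K (\<lambda>x. sqrt (det (gram t x)))) A 0"
    using compact_K d(1) by (intro time_C2_integral) auto
  moreover have "volume_density (F t) = (\<lambda>x. sqrt (det (gram t x)))" for t
    by (rule ext) (rule volume_density_gram)
  ultimately show ?thesis
    by (simp add: volume_over_def)
qed

end

lemma finite_family_bound:
  fixes g :: "'i::finite \<Rightarrow> 'a \<Rightarrow> real"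
  assumes "\<And>i. \<exists>B. \<forall>y\<in>S. g i y \<le> B"
  shows "\<exists>B\<ge>0. \<forall>i. \<forall>y\<in>S. g i y \<le> B"
proof -
  obtain b where b: "\<And>i y. y \<in> S \<Longrightarrow> g i y \<le> b i" using assms by metis
  have "\<bar>b i\<bar> \<le> (\<Sum>i\<in>UNIV. \<bar>b i\<bar>)" for i by (intro member_le_sum) auto
  then have "g i y \<le> (\<Sum>i\<in>UNIV. \<bar>b i\<bar>)" if "y \<in> S" for i y
    using b[OF that, of i] by (meson abs_ge_self order_trans)
  then show ?thesis by (intro exI[of _ "\<Sum>i\<in>UNIV. \<bar>b i\<bar>"]) (simp add: sum_nonneg)
qed

context graph_variation
begin

section \<open>Lipschitz estimates and the comparison graph\<close>

lemma linear_Df: "x \<in> \<Omega> \<Longrightarrow> linear (Df x)"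
  by (rule has_derivative_linear[OF df])

lemma linear_D: "t \<in> U \<Longrightarrow> x \<in> \<Omega> \<Longrightarrow> linear (D t x)"
  by (rule has_derivative_linear[OF dF])

text \<open>Needed because the reparametrization moves base points. As \<open>\<Omega>\<close> need
  not be convex, the mean value inequality is applied in balls of a common radius around points of
  \<open>K\<close>; the second derivatives are bounded on the compact union of these balls.\<close>

lemma Df_lipschitz:
  obtains \<delta> C where "\<delta> > 0" "C \<ge> 0"
    "\<And>x y v. x \<in> K \<Longrightarrow> norm (y - x) \<le> \<delta> \<Longrightarrow> norm (Df y v - Df x v) \<le> C * norm (y - x) * norm v"
proof -
  obtain \<delta> where \<delta>: "\<delta> > 0" "(\<Union>x\<in>K. cball x \<delta>) \<subseteq> \<Omega>"
    using compact_subset_open_imp_cball_epsilon_subset[OF compact_K open_\<Omega> K_sub] by metis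
  define K' where "K' = (\<Union>x\<in>K. cball x \<delta>)"
  have K': "compact K'" unfolding K'_def by (rule compact_minkowski_sum_cball[OF compact_K])
  have cb: "cball x \<delta> \<subseteq> K'" if "x \<in> K" for x unfolding K'_def using that by blast
  have K'\<Omega>: "K' \<subseteq> \<Omega>" unfolding K'_def by (rule \<delta>(2))
  have C1: "C1_on \<Omega> (\<lambda>x. Df x v)" for v
    using C2 unfolding C2_on_def Df_def by blast
  define H where "H = (\<lambda>v y. frechet_derivative (\<lambda>x. Df x v) (at y))"
  have H: "((\<lambda>x. Df x v) has_derivative H v y) (at y)" if "y \<in> \<Omega>" for v y
    unfolding H_def by (rule C1_onD(1)[OF C1 that])
  have "\<exists>B. \<forall>y\<in>K'. norm (H (axis (fst ij) 1) y (axis (snd ij) 1)) \<le> B" for ij :: "'n \<times> 'n"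
  proof -
    have "bounded ((\<lambda>y. H (axis (fst ij) 1) y (axis (snd ij) 1)) ` K')"
      unfolding H_def
      by (intro compact_imp_bounded compact_continuous_image K' continuous_on_subset[OF C1_onD(2)[OF C1] K'\<Omega>])
    then show ?thesis unfolding bounded_iff by auto
  qed
  then obtain B where B0: "B \<ge> 0"
    and B: "\<And>ij y. y \<in> K' \<Longrightarrow> norm (H (axis (fst ij) 1) y (axis (snd ij) 1)) \<le> B"
    using finite_family_bound[where g = "\<lambda>ij y. norm (H (axis (fst ij) 1) y (axis (snd ij) 1))" and S = K'] by auto
  define n where "n = real CARD('n)"
  have n: "n \<ge> 0" by (simp add: n_def)
  have HB: "norm (H (axis i 1) y w) \<le> n * B * norm w" if "y \<in> K'" for i y w
  proof -
    have "linear (H (axis i 1) y)" using H K'\<Omega> that by (blast intro: has_derivative_linear)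
    then show ?thesis unfolding n_def
    proof (rule norm_linear_le_sum_axis)
      show "norm (H (axis i 1) y (axis j 1)) \<le> B" for j using B[OF that, of "(i, j)"] by simp
    qed
  qed
  show ?thesis
  proof (rule that[of \<delta> "n * (n * B)"])
    show "\<delta> > 0" "n * (n * B) \<ge> 0" using \<delta>(1) n B0 by simp_all
    show "norm (Df y v - Df x v) \<le> n * (n * B) * norm (y - x) * norm v"
      if x: "x \<in> K" and y: "norm (y - x) \<le> \<delta>" for x y v
    proof -
      have yc: "y \<in> cball x \<delta>" using y by (simp add: dist_norm norm_minus_commute)
      have xc: "x \<in> cball x \<delta>" using \<delta>(1) by simp
      have "norm (Df y (axis i 1) - Df x (axis i 1)) \<le> n * B * norm (y - x)" for i
      proof (rule differentiable_bound[where S = "cball x \<delta>" and f = "\<lambda>z. Df z (axis i 1)" and f' = "H (axis i 1)"])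
        fix z assume z: "z \<in> cball x \<delta>"
        then have zK: "z \<in> K'" using cb[OF x] by blast
        show "((\<lambda>z. Df z (axis i 1)) has_derivative H (axis i 1) z) (at z within cball x \<delta>)"
          using H zK K'\<Omega> by (blast intro: has_derivative_at_withinI)
        show "onorm (H (axis i 1) z) \<le> n * B" by (rule onorm_le) (rule HB[OF zK])
      qed (use xc yc in auto)
      moreover have "linear (\<lambda>v. Df y v - Df x v)"
        using cb[OF x] K'\<Omega> xc yc by (intro linear_compose_sub linear_Df) blast+
      ultimately have "norm (Df y v - Df x v) \<le> real CARD('n) * (n * B * norm (y - x)) * norm v"
        by (intro norm_linear_le_sum_axis[of "\<lambda>v. Df y v - Df x v"])
      then show ?thesis by (simp add: n_def mult.assoc)
    qed
  qed
qed

lemma D_lipschitz: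
  obtains \<delta> C where "\<delta> > 0" "{-\<delta>..\<delta>} \<subseteq> U" "C \<ge> 0"
    "\<And>t x v. \<bar>t\<bar> \<le> \<delta> \<Longrightarrow> x \<in> K \<Longrightarrow> norm (D t x v - D 0 x v) \<le> C * \<bar>t\<bar> * norm v"
    "\<And>t x. \<bar>t\<bar> \<le> \<delta> \<Longrightarrow> x \<in> K \<Longrightarrow> norm (F t x - F 0 x) \<le> C * \<bar>t\<bar>"
proof -
  define \<delta> where "\<delta> = \<epsilon> / 2"
  have \<delta>: "\<delta> > 0" "{-\<delta>..\<delta>} \<subseteq> U" using eps by (auto simp: \<delta>_def U_def)
  have "\<exists>C\<ge>0. \<forall>t x. \<bar>t\<bar> \<le> \<delta> \<longrightarrow> x \<in> K \<longrightarrow> norm (D t x (axis i 1) - D 0 x (axis i 1)) \<le> C * \<bar>t\<bar>" for i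
  proof -
    have d: "((\<lambda>s. D s x (axis i 1)) has_vector_derivative frechet_derivative (time_deriv F t) (at x) (axis i 1)) (at t)"
      if "t \<in> U" "x \<in> K" for t x
      using that K_sub by (intro has_vector_derivative_componentwise D_time_derivative_inner) auto
    obtain C where "C \<ge> 0" "\<And>t x. \<bar>t\<bar> \<le> \<delta> \<Longrightarrow> x \<in> K \<Longrightarrow> norm (D t x (axis i 1) - D 0 x (axis i 1)) \<le> C * \<bar>t\<bar>"
      using time_lipschitz[OF compact_K \<delta>(2) less_imp_le[OF \<delta>(1)] d joint_continuous_K[OF cont_families(4)]]
      by metis
    then show ?thesis by blast
  qed
  then obtain c where c: "\<And>i. c i \<ge> 0"
    "\<And>i t x. \<bar>t\<bar> \<le> \<delta> \<Longrightarrow> x \<in> K \<Longrightarrow> norm (D t x (axis i 1) - D 0 x (axis i 1)) \<le> c i * \<bar>t\<bar>"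
    by metis
  obtain C0 where C0: "C0 \<ge> 0" "\<And>t x. \<bar>t\<bar> \<le> \<delta> \<Longrightarrow> x \<in> K \<Longrightarrow> norm (F t x - F 0 x) \<le> C0 * \<bar>t\<bar>"
    using time_lipschitz[OF compact_K \<delta>(2) less_imp_le[OF \<delta>(1)] time_derivs(1)
        joint_continuous_K[OF cont_families(2)]] K_sub by (metis subsetD)
  define B where "B = (\<Sum>i\<in>UNIV. c i)"
  have cB: "c i \<le> B" for i unfolding B_def using c(1) by (intro member_le_sum) auto
  have B0: "B \<ge> 0" unfolding B_def using c(1) by (intro sum_nonneg) auto
  define C where "C = real CARD('n) * B + C0"
  have C: "C \<ge> 0" using B0 C0(1) by (simp add: C_def)
  show ?thesis
  proof (rule that[OF \<delta> C])
    fix t x v assume t: "\<bar>t\<bar> \<le> \<delta>" and x: "x \<in> K"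
    have tU: "t \<in> U" using t \<delta>(2) by (auto simp: abs_le_iff)
    have "norm (D t x v - D 0 x v) \<le> real CARD('n) * (B * \<bar>t\<bar>) * norm v"
    proof (rule norm_linear_le_sum_axis[of "\<lambda>v. D t x v - D 0 x v"])
      show "linear (\<lambda>v. D t x v - D 0 x v)"
        using x K_sub by (intro linear_compose_sub linear_D tU zero_U) auto
      show "norm (D t x (axis i 1) - D 0 x (axis i 1)) \<le> B * \<bar>t\<bar>" for i
        using c(2)[OF t x, of i] mult_right_mono[OF cB[of i], of "\<bar>t\<bar>"] by simp
    qed
    also have "\<dots> = real CARD('n) * B * (\<bar>t\<bar> * norm v)" by (simp add: ac_simps)
    also have "\<dots> \<le> C * (\<bar>t\<bar> * norm v)"
      using C0(1) by (intro mult_right_mono) (auto simp: C_def)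
    finally show "norm (D t x v - D 0 x v) \<le> C * \<bar>t\<bar> * norm v" by (simp add: ac_simps)
  next
    fix t x assume "\<bar>t\<bar> \<le> \<delta>" "x \<in> K"
    then have "norm (F t x - F 0 x) \<le> C0 * \<bar>t\<bar>" by (rule C0(2))
    also have "\<dots> \<le> C * \<bar>t\<bar>" using B0 by (intro mult_right_mono) (auto simp: C_def)
    finally show "norm (F t x - F 0 x) \<le> C * \<bar>t\<bar>" .
  qed
qed

lemma volume_0: "volume_over K (F 0) = integral K (\<lambda>x. area_density (jac f x))"
  and integrable_area: "(\<lambda>x. area_density (jac f x)) integrable_on K"
proof -
  have "volume_density (F 0) x = area_density (jac f x)" if "x \<in> K" for x
    using that K_sub by (simp add: volume_density_gram gram_0 area_density_def subset_iff)
  then show "volume_over K (F 0) = integral K (\<lambda>x. area_density (jac f x))"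
    unfolding volume_over_def by (intro integral_cong)
  show "(\<lambda>x. area_density (jac f x)) integrable_on K"
    by (intro integrable_on_compact compact_K
        continuous_on_subset[OF C1_onD(3)[OF C1_on_area_density_jac[OF open_\<Omega> C2]] K_sub])
qed

text \<open>With A the derivative of the horizontal part and B the matrix of \<open>L\<close>, the
  hypothesis reads DQ = B A, so the Gram matrix is A^T (1 + B^T B) A. Its determinant splits off
  (det A)^2, exactly the Jacobian factor of the change of variables.\<close>

lemma volume_density_factor:
  assumes "t \<in> U" "x \<in> \<Omega>" and lin: "linear L" and L: "\<And>v. L (fst (D t x v)) = snd (D t x v)"
  shows "volume_density (F t) x = \<bar>det (matrix (\<lambda>v. fst (D t x v)))\<bar> * area_density (matrix L)"
proof -
  define A where "A = matrix (\<lambda>v. fst (D t x v))"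
  define B where "B = matrix L"
  have linA: "linear (\<lambda>v. fst (D t x v))"
    using linear_compose[OF linear_D[OF assms(1,2)] linear_fst] by (simp add: o_def)
  have "matrix (\<lambda>v. snd (D t x v)) = B ** A"
    using matrix_compose[OF linA lin] by (simp add: A_def B_def o_def L)
  then have "gram t x = transpose A ** A + transpose (B ** A) ** (B ** A)"
    unfolding gram_eq A_def by simp
  also have "\<dots> = transpose A ** gmet B ** A"
    unfolding gmet_def matrix_add_ldistrib matrix_add_rdistrib
    by (simp add: matrix_transpose_mul matrix_mul_assoc)
  finally have "det (gram t x) = (det A)\<^sup>2 * det (gmet B)"
    by (simp add: det_mul power2_eq_square)
  then show ?thesis
    unfolding volume_density_gram area_density_def A_def[symmetric] B_def[symmetric]
    by (simp add: real_sqrt_mult)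
qed


lemma continuous_volume_density: "t \<in> U \<Longrightarrow> continuous_on K (volume_density (F t))"
proof -
  assume t: "t \<in> U"
  have "time_C2 U K (\<lambda>t x. det (gram t x))"
    by (intro time_C2_det time_C2_mono[OF _ subset_refl K_sub] time_C2_gram)
  from slice_continuous[OF time_C2_continuous[OF this] t] have "continuous_on K (\<lambda>x. sqrt (det (gram t x)))"
    by (intro continuous_intros)
  moreover have "volume_density (F t) = (\<lambda>x. sqrt (det (gram t x)))"
    by (rule ext) (rule volume_density_gram)
  ultimately show ?thesis by simp
qed

text \<open>For small times the varied graph is again the graph of some \<open>h\<close>, with \<open>h - f\<close> of size \<open>O(t)\<close>
  in \<open>C\<^sup>1\<close>; no derivative is lost because \<open>f\<close> is \<open>C\<^sup>2\<close>.\<close>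

definition comparison :: "real \<Rightarrow> real \<Rightarrow> (real^'n \<Rightarrow> real^'m) \<Rightarrow> (real^'n \<Rightarrow> real^'n \<Rightarrow> real^'m) \<Rightarrow> bool" where
  "comparison C t h Dh \<longleftrightarrow>
     (\<forall>y\<in>\<Omega>. (h has_derivative Dh y) (at y)) \<and> (\<forall>y\<in>\<Omega> - K. h y = f y) \<and>
     (\<forall>x\<in>\<Omega>. h (fst (F t x)) = snd (F t x)) \<and>
     (\<lambda>x. fst (F t x)) ` K = K \<and> (\<forall>x\<in>K. norm (fst (F t x) - x) \<le> C * \<bar>t\<bar>) \<and>
     (\<forall>y\<in>K. \<forall>v. norm (Dh y v - Df y v) \<le> C * \<bar>t\<bar> * norm v) \<and>
     ((\<lambda>y. area_density (matrix (Dh y))) has_integral volume_over K (F t)) K"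

lemma comparison_exists:
  obtains \<delta> C where "\<delta> > 0" "C \<ge> 0" "{-\<delta>..\<delta>} \<subseteq> U"
    "\<And>t x. \<bar>t\<bar> \<le> \<delta> \<Longrightarrow> x \<in> \<Omega> \<Longrightarrow> fst (F t x) \<in> \<Omega>"
    "\<And>t. \<bar>t\<bar> \<le> \<delta> \<Longrightarrow> \<exists>h Dh. comparison C t h Dh"
proof -
  obtain \<delta>0 C0 where 0: "\<delta>0 > 0" "{-\<delta>0..\<delta>0} \<subseteq> U" "C0 \<ge> 0"
    "\<And>t x v. \<bar>t\<bar> \<le> \<delta>0 \<Longrightarrow> x \<in> K \<Longrightarrow> norm (D t x v - D 0 x v) \<le> C0 * \<bar>t\<bar> * norm v"
    "\<And>t x. \<bar>t\<bar> \<le> \<delta>0 \<Longrightarrow> x \<in> K \<Longrightarrow> norm (F t x - F 0 x) \<le> C0 * \<bar>t\<bar>"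
    using D_lipschitz by metis
  obtain \<delta>1 C1 where 1: "\<delta>1 > 0" "C1 \<ge> 0"
    "\<And>x y v. x \<in> K \<Longrightarrow> norm (y - x) \<le> \<delta>1 \<Longrightarrow> norm (Df y v - Df x v) \<le> C1 * norm (y - x) * norm v"
    using Df_lipschitz by metis
  \<comment> \<open>Guarantees C0 |t| <= 1/2, which makes P_t invertible, and C0 |t| <= \<delta>1,
    which keeps P_t x inside the ball where \<open>Df\<close> is Lipschitz around x.\<close>
  define \<delta> where "\<delta> = min \<delta>0 (min (1/2) \<delta>1 / (C0 + 1))"
  have \<delta>: "\<delta> > 0" using 0(1,3) 1(1) by (simp add: \<delta>_def)
  \<comment> \<open>The three summands bound the three differences into which Dh - Df is split
    below; the factor 2 pays for passing from \<open>v\<close> to \<open>w = DP x v\<close>, as |v|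
    <= 2 |w|.\<close>
  define C where "C = 2 * (C0 + C1 * C0 + C0)"
  have C: "C \<ge> 0" using 0(3) 1(2) by (simp add: C_def)
  have sub: "{-\<delta>..\<delta>} \<subseteq> U" using 0(2) by (force simp: \<delta>_def)
  have main: "(\<forall>x\<in>\<Omega>. fst (F t x) \<in> \<Omega>) \<and> (\<exists>h Dh. comparison C t h Dh)" if t: "\<bar>t\<bar> \<le> \<delta>" for t
  proof -
    have t0: "\<bar>t\<bar> \<le> \<delta>0" using t by (simp add: \<delta>_def)
    have tU: "t \<in> U" using sub t by (auto simp: abs_le_iff)
    have "C0 * \<bar>t\<bar> \<le> (C0 + 1) * (min (1/2) \<delta>1 / (C0 + 1))"
      using t 0(3) by (intro mult_mono) (auto simp: \<delta>_def)
    also have "\<dots> = min (1/2) \<delta>1" using 0(3) by simp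
    finally have tC: "C0 * \<bar>t\<bar> \<le> 1/2" "C0 * \<bar>t\<bar> \<le> \<delta>1" by auto
    define P Q where "P = (\<lambda>x. fst (F t x))" and "Q = (\<lambda>x. snd (F t x))"
    define DP DQ where "DP = (\<lambda>x v. fst (D t x v))" and "DQ = (\<lambda>x v. snd (D t x v))"
    have DPb: "norm (DP x v - v) \<le> C0 * \<bar>t\<bar> * norm v" and DQb: "norm (DQ x v - Df x v) \<le> C0 * \<bar>t\<bar> * norm v"
      if xK: "x \<in> K" for x v
    proof -
      have x: "x \<in> \<Omega>" using xK K_sub by blast
      have eq: "D t x v - D 0 x v = (DP x v - v, DQ x v - Df x v)"
        by (simp add: D_0[OF x] DP_def DQ_def prod_eq_iff)
      show "norm (DP x v - v) \<le> C0 * \<bar>t\<bar> * norm v"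
        using norm_fst_le[of "DP x v - v" "DQ x v - Df x v"] 0(4)[OF t0 xK, of v] unfolding eq by linarith
      show "norm (DQ x v - Df x v) \<le> C0 * \<bar>t\<bar> * norm v"
        using norm_snd_le[of "DQ x v - Df x v" "DP x v - v"] 0(4)[OF t0 xK, of v] unfolding eq by linarith
    qed
    have small: "norm (DP x v - v) \<le> norm v / 2" if "x \<in> \<Omega>" for x v
    proof (cases "x \<in> K")
      case True
      then show ?thesis using DPb[OF True, of v] mult_right_mono[OF tC(1), of "norm v"] by simp
    next
      case False
      then show ?thesis using D_off[OF tU] that by (simp add: DP_def)
    qed
    have Pb: "norm (P x - x) \<le> C0 * \<bar>t\<bar>" if xK: "x \<in> K" for x
    proof -
      have x: "x \<in> \<Omega>" using xK K_sub by blast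
      have "F t x - F 0 x = (P x - x, Q x - f x)" by (simp add: F_0[OF x] P_def Q_def prod_eq_iff)
      then show ?thesis using norm_fst_le[of "P x - x" "Q x - f x"] 0(5)[OF t0 xK] by simp
    qed
    have dP': "\<And>x. x \<in> \<Omega> \<Longrightarrow> (P has_derivative DP x) (at x)" and dQ': "\<And>x. x \<in> \<Omega> \<Longrightarrow> (Q has_derivative DQ x) (at x)"
      unfolding P_def Q_def DP_def DQ_def by (intro has_derivative_fst has_derivative_snd dF tU; assumption)+
    have offP: "P x = x" and offQ: "Q x = f x" if "x \<in> \<Omega> - K" for x
      using F_off[OF tU that] by (simp_all add: P_def Q_def)
    obtain h Dh where h: "inj_on P K" "P ` K = K" "\<And>x. x \<in> \<Omega> \<Longrightarrow> P x \<in> \<Omega>"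
      "\<And>y. y \<in> \<Omega> \<Longrightarrow> (h has_derivative Dh y) (at y)"
      "\<And>y. y \<in> \<Omega> - K \<Longrightarrow> h y = f y"
      "\<And>x. x \<in> \<Omega> \<Longrightarrow> h (P x) = Q x"
      "\<And>x v. x \<in> \<Omega> \<Longrightarrow> Dh (P x) (DP x v) = DQ x v"
      using graph_reparametrization[OF open_\<Omega> compact_K K_sub dP' dQ' small offP offQ] by blast
    have close: "norm (Dh y w - Df y w) \<le> C * \<bar>t\<bar> * norm w" if y: "y \<in> K" for y w
    proof -
      obtain x where x: "x \<in> K" "y = P x" using h(2) y by blast
      have x\<Omega>: "x \<in> \<Omega>" and y\<Omega>: "y \<in> \<Omega>" using x(1) y K_sub by auto
      have lin: "linear (DP x)" using dP'[OF x\<Omega>] by (rule has_derivative_linear)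
      have "v = 0" if "DP x v = 0" for v using small[OF x\<Omega>, of v] that by simp
      then have "inj (DP x)" using lin by (simp add: linear_injective_0)
      then have "surj (DP x)" using lin by (simp add: linear_injective_imp_surjective)
      then obtain v where v: "w = DP x v" by blast
      have "norm v \<le> norm (DP x v) + norm (DP x v - v)"
        using norm_triangle_ineq4[of "DP x v" "DP x v - v"] by simp
      then have vw: "norm v \<le> 2 * norm w" using small[OF x\<Omega>, of v] v by simp
      \<comment> \<open>The errors come from the change of the vertical part, from moving the base
        point from x to y = P x, and from the distortion of the direction v by DP.\<close>
      have "Dh y w - Df y w = (DQ x v - Df x v) - (Df y v - Df x v) + (Df y v - Df y (DP x v))"
        using h(7)[OF x\<Omega>, of v] by (simp add: x(2) v)
      also have "norm \<dots> \<le> norm (DQ x v - Df x v) + norm (Df y v - Df x v) + norm (Df y v - Df y (DP x v))"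
        using norm_triangle_ineq[of "(DQ x v - Df x v) - (Df y v - Df x v)" "Df y v - Df y (DP x v)"]
          norm_triangle_ineq4[of "DQ x v - Df x v" "Df y v - Df x v"] by linarith
      also have "\<dots> \<le> C0 * \<bar>t\<bar> * norm v + C1 * C0 * \<bar>t\<bar> * norm v + C0 * \<bar>t\<bar> * norm v"
      proof (intro add_mono)
        show "norm (DQ x v - Df x v) \<le> C0 * \<bar>t\<bar> * norm v" by (rule DQb[OF x(1)])
        have "norm (y - x) \<le> C0 * \<bar>t\<bar>" using Pb[OF x(1)] x(2) by simp
        then have "norm (Df y v - Df x v) \<le> C1 * norm (y - x) * norm v" "C1 * norm (y - x) \<le> C1 * (C0 * \<bar>t\<bar>)"
          using tC(2) 1(2) by (auto intro!: 1(3) x(1) mult_left_mono)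
        then show "norm (Df y v - Df x v) \<le> C1 * C0 * \<bar>t\<bar> * norm v"
          using mult_right_mono[of "C1 * norm (y - x)" "C1 * (C0 * \<bar>t\<bar>)" "norm v"] by (simp add: mult.assoc)
        have "Df y v - Df y (DP x v) = Df y (v - DP x v)"
          using linear_diff[OF linear_Df[OF y\<Omega>]] by simp
        then show "norm (Df y v - Df y (DP x v)) \<le> C0 * \<bar>t\<bar> * norm v"
          using Df_contraction[OF y\<Omega>, of "v - DP x v"] DPb[OF x(1), of v] by (simp add: norm_minus_commute)
      qed
      also have "\<dots> = (C / 2 * \<bar>t\<bar>) * norm v" by (simp add: C_def algebra_simps)
      also have "\<dots> \<le> (C / 2 * \<bar>t\<bar>) * (2 * norm w)" using C vw by (intro mult_left_mono) auto
      finally show ?thesis by simp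
    qed
    have vol: "((\<lambda>y. area_density (matrix (Dh y))) has_integral volume_over K (F t)) K"
    proof -
      have eq: "volume_density (F t) x = \<bar>det (matrix (DP x))\<bar> * area_density (matrix (Dh (P x)))" if "x \<in> K" for x
      proof -
        have x: "x \<in> \<Omega>" using that K_sub by blast
        show ?thesis
          unfolding DP_def
          by (rule volume_density_factor[OF tU x has_derivative_linear[OF h(4)[OF h(3)[OF x]]]])
             (use h(7)[OF x] in \<open>simp add: DP_def DQ_def\<close>)
      qed
      \<comment> \<open>Continuity of the product is inherited from the volume density of
        \<open>F t\<close>; no continuity of \<open>Dh\<close> is claimed.\<close>
      have "continuous_on K (\<lambda>x. \<bar>det (matrix (DP x))\<bar> * area_density (matrix (Dh (P x))))"
        using continuous_volume_density[OF tU] by (rule continuous_on_eq) (rule eq)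
      then have "((\<lambda>y. area_density (matrix (Dh y))) has_integral
          integral K (\<lambda>x. \<bar>det (matrix (DP x))\<bar> * area_density (matrix (Dh (P x))))) (P ` K)"
        using K_sub by (intro has_integral_image_compact[OF compact_K _ h(1)] dP') auto
      moreover have "integral K (\<lambda>x. \<bar>det (matrix (DP x))\<bar> * area_density (matrix (Dh (P x)))) = volume_over K (F t)"
        unfolding volume_over_def by (intro integral_cong) (simp add: eq)
      ultimately show ?thesis using h(2) by simp
    qed
    have "C0 * \<bar>t\<bar> \<le> C * \<bar>t\<bar>" using 0(3) 1(2) by (intro mult_right_mono) (auto simp: C_def)
    then have "\<forall>x\<in>K. norm (P x - x) \<le> C * \<bar>t\<bar>" using Pb order_trans by blast
    then have "comparison C t h Dh"
      unfolding comparison_def using h close vol unfolding P_def Q_def by blast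
    then show ?thesis using h(3) unfolding P_def by blast
  qed
  show ?thesis
    by (rule that[OF \<delta> C sub]) (use main in blast)+
qed


lemma jac_eq: "jac f y = matrix (Df y)"
  by (simp add: jac_def Df_def)

text \<open>These facts prepare the convexity estimates for the difference \<open>r\<close> of the
  two Jacobians. In \<open>comparison_op\<close>, L = 1 yields 1 + O(t) on the whole segment, while
  a bound below 1 stays below 1 for small t. Because h = f on \<open>\<Omega> - K\<close>, the zero
  extension of h - f is differentiable on the whole space and may be used as a test field.\<close>

lemma
  assumes cmp: "comparison C t h Dh" and C: "C \<ge> 0"
  defines "r \<equiv> \<lambda>y. matrix (\<lambda>v. Dh y v - Df y v)"
  shows comparison_jac: "y \<in> K \<Longrightarrow> matrix (Dh y) = jac f y + r y"
    and comparison_norm: "y \<in> K \<Longrightarrow> norm (r y) \<le> real CARD('m) * (real CARD('n) * (C * \<bar>t\<bar>))"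
    and comparison_op: "y \<in> K \<Longrightarrow> 0 \<le> s \<Longrightarrow> s \<le> 1 \<Longrightarrow> norm (Df y v) \<le> L * norm v \<Longrightarrow>
      norm ((jac f y + s *\<^sub>R r y) *v v) \<le> (L + C * \<bar>t\<bar>) * norm v"
    and comparison_zero: "y \<notin> K \<Longrightarrow> (if y \<in> \<Omega> then h y - f y else 0) = 0"
    and comparison_deriv: "((\<lambda>y. if y \<in> \<Omega> then h y - f y else 0) has_derivative
      (\<lambda>v. if y \<in> K then Dh y v - Df y v else 0)) (at y)"
    and comparison_flux: "((\<lambda>y. trace (area_flux (jac f y) ** r y)) has_integral 0) K"
proof -
  have dh: "\<And>y. y \<in> \<Omega> \<Longrightarrow> (h has_derivative Dh y) (at y)"
    and hf: "\<And>y. y \<in> \<Omega> - K \<Longrightarrow> h y = f y"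
    and close: "\<And>y v. y \<in> K \<Longrightarrow> norm (Dh y v - Df y v) \<le> C * \<bar>t\<bar> * norm v"
    using cmp unfolding comparison_def by blast+
  have lin: "linear (\<lambda>v. Dh y v - Df y v)" if "y \<in> K" for y
    using that K_sub by (intro linear_compose_sub linear_Df has_derivative_linear[OF dh]) auto
  have mult: "r y *v v = Dh y v - Df y v" if "y \<in> K" for y v
    unfolding r_def by (simp add: matrix_works lin that)
  show "matrix (Dh y) = jac f y + r y" if "y \<in> K"
    by (simp add: jac_eq r_def matrix_def vec_eq_iff)
  show "norm (r y) \<le> real CARD('m) * (real CARD('n) * (C * \<bar>t\<bar>))" if "y \<in> K"
  proof (rule norm_matrix_le)
    show "norm (r y *v axis i 1) \<le> C * \<bar>t\<bar>" for i
      using close[OF that, of "axis i 1"] by (simp only: mult[OF that]) simp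
  qed
  show "norm ((jac f y + s *\<^sub>R r y) *v v) \<le> (L + C * \<bar>t\<bar>) * norm v"
    if y: "y \<in> K" and s: "0 \<le> s" "s \<le> 1" and L: "norm (Df y v) \<le> L * norm v"
  proof -
    have "jac f y *v v = Df y v"
      using y K_sub jac_mult[OF df_diff] by (auto simp: Df_def)
    then have "(jac f y + s *\<^sub>R r y) *v v = Df y v + s *\<^sub>R (Dh y v - Df y v)"
      by (simp add: matrix_vector_mult_add_rdistrib scaleR_matrix_vector_assoc[symmetric] mult[OF y])
    also have "norm \<dots> \<le> norm (Df y v) + norm (s *\<^sub>R (Dh y v - Df y v))"
      by (rule norm_triangle_ineq)
    also have "norm (s *\<^sub>R (Dh y v - Df y v)) \<le> norm (Dh y v - Df y v)"
      using s by (simp add: mult_left_le_one_le)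
    finally show ?thesis using close[OF y, of v] L by (simp add: distrib_right)
  qed
  define u where "u = (\<lambda>y. if y \<in> \<Omega> then h y - f y else 0)"
  define u' where "u' = (\<lambda>y v. if y \<in> K then Dh y v - Df y v else 0)"
  have u0: "u y = 0" if "y \<notin> K" for y using that hf[of y] by (auto simp: u_def)
  have du: "(u has_derivative u' y) (at y)" for y
  proof (cases "y \<in> K")
    case True
    then have y: "y \<in> \<Omega>" using K_sub by blast
    have "(u has_derivative (\<lambda>v. Dh y v - Df y v)) (at y)"
      by (rule has_derivative_transform_within_open[OF has_derivative_diff[OF dh[OF y] df[OF y]] open_\<Omega> y])
         (simp add: u_def)
    then show ?thesis using True by (simp add: u'_def)
  next
    case False
    have "(u has_derivative (\<lambda>v. 0)) (at y)"
      by (rule has_derivative_transform_within_open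
          [OF has_derivative_const open_Compl[OF compact_imp_closed[OF compact_K]]])
         (use False u0 in auto)
    then show ?thesis using False by (simp add: u'_def)
  qed
  show "y \<notin> K \<Longrightarrow> (if y \<in> \<Omega> then h y - f y else 0) = 0"
    using u0 unfolding u_def by simp
  show "((\<lambda>y. if y \<in> \<Omega> then h y - f y else 0) has_derivative
      (\<lambda>v. if y \<in> K then Dh y v - Df y v else 0)) (at y)"
    using du[of y] unfolding u_def u'_def .
  have "((\<lambda>y. trace (area_flux (jac f y) ** matrix (u' y))) has_integral 0) K"
    by (rule flux_has_integral_zero[OF open_\<Omega> min compact_K K_sub du u0, where B = "C * \<bar>t\<bar>"])
       (use close in \<open>auto simp: u'_def\<close>)
  then show "((\<lambda>y. trace (area_flux (jac f y) ** r y)) has_integral 0) K"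
    by (rule has_integral_eq[rotated]) (simp add: u'_def r_def)
qed

section \<open>The cubic lower bound for the volume\<close>

lemma norm_segment_le:
  assumes "comparison C t h Dh" "C \<ge> 0" "y \<in> K" "0 \<le> s" "s \<le> 1" "\<bar>t\<bar> \<le> \<delta>"
  defines "n \<equiv> real CARD('m) * real CARD('n)"
  shows "norm (jac f y + s *\<^sub>R matrix (\<lambda>v. Dh y v - Df y v)) \<le> n + n * C * \<delta>"
proof -
  let ?r = "matrix (\<lambda>v. Dh y v - Df y v) :: real^'n^'m"
  have "norm (s *\<^sub>R ?r) \<le> norm ?r" using assms(4,5) by (simp add: mult_left_le_one_le)
  moreover have "norm ?r \<le> n * C * \<bar>t\<bar>"
    using comparison_norm[OF assms(1-3)] by (simp add: n_def mult.assoc)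
  moreover have "n * C * \<bar>t\<bar> \<le> n * C * \<delta>" using assms(2,6) by (intro mult_left_mono) (auto simp: n_def)
  moreover have "norm (jac f y) \<le> n" using norm_jac_le assms(3) K_sub by (auto simp: n_def)
  ultimately show ?thesis
    using norm_triangle_ineq[of "jac f y" "s *\<^sub>R ?r"] by linarith
qed

text \<open>Here minimality pays off: the linear term of the pointwise expansion integrates to zero,
  so a pointwise lower bound for the second-order remainder becomes a lower bound for the volume
  difference.\<close>

lemma volume_ge_of_pointwise:
  assumes cmp: "comparison C t h Dh" and C: "C \<ge> 0"
    and k: "(k has_integral J) K"
    and pt: "\<And>y. y \<in> K \<Longrightarrow> area_density (matrix (Dh y)) \<ge> area_density (jac f y)
      + trace (area_flux (jac f y) ** matrix (\<lambda>v. Dh y v - Df y v)) + k y"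
  shows "volume_over K (F t) \<ge> volume_over K (F 0) + J"
proof -
  have "((\<lambda>y. area_density (jac f y)) has_integral volume_over K (F 0)) K"
    unfolding volume_0 by (rule integrable_integral[OF integrable_area])
  from has_integral_add[OF has_integral_add[OF this comparison_flux[OF cmp C]] k]
  have lower: "((\<lambda>y. area_density (jac f y) + trace (area_flux (jac f y) ** matrix (\<lambda>v. Dh y v - Df y v)) + k y)
    has_integral volume_over K (F 0) + J) K" by simp
  have "((\<lambda>y. area_density (matrix (Dh y))) has_integral volume_over K (F t)) K"
    using cmp unfolding comparison_def by blast
  from has_integral_le[OF lower this pt] show ?thesis .
qed

lemma volume_lower_bound:
  obtains \<delta> C where "\<delta> > 0" "\<And>t. \<bar>t\<bar> < \<delta> \<Longrightarrow> volume_over K (F t) \<ge> volume_over K (F 0) - C * \<bar>t\<bar> ^ 3"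
proof -
  obtain \<delta> C where 0: "\<delta> > 0" "C \<ge> 0" "{-\<delta>..\<delta>} \<subseteq> U" "\<And>t. \<bar>t\<bar> \<le> \<delta> \<Longrightarrow> \<exists>h Dh. comparison C t h Dh"
    using comparison_exists by metis
  define n where "n = real CARD('m) * real CARD('n)"
  have n: "n \<ge> 0" by (simp add: n_def)
  have N: "0 \<le> n + n * C * \<delta>" using n 0(1,2) by simp
  obtain M where M: "\<And>p :: real^'n^'m. norm p \<le> n + n * C * \<delta> \<Longrightarrow> area_density p \<le> M"
    using area_density_bounds[OF N] by metis
  have M0: "M \<ge> 0"
    using M[of 0] area_density_pos[of "0 :: real^'n^'m"] n 0(1,2) by simp
  \<comment> \<open>Collects L^2 - 1 = (2C + C^2 |t|) |t| for L = 1 + C |t| and |r| <= n C |t|; the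
    three powers of |t| are split off.\<close>
  define B where "B = M * (2 * C + C * C * \<delta>) * (n * C)\<^sup>2"
  define V where "V = integral K (\<lambda>x. 1 :: real)"
  have V: "((\<lambda>x. 1 :: real) has_integral V) K"
    unfolding V_def by (intro integrable_integral integrable_on_compact compact_K continuous_intros)
  show ?thesis
  proof (rule that[OF 0(1), of "B * V"])
    fix t assume t: "\<bar>t\<bar> < \<delta>"
    obtain h Dh where cmp: "comparison C t h Dh" using 0(4)[of t] t by auto
    define r where "r = (\<lambda>y. matrix (\<lambda>v. Dh y v - Df y v))"
    have "((\<lambda>y. - B * \<bar>t\<bar> ^ 3 * 1) has_integral - B * \<bar>t\<bar> ^ 3 * V) K"
      by (intro has_integral_mult_right V)
    then have "volume_over K (F t) \<ge> volume_over K (F 0) + - B * \<bar>t\<bar> ^ 3 * V"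
    proof (rule volume_ge_of_pointwise[OF cmp 0(2)])
      fix y assume y: "y \<in> K"
      have y\<Omega>: "y \<in> \<Omega>" using y K_sub by blast
      define L where "L = 1 + C * \<bar>t\<bar>"
      have L1: "L \<ge> 1" using 0(2) by (simp add: L_def)
      have nr: "norm (r y) \<le> n * C * \<bar>t\<bar>"
        using comparison_norm[OF cmp 0(2) y] unfolding r_def n_def by (simp add: mult.assoc)
      have op: "norm ((jac f y + s *\<^sub>R r y) *v v) \<le> L * norm v" if "0 \<le> s" "s \<le> 1" for s v
        unfolding r_def L_def by (rule comparison_op[OF cmp 0(2) y that]) (use Df_contraction[OF y\<Omega>] in simp)
      have ar: "area_density (jac f y + s *\<^sub>R r y) \<le> M" if "0 \<le> s" "s \<le> 1" for s
        unfolding r_def using t by (intro M norm_segment_le[OF cmp 0(2) y that, folded n_def]) simp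
      have "L\<^sup>2 - 1 = (2 * C + C * C * \<bar>t\<bar>) * \<bar>t\<bar>" by (simp add: L_def power2_eq_square algebra_simps)
      also have "\<dots> \<le> (2 * C + C * C * \<delta>) * \<bar>t\<bar>"
        using t 0(2) by (intro mult_right_mono add_left_mono mult_left_mono) auto
      finally have LL: "L\<^sup>2 - 1 \<le> (2 * C + C * C * \<delta>) * \<bar>t\<bar>" .
      have nn: "0 \<le> (2 * C + C * C * \<delta>) * \<bar>t\<bar>" "0 \<le> 2 * C + C * C * \<delta>" "1 \<le> L\<^sup>2"
        using 0(1,2) L1 by simp_all
      have "M * (L\<^sup>2 - 1) * (norm (r y))\<^sup>2 \<le> M * ((2 * C + C * C * \<delta>) * \<bar>t\<bar>) * (n * C * \<bar>t\<bar>)\<^sup>2"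
        using LL nn nr M0 by (intro mult_mono mult_left_mono power_mono mult_nonneg_nonneg) auto
      also have "\<dots> = B * \<bar>t\<bar> ^ 3" by (simp add: B_def power2_eq_square power3_eq_cube)
      finally have "M * (L\<^sup>2 - 1) * (norm (r y))\<^sup>2 \<le> B * \<bar>t\<bar> ^ 3" .
      moreover have "area_density (jac f y + r y) \<ge> area_density (jac f y) + trace (area_flux (jac f y) ** r y)
          - M * (L\<^sup>2 - 1) * (norm (r y))\<^sup>2"
        by (rule area_density_almost_convex[OF op L1 ar])
      ultimately show "area_density (matrix (Dh y)) \<ge> area_density (jac f y)
        + trace (area_flux (jac f y) ** matrix (\<lambda>v. Dh y v - Df y v)) + - B * \<bar>t\<bar> ^ 3 * 1"
        unfolding comparison_jac[OF cmp 0(2) y] r_def[symmetric, THEN fun_cong] by simp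
    qed
    then show "volume_over K (F t) \<ge> volume_over K (F 0) - B * V * \<bar>t\<bar> ^ 3" by (simp add: ac_simps)
  qed
qed


section \<open>The vertical displacement to first order in time\<close>

lemma time_deriv_off:
  assumes "t \<in> U" "x \<in> \<Omega> - K"
  shows "time_deriv F t x = 0"
proof -
  have "((\<lambda>s. (x, f x)) has_vector_derivative 0) (at t)" by (rule has_vector_derivative_const)
  then have "((\<lambda>s. F s x) has_vector_derivative 0) (at t)"
    by (rule has_vector_derivative_transform_within_open[OF _ open_U assms(1)]) (rule F_off[OF _ assms(2), symmetric])
  then show ?thesis unfolding time_deriv_def by (rule vector_derivative_at)
qed

lemma normal_field:
  assumes "x \<in> \<Omega>"
  shows "fst (time_deriv F 0 x) \<bullet> v + snd (time_deriv F 0 x) \<bullet> Df x v = 0"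
proof -
  have "(graph_map f has_derivative (\<lambda>v. (v, Df x v))) (at x)"
    unfolding graph_map_def[abs_def] by (intro has_derivative_Pair has_derivative_ident df assms)
  from frechet_derivative_at[OF this, symmetric]
  have "time_deriv F 0 x \<bullet> (v, Df x v) = 0"
    using nv assms unfolding normal_variation_def by metis
  then show ?thesis by (simp add: inner_prod_def)
qed

text \<open>At the moved point P_t x this is the value of h_t - f. Written through \<open>F\<close>
  and \<open>f\<close> it can be differentiated in time, whereas the maps h_t are produced
  separately for each t.\<close>

definition height :: "real \<Rightarrow> real^'n \<Rightarrow> real^'m" where
  "height t x = snd (F t x) - f (fst (F t x))"

text \<open>If \<open>V = (a, b)\<close> is the variation field, then \<open>height' 0 = b - Df a\<close> is the vertical field that
  differs from \<open>V\<close> by a tangential one.\<close>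

definition height' :: "real \<Rightarrow> real^'n \<Rightarrow> real^'m" where
  "height' t x = snd (time_deriv F t x) - Df (fst (F t x)) (fst (time_deriv F t x))"

text \<open>If b = Df a, the field (a, b) is tangent to the graph; being also normal, it is
  orthogonal to itself.\<close>

lemma height'_nonzero:
  assumes "x \<in> \<Omega>" "time_deriv F 0 x \<noteq> 0"
  shows "height' 0 x \<noteq> 0"
proof
  define a b where "a = fst (time_deriv F 0 x)" and "b = snd (time_deriv F 0 x)"
  assume "height' 0 x = 0"
  then have "b = Df x a" by (simp add: height'_def a_def b_def F_0 assms(1))
  moreover have "a \<bullet> a + b \<bullet> Df x a = 0" using normal_field[OF assms(1)] by (simp add: a_def b_def)
  ultimately have "a \<bullet> a + b \<bullet> b = 0" by simp
  then have "a = 0" "b = 0" by (smt (verit) inner_ge_zero inner_gt_zero_iff)+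
  then show False using assms(2) by (simp add: a_def b_def prod_eq_iff)
qed

lemma height_derivative:
  assumes "t \<in> U" "x \<in> \<Omega>" "fst (F t x) \<in> \<Omega>"
  shows "((\<lambda>s. height s x) has_vector_derivative height' t x) (at t)"
proof -
  have P: "((\<lambda>s. fst (F s x)) has_vector_derivative fst (time_deriv F t x)) (at t)"
    and Q: "((\<lambda>s. snd (F s x)) has_vector_derivative snd (time_deriv F t x)) (at t)"
    by (rule bounded_linear.has_vector_derivative[OF bounded_linear_fst time_derivs(1)[OF assms(1,2)]]
        bounded_linear.has_vector_derivative[OF bounded_linear_snd time_derivs(1)[OF assms(1,2)]])+
  have "((\<lambda>s. f (fst (F s x))) has_vector_derivative Df (fst (F t x)) (fst (time_deriv F t x))) (at t)"
    using has_derivative_compose[where f = "\<lambda>s. fst (F s x)" and g = f, OF P[unfolded has_vector_derivative_def] df[OF assms(3)]]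
    by (simp add: has_vector_derivative_def linear_scale[OF linear_Df[OF assms(3)]])
  with Q show ?thesis unfolding height_def height'_def by (intro has_vector_derivative_diff)
qed

lemma continuous_height':
  assumes V: "V \<subseteq> U" and P: "\<And>t x. t \<in> V \<Longrightarrow> x \<in> \<Omega> \<Longrightarrow> fst (F t x) \<in> \<Omega>"
  shows "joint_continuous V \<Omega> height'"
proof -
  have sub: "V \<times> \<Omega> \<subseteq> U \<times> \<Omega>" using V by blast
  have Dfe: "continuous_on \<Omega> (\<lambda>x. Df x v)" for v
    using C2 unfolding C2_on_def C1_on_def Df_def by blast
  have c1: "continuous_on (V \<times> \<Omega>) (\<lambda>p. Df (fst (F (fst p) (snd p))) v)" for v
    by (rule continuous_on_compose2[OF Dfe])
       (use P in \<open>auto intro!: continuous_intros continuous_on_subset[OF cont_families(1) sub]\<close>)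
  have "continuous_on (V \<times> \<Omega>) (\<lambda>p. snd (time_deriv F (fst p) (snd p)) -
    (\<Sum>i\<in>UNIV. fst (time_deriv F (fst p) (snd p)) $ i *\<^sub>R Df (fst (F (fst p) (snd p))) (axis i 1)))"
    by (intro continuous_intros c1 continuous_on_subset[OF cont_families(2) sub])
  then show ?thesis
  proof (rule continuous_on_eq)
    fix p assume "p \<in> V \<times> \<Omega>"
    then have "fst (F (fst p) (snd p)) \<in> \<Omega>" using P by auto
    from linear_expand_axis[OF linear_Df[OF this], of "fst (time_deriv F (fst p) (snd p))"]
    show "snd (time_deriv F (fst p) (snd p)) -
      (\<Sum>i\<in>UNIV. fst (time_deriv F (fst p) (snd p)) $ i *\<^sub>R Df (fst (F (fst p) (snd p))) (axis i 1))
      = height' (fst p) (snd p)" unfolding height'_def by simp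
  qed
qed

text \<open>A single component that is non-zero at \<open>x0\<close> is kept, since the Poincare
  inequality is scalar. Its non-vanishing set is open and lies in \<open>K\<close>, because the
  variation field vanishes elsewhere; hence \<open>K\<close> contains a box on which the square has
  positive integral. The error is o(t) uniformly on \<open>K\<close>.\<close>

lemma height_expansion:
  assumes x0: "x0 \<in> \<Omega>" "time_deriv F 0 x0 \<noteq> 0"
    and \<delta>: "\<delta> > 0" "{-\<delta>..\<delta>} \<subseteq> U" and P: "\<And>t x. \<bar>t\<bar> \<le> \<delta> \<Longrightarrow> x \<in> \<Omega> \<Longrightarrow> fst (F t x) \<in> \<Omega>"
  obtains a W where "continuous_on K W" "integral K (\<lambda>x. (W x)\<^sup>2) > 0"
    "\<forall>e>0. \<exists>d>0. \<forall>t x. 0 < t \<longrightarrow> t < d \<longrightarrow> x \<in> K \<longrightarrow> \<bar>height t x $ a - t * W x\<bar> \<le> e * t"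
proof -
  obtain a where a: "height' 0 x0 $ a \<noteq> 0"
    using height'_nonzero[OF x0] by (auto simp: vec_eq_iff)
  define W where "W = (\<lambda>x. height' 0 x $ a)"
  define V where "V = {-\<delta><..<\<delta>}"
  have V: "open V" "V \<subseteq> U" "0 \<in> V" using \<delta> by (auto simp: V_def)
  have PV: "\<And>t x. t \<in> V \<Longrightarrow> x \<in> \<Omega> \<Longrightarrow> fst (F t x) \<in> \<Omega>" using P by (auto simp: V_def abs_le_iff)
  have "joint_continuous V \<Omega> height'"
    by (rule continuous_height'[OF V(2) PV])
  then have ch: "continuous_on (V \<times> \<Omega>) (\<lambda>p. height' (fst p) (snd p) $ a)"
    by (intro continuous_intros)
  have cW: "continuous_on \<Omega> W"
    unfolding W_def by (rule slice_continuous[OF ch V(3)])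
  define N where "N = \<Omega> \<inter> W -` (- {0})"
  have N: "open N" unfolding N_def
    by (rule continuous_open_preimage[OF cW open_\<Omega>]) auto
  have "W x = 0" if "x \<in> \<Omega> - K" for x
  proof -
    have "x \<in> \<Omega>" using that by blast
    then show ?thesis
      using time_deriv_off[OF zero_U that] linear_0[OF linear_Df]
      by (simp add: W_def height'_def F_0)
  qed
  then have NK: "N \<subseteq> K" unfolding N_def by auto
  have x0N: "x0 \<in> N" using x0(1) a by (simp add: N_def W_def)
  have cWK: "continuous_on K W" by (rule continuous_on_subset[OF cW K_sub])
  have J: "integral K (\<lambda>x. (W x)\<^sup>2) > 0"
    by (rule integral_square_pos[OF compact_K N x0N NK cWK]) (use a in \<open>simp add: W_def\<close>)
  have sub: "V \<times> K \<subseteq> V \<times> \<Omega>" using K_sub by blast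
  show ?thesis
  proof (rule that[OF cWK J], intro allI impI)
    fix e :: real assume e: "e > 0"
    show "\<exists>d>0. \<forall>t x. 0 < t \<longrightarrow> t < d \<longrightarrow> x \<in> K \<longrightarrow> \<bar>height t x $ a - t * W x\<bar> \<le> e * t"
    proof -
      obtain d where d: "d > 0" "{0 - d..0 + d} \<subseteq> V"
        "\<And>s x. \<bar>s - 0\<bar> \<le> d \<Longrightarrow> x \<in> K \<Longrightarrow> dist (height' s x $ a) (height' 0 x $ a) \<le> e"
        using uniform_in_parameter[OF continuous_on_subset[OF ch sub] V(1) compact_K V(3) e] by metis
      have "\<bar>height t x $ a - t * W x\<bar> \<le> e * t" if t: "0 < t" "t < d" and x: "x \<in> K" for t x
      proof -
        have x\<Omega>: "x \<in> \<Omega>" using x K_sub by blast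
        define g where "g = (\<lambda>s. height s x $ a - s * W x)"
        have "norm (g t - g 0) \<le> e * norm (t - 0)"
        proof (rule field_differentiable_bound[where S = "{0..t}" and f' = "\<lambda>s. height' s x $ a - W x"])
          fix s assume s: "s \<in> {0..t}"
          then have sV: "s \<in> V" using d(2) t by auto
          have "((\<lambda>s. height s x) has_vector_derivative height' s x) (at s)"
            using sV V(2) x\<Omega> by (intro height_derivative PV) auto
          from bounded_linear.has_vector_derivative[OF bounded_linear_vec_nth this, of a]
          have "((\<lambda>s. height s x $ a) has_real_derivative height' s x $ a) (at s)"
            by (simp add: has_real_derivative_iff_has_vector_derivative)
          then have "(g has_real_derivative height' s x $ a - W x) (at s)"
            unfolding g_def by (auto intro!: derivative_eq_intros)
          then show "(g has_real_derivative height' s x $ a - W x) (at s within {0..t})"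
            by (rule has_field_derivative_at_within)
          show "norm (height' s x $ a - W x) \<le> e"
            using d(3)[of s x] s t x by (simp add: dist_real_def W_def)
        qed (use t in auto)
        moreover have "g 0 = 0" by (simp add: g_def height_def F_0 x\<Omega>)
        ultimately show ?thesis using t by (simp add: g_def)
      qed
      then show ?thesis using d(1) by blast
    qed
  qed
qed

section \<open>The quadratic lower bound in the strict case\<close>

lemma uniform_contraction:
  assumes strict: "strictly_distance_decreasing \<Omega> f"
  obtains L where "0 \<le> L" "L < 1" "\<And>y v. y \<in> K \<Longrightarrow> norm (Df y v) \<le> L * norm v"
proof (cases "K = {}")
  case True
  then show ?thesis using that[of 0] by simp
next
  case False
  define S where "S = K \<times> sphere (0 :: real^'n) 1"
  have S: "compact S" unfolding S_def by (intro compact_Times compact_K compact_sphere)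
  have ne: "S \<noteq> {}" using False vector_choose_size[of 1] by (auto simp: S_def)
  have Dfe: "continuous_on K (\<lambda>x. Df x v)" for v
    using C2 K_sub continuous_on_subset unfolding C2_on_def C1_on_def Df_def by blast
  \<comment> \<open>C^1 regularity gives continuity of \<open>Df x v\<close> for fixed
    \<open>v\<close>; expanding \<open>v\<close> in coordinates makes it jointly continuous, so the
    norm attains its maximum over \<open>K\<close> times the unit sphere.\<close>
  have "continuous_on S (\<lambda>p. \<Sum>i\<in>UNIV. snd p $ i *\<^sub>R Df (fst p) (axis i 1))"
    unfolding S_def by (intro continuous_intros continuous_on_compose2[OF Dfe]) auto
  then have "continuous_on S (\<lambda>p. Df (fst p) (snd p))"
  proof (rule continuous_on_eq)
    fix p assume "p \<in> S"
    then have "fst p \<in> \<Omega>" using K_sub by (auto simp: S_def)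
    from linear_expand_axis[OF linear_Df[OF this], of "snd p"]
    show "(\<Sum>i\<in>UNIV. snd p $ i *\<^sub>R Df (fst p) (axis i 1)) = Df (fst p) (snd p)" by simp
  qed
  then have "continuous_on S (\<lambda>p. norm (Df (fst p) (snd p)))" by (rule continuous_on_norm)
  from continuous_attains_sup[OF S ne this] obtain p where p: "p \<in> S"
    "\<And>q. q \<in> S \<Longrightarrow> norm (Df (fst q) (snd q)) \<le> norm (Df (fst p) (snd p))" by blast
  define L where "L = norm (Df (fst p) (snd p))"
  show ?thesis
  proof (rule that[of L])
    show "0 \<le> L" by (simp add: L_def)
    have "fst p \<in> \<Omega>" "norm (snd p) = 1" "snd p \<noteq> 0" using p(1) K_sub by (auto simp: S_def)
    then show "L < 1" using strict unfolding strictly_distance_decreasing_def L_def Df_def by force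
    show "norm (Df y v) \<le> L * norm v" if y: "y \<in> K" for y v
    proof (cases "v = 0")
      case True
      then show ?thesis using linear_0[OF linear_Df] y K_sub by (simp add: subset_iff)
    next
      case False
      have "(y, v /\<^sub>R norm v) \<in> S" using y False by (simp add: S_def)
      from p(2)[OF this] have "norm (Df y (v /\<^sub>R norm v)) \<le> L" by (simp add: L_def)
      moreover have "Df y (v /\<^sub>R norm v) = Df y v /\<^sub>R norm v"
        using linear_scale[OF linear_Df] y K_sub by (simp add: subset_iff)
      ultimately show ?thesis using False by (simp add: field_simps)
    qed
  qed
qed


text \<open>Of the convexity gain k |r|^2 the square of one entry is retained: component
  \<open>a\<close>, in which the field is visible, differentiated in one direction \<open>i\<close>.
  The Poincare inequality turns its integral into that of u^2, and u is uniformly close to t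
  W.\<close>

lemma volume_lower_bound_strict:
  assumes strict: "strictly_distance_decreasing \<Omega> f"
    and x0: "x0 \<in> \<Omega>" "time_deriv F 0 x0 \<noteq> 0"
  obtains \<delta> c where "\<delta> > 0" "c > 0" "\<And>t. 0 < t \<Longrightarrow> t < \<delta> \<Longrightarrow> volume_over K (F t) \<ge> volume_over K (F 0) + c * t\<^sup>2"
proof -
  obtain L0 where L0: "0 \<le> L0" "L0 < 1" "\<And>y v. y \<in> K \<Longrightarrow> norm (Df y v) \<le> L0 * norm v"
    using uniform_contraction[OF strict] by metis
  obtain \<delta> C where cmp: "\<delta> > 0" "C \<ge> 0" "{-\<delta>..\<delta>} \<subseteq> U"
    "\<And>t x. \<bar>t\<bar> \<le> \<delta> \<Longrightarrow> x \<in> \<Omega> \<Longrightarrow> fst (F t x) \<in> \<Omega>"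
    "\<And>t. \<bar>t\<bar> \<le> \<delta> \<Longrightarrow> \<exists>h Dh. comparison C t h Dh"
    using comparison_exists by blast
  obtain a W where W: "continuous_on K W" "integral K (\<lambda>x. (W x)\<^sup>2) > 0"
    and exp: "\<forall>e>0. \<exists>d>0. \<forall>t x. 0 < t \<longrightarrow> t < d \<longrightarrow> x \<in> K \<longrightarrow> \<bar>height t x $ a - t * W x\<bar> \<le> e * t"
  proof (rule height_expansion[OF x0 cmp(1,3,4)])
    fix a W
    assume "continuous_on K W" "integral K (\<lambda>x. (W x)\<^sup>2) > 0"
      "\<forall>e>0. \<exists>d>0. \<forall>t x. 0 < t \<longrightarrow> t < d \<longrightarrow> x \<in> K \<longrightarrow> \<bar>height t x $ a - t * W x\<bar> \<le> e * t"
    then show thesis by (rule that)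
  qed
  define J where "J = integral K (\<lambda>x. (W x)\<^sup>2)"
  have J: "J > 0" using W(2) by (simp add: J_def)
  define v where "v = integral K (\<lambda>x. 1 :: real)"
  have v1: "((\<lambda>x. 1 :: real) has_integral v) K"
    unfolding v_def by (intro integrable_integral integrable_on_compact compact_K continuous_intros)
  define q where "q = v + 1"
  have q: "q > 0" "v \<le> q" using has_integral_nonneg[OF v1] by (simp_all add: q_def)
  \<comment> \<open>The choice makes 4 e^2 v at most J/4, half of the main term J/2;
    \<open>q = v + 1\<close> keeps the quotient defined if \<open>K\<close> has measure
    zero.\<close>
  define e where "e = sqrt (J / (16 * q))"
  have e: "e > 0" using J q by (simp add: e_def)
  have "e\<^sup>2 = J / (16 * q)" using J q by (simp add: e_def)
  then have "e\<^sup>2 * q = J / 16" using q by (simp add: field_simps)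
  then have e2: "e\<^sup>2 * v \<le> J / 16" using mult_left_mono[OF q(2) zero_le_power2[of e]] by simp
  obtain d where d: "d > 0" "\<And>t x. 0 < t \<Longrightarrow> t < d \<Longrightarrow> x \<in> K \<Longrightarrow> \<bar>height t x $ a - t * W x\<bar> \<le> e * t"
    using exp e by blast
  obtain \<delta>' where \<delta>': "\<delta>' > 0" "\<And>x y. x \<in> K \<Longrightarrow> y \<in> K \<Longrightarrow> dist y x < \<delta>' \<Longrightarrow> dist (W y) (W x) < e"
    using compact_uniformly_continuous[OF W(1) compact_K] e unfolding uniformly_continuous_on_def by metis
  define n where "n = real CARD('m) * real CARD('n)"
  have n: "n \<ge> 0" by (simp add: n_def)
  have N: "0 \<le> n + n * C * \<delta>" using n cmp(1,2) by simp
  obtain m where m: "0 < m" "\<And>p :: real^'n^'m. norm p \<le> n + n * C * \<delta> \<Longrightarrow> m \<le> area_density p"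
    using area_density_bounds[OF N] by metis
  obtain R where R: "R > 0" "\<And>x i. x \<in> K \<Longrightarrow> \<bar>x $ i\<bar> \<le> R"
  proof -
    obtain R where R: "R > 0" "\<forall>x\<in>K. norm x \<le> R"
      using compact_imp_bounded[OF compact_K] bounded_pos by metis
    show ?thesis
    proof (rule that[OF R(1)])
      show "\<bar>x $ i\<bar> \<le> R" if "x \<in> K" for x i
        using R(2) that by (intro order_trans[OF component_le_norm_cart]) blast
    qed
  qed
  \<comment> \<open>The midpoint leaves room \<open>L - L0\<close> to absorb the O(t) growth of the
    operator norm.\<close>
  define L where "L = (1 + L0) / 2"
  have L: "0 \<le> L" "L < 1" "L0 < L" using L0 by (auto simp: L_def)
  define k where "k = m * (1 - L\<^sup>2) / 16"
  have "L\<^sup>2 < 1" using L by (simp add: abs_square_less_1)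
  then have k: "k > 0" using m(1) by (simp add: k_def)
  \<comment> \<open>The four bounds serve the existence of the comparison graph, the expansion of
    the height, the uniform continuity of \<open>W\<close> under a shift of length C t, and the
    operator bound L0 + C t <= L.\<close>
  define \<delta>2 where "\<delta>2 = min (min \<delta> d) (min (\<delta>' / (C + 1)) ((L - L0) / (C + 1)))"
  have \<delta>2: "\<delta>2 > 0" using cmp(1,2) d(1) \<delta>'(1) L by (simp add: \<delta>2_def)
  \<comment> \<open>Any coordinate direction works in the Poincare inequality.\<close>
  define i :: "'n" where "i = undefined"
  define c' where "c' = k * (J / 4 / (4 * R\<^sup>2))"
  show ?thesis
  proof (rule that[of \<delta>2 c'])
    show "\<delta>2 > 0" "c' > 0" using \<delta>2 k J R(1) by (simp_all add: c'_def)
    fix t :: real assume t: "0 < t" "t < \<delta>2"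
    have t': "\<bar>t\<bar> \<le> \<delta>" "t < \<delta>' / (C + 1)" "t < d" "t \<le> (L - L0) / (C + 1)"
      using t by (auto simp: \<delta>2_def)
    have "C * t \<le> (C + 1) * ((L - L0) / (C + 1))"
      using t t'(4) cmp(2) by (intro mult_mono) auto
    then have Ct: "C * t \<le> L - L0" using cmp(2) by simp
    obtain h Dh where h: "comparison C t h Dh" using cmp(5)[OF t'(1)] by blast
    define r where "r = (\<lambda>y. matrix (\<lambda>v. Dh y v - Df y v))"
    define u where "u = (\<lambda>y. (if y \<in> \<Omega> then h y - f y else 0) $ a)"
    define u' where "u' = (\<lambda>y v. (if y \<in> K then Dh y v - Df y v else 0) $ a)"
    have du: "(u has_derivative u' y) (at y)" for y
      unfolding u_def u'_def
      by (rule bounded_linear.has_derivative[OF bounded_linear_vec_nth comparison_deriv[OF h cmp(2)]])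
    have u0: "u y = 0" if "y \<notin> K" for y
      unfolding u_def comparison_zero[OF h cmp(2) that] by simp
    have r_entry: "r y $ a $ i = u' y (axis i 1)" if "y \<in> K" for y
      using that by (simp add: r_def u'_def matrix_def)
    have nr: "norm (r y) \<le> n * C * \<bar>t\<bar>" if "y \<in> K" for y
      using comparison_norm[OF h cmp(2) that] unfolding r_def n_def by (simp add: mult.assoc)
    have ub: "\<bar>u' y (axis i 1)\<bar> \<le> n * C * \<bar>t\<bar>" if y: "y \<in> K" for y
      using abs_entry_le_norm_matrix[of "r y" a i] nr[OF y] r_entry[OF y] by simp
    note poincare = poincare_inequality_compact_support[OF compact_K R(2) du u0 ub]
    define I where "I = integral K (\<lambda>y. (u' y (axis i 1))\<^sup>2)"
    have "((\<lambda>y. (u' y (axis i 1))\<^sup>2) has_integral I) K"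
      unfolding I_def by (rule integrable_integral[OF poincare(2)])
    then have "((\<lambda>y. k * (u' y (axis i 1))\<^sup>2) has_integral k * I) K"
      by (rule has_integral_mult_right)
    then have vol: "volume_over K (F t) \<ge> volume_over K (F 0) + k * I"
    proof (rule volume_ge_of_pointwise[OF h cmp(2)])
      fix y assume y: "y \<in> K"
      have op: "norm ((jac f y + s *\<^sub>R r y) *v v) \<le> L * norm v" if "0 \<le> s" "s \<le> 1" for s v
      proof -
        have "norm ((jac f y + s *\<^sub>R r y) *v v) \<le> (L0 + C * \<bar>t\<bar>) * norm v"
          unfolding r_def by (rule comparison_op[OF h cmp(2) y that L0(3)[OF y]])
        also have "\<dots> \<le> L * norm v" using Ct t(1) by (intro mult_right_mono) auto
        finally show ?thesis .
      qed
      have ar: "m \<le> area_density (jac f y + s *\<^sub>R r y)" if "0 \<le> s" "s \<le> 1" for s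
        unfolding r_def by (intro m(2) norm_segment_le[OF h cmp(2) y that t'(1), folded n_def])
      have "area_density (jac f y + r y) \<ge> area_density (jac f y) + trace (area_flux (jac f y) ** r y)
          + m * (1 - L\<^sup>2) / 16 * (norm (r y))\<^sup>2"
        by (rule area_density_strictly_convex[OF op L(1) less_imp_le[OF L(2)] ar less_imp_le[OF m(1)]])
      moreover have "k * (u' y (axis i 1))\<^sup>2 \<le> k * (norm (r y))\<^sup>2"
        using power_mono[OF abs_entry_le_norm_matrix[of "r y" a i] abs_ge_zero, of 2] k r_entry[OF y]
        by (intro mult_left_mono) auto
      ultimately show "area_density (matrix (Dh y)) \<ge> area_density (jac f y)
        + trace (area_flux (jac f y) ** matrix (\<lambda>v. Dh y v - Df y v)) + k * (u' y (axis i 1))\<^sup>2"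
        unfolding comparison_jac[OF h cmp(2) y] r_def[symmetric, THEN fun_cong] k_def by linarith
    qed
    have "C * t \<le> (C + 1) * t" using t(1) by simp
    also have "\<dots> < \<delta>'" using t'(2) cmp(2) by (simp add: less_divide_eq mult.commute)
    finally have Ct': "C * t < \<delta>'" .
    \<comment> \<open>The expansion of the height is based at x, while u is evaluated at y = P_t x.
      One e t comes from the expansion, the other from replacing W x by W y.\<close>
    have est: "\<bar>u y - t * W y\<bar> \<le> 2 * e * t" if y: "y \<in> K" for y
    proof -
      obtain x where x: "x \<in> K" "y = fst (F t x)" using h y unfolding comparison_def by blast
      have "x \<in> \<Omega>" "y \<in> \<Omega>" using x(1) y K_sub by auto
      then have "u y = height t x $ a"
        using h x(2) unfolding comparison_def by (simp add: u_def height_def)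
      moreover have "norm (y - x) \<le> C * t" using h x t(1) unfolding comparison_def by auto
      then have "dist (W y) (W x) < e" using Ct' by (intro \<delta>'(2) x(1) y) (simp add: dist_norm)
      then have "t * \<bar>W x - W y\<bar> \<le> t * e" using t(1) by (intro mult_left_mono) (auto simp: dist_real_def)
      then have "\<bar>t * W x - t * W y\<bar> \<le> e * t"
        using t(1) by (simp add: abs_mult mult.commute flip: right_diff_distrib)
      ultimately show ?thesis using d(2)[OF t(1) t'(3) x(1)] by linarith
    qed
    have W2: "((\<lambda>x. (W x)\<^sup>2) has_integral J) K"
      unfolding J_def by (intro integrable_integral integrable_on_compact compact_K continuous_intros W)
    have low: "((\<lambda>x. t\<^sup>2 / 2 * (W x)\<^sup>2 - 4 * e\<^sup>2 * t\<^sup>2 * 1) has_integral t\<^sup>2 / 2 * J - 4 * e\<^sup>2 * t\<^sup>2 * v) K"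
      by (intro has_integral_diff has_integral_mult_right W2 v1)
    have "t\<^sup>2 / 2 * J - 4 * e\<^sup>2 * t\<^sup>2 * v \<le> integral K (\<lambda>y. (u y)\<^sup>2)"
    proof (rule has_integral_le[OF low integrable_integral[OF poincare(1)]])
      fix y assume y: "y \<in> K"
      \<comment> \<open>This bound is combined with u^2 >= (t W)^2 / 2 - (u - t W)^2, which is the
        non-negativity of (2u - t W)^2 halved.\<close>
      have "(u y - t * W y)\<^sup>2 \<le> (2 * e * t)\<^sup>2"
        using power_mono[OF est[OF y] abs_ge_zero, of 2] by simp
      moreover have "0 \<le> (2 * u y - t * W y)\<^sup>2" by simp
      ultimately show "t\<^sup>2 / 2 * (W y)\<^sup>2 - 4 * e\<^sup>2 * t\<^sup>2 * 1 \<le> (u y)\<^sup>2"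
        by (simp add: power2_eq_square algebra_simps)
    qed
    moreover have "4 * e\<^sup>2 * t\<^sup>2 * v \<le> J / 4 * t\<^sup>2"
      using mult_right_mono[OF e2, of "t\<^sup>2"] by (simp add: ac_simps)
    ultimately have "J / 4 * t\<^sup>2 \<le> integral K (\<lambda>y. (u y)\<^sup>2)" by (simp add: algebra_simps)
    also have "\<dots> \<le> 4 * R\<^sup>2 * I" unfolding I_def by (rule poincare(3))
    finally have "J / 4 / (4 * R\<^sup>2) * t\<^sup>2 \<le> I" using R(1) by (simp add: field_simps)
    then have "k * (J / 4 / (4 * R\<^sup>2) * t\<^sup>2) \<le> k * I" using k by (intro mult_left_mono) auto
    then show "volume_over K (F t) \<ge> volume_over K (F 0) + c' * t\<^sup>2"
      using vol unfolding c'_def mult.assoc[of k] by linarith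
  qed
qed

section \<open>The sign of the second derivative\<close>

lemma second_derivative_volume_nonneg:
  "\<exists>A. has_second_derivative (\<lambda>t. volume_over K (F t)) A 0 \<and> A \<ge> 0"
proof -
  obtain A where A: "has_second_derivative (\<lambda>t. volume_over K (F t)) A 0"
    using volume_has_second_derivative by blast
  obtain \<delta> C where "\<delta> > 0" "\<And>t. \<bar>t\<bar> < \<delta> \<Longrightarrow> volume_over K (F t) \<ge> volume_over K (F 0) - C * \<bar>t\<bar> ^ 3"
    using volume_lower_bound by blast
  then have "\<delta> > 0" and low: "\<And>t. \<bar>t\<bar> < \<delta> \<Longrightarrow> volume_over K (F t) \<ge> volume_over K (F 0) - C * \<bar>t\<bar> ^ 3"
    by blast+
  have "A \<ge> 2 * 0"
  proof (rule second_derivative_ge[OF A \<open>\<delta> > 0\<close> low])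
    show "volume_over K (F t) \<ge> volume_over K (F 0) + 0 * t\<^sup>2 - C * t ^ 3" if "0 < t" "t < \<delta>" for t
      using low[of t] that by simp
  qed
  with A show ?thesis by auto
qed

lemma second_derivative_volume_pos:
  assumes "strictly_distance_decreasing \<Omega> f" "x0 \<in> \<Omega>" "time_deriv F 0 x0 \<noteq> 0"
  shows "\<exists>A. has_second_derivative (\<lambda>t. volume_over K (F t)) A 0 \<and> A > 0"
proof -
  obtain A where A: "has_second_derivative (\<lambda>t. volume_over K (F t)) A 0"
    using volume_has_second_derivative by blast
  obtain \<delta> C where 1: "\<delta> > 0" "\<And>t. \<bar>t\<bar> < \<delta> \<Longrightarrow> volume_over K (F t) \<ge> volume_over K (F 0) - C * \<bar>t\<bar> ^ 3"
    using volume_lower_bound by blast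
  obtain \<delta>' c where 2: "\<delta>' > 0" "c > 0"
    "\<And>t. 0 < t \<Longrightarrow> t < \<delta>' \<Longrightarrow> volume_over K (F t) \<ge> volume_over K (F 0) + c * t\<^sup>2"
    using volume_lower_bound_strict[OF assms] by blast
  \<comment> \<open>The quadratic bound concerns t > 0 only, so the two-sided cubic bound is still
    used to make the first derivative vanish. Taking |C| lets both bounds share one constant, as
    subtracting |C| t^3 weakens the quadratic one.\<close>
  have "A \<ge> 2 * c"
  proof (rule second_derivative_ge[OF A, of "min \<delta> \<delta>'" "\<bar>C\<bar>" c])
    show "min \<delta> \<delta>' > 0" using 1(1) 2(1) by simp
    fix t :: real
    have "C * \<bar>t\<bar> ^ 3 \<le> \<bar>C\<bar> * \<bar>t\<bar> ^ 3" by (intro mult_right_mono) auto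
    then show "volume_over K (F t) \<ge> volume_over K (F 0) - \<bar>C\<bar> * \<bar>t\<bar> ^ 3" if "\<bar>t\<bar> < min \<delta> \<delta>'"
      using 1(2)[of t] that by simp
    show "volume_over K (F t) \<ge> volume_over K (F 0) + c * t\<^sup>2 - \<bar>C\<bar> * t ^ 3" if "0 < t" "t < min \<delta> \<delta>'"
    proof -
      have "0 \<le> \<bar>C\<bar> * t ^ 3" using that(1) by simp
      then show ?thesis using 2(3)[of t] that by linarith
    qed
  qed
  with A 2(2) show ?thesis by (intro exI[of _ A]) auto
qed

end

theorem theoremA:
  fixes \<Omega> :: "(real^'n) set" and f :: "real^'n \<Rightarrow> real^'m"
  assumes "open \<Omega>" and "connected \<Omega>" and "\<Omega> \<noteq> {}" and "bounded \<Omega>"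
    and "minimal_surface_solution \<Omega> f"
    and "distance_decreasing \<Omega> f"
  shows "stable_immersion \<Omega> (graph_map f) \<and>
    (strictly_distance_decreasing \<Omega> f \<longrightarrow> strictly_stable_immersion \<Omega> (graph_map f))"
proof -
  have var: "graph_variation \<Omega> f \<epsilon> K F" if "normal_variation \<Omega> (graph_map f) \<epsilon> K F" for \<epsilon> K F
    using assms that by unfold_locales
  show ?thesis
    unfolding stable_immersion_def strictly_stable_immersion_def
    using graph_variation.second_derivative_volume_nonneg[OF var]
      graph_variation.second_derivative_volume_pos[OF var] by blast
qed

end
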